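(* Let $\alpha_1,\mu_1\in\mathbb R$ and let $m\ge2$ be an integer. Consider the equation $$\partial_t u+u\,u_{xxx}+\alpha_1u_xu_{xx}+\frac{\mu_1}{m}(u^m)_x=0 \qquad (\ast)$$ for real-valued $u$ on $\mathbb T$. Let $\sigma_c=-(\alpha_1-\frac32)$ and $s_c=\max\{5,\lfloor\sigma_c-\frac12\rfloor+1\}$. For any $\epsilon>0$ and integers $s_c\le s\le s_0$ with $s$ even, there exists initial data $u_0\in C^\infty(\mathbb T)$ with $\|u_0\|_{C^{s_0}}<\epsilon$ for which there is no solution of $(\ast)$ with $u(0)=u_0$ belonging to $L^\infty([0,\delta];C^{s}(\mathbb T))$, for any $\delta>0$.
   Context: $\mathbb T$ is the one-dimensional torus; $C^{s}$ denotes $s$ times continuously differentiable functions with the usual norm. *)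

theory Defs
  imports "HOL-Analysis.Analysis"
begin

definition torus_fun :: "(real \<Rightarrow> real) \<Rightarrow> bool" where
  "torus_fun f \<longleftrightarrow> (\<forall>x. f (x + 2 * pi) = f x)"

definition Ck :: "nat \<Rightarrow> (real \<Rightarrow> real) \<Rightarrow> bool" where
  "Ck k f \<longleftrightarrow>
     (\<forall>j<k. \<forall>x. ((deriv ^^ j) f has_real_derivative (deriv ^^ (Suc j)) f x) (at x)) \<and>
     continuous_on UNIV ((deriv ^^ k) f)"

definition smooth_fun :: "(real \<Rightarrow> real) \<Rightarrow> bool" where
  "smooth_fun f \<longleftrightarrow> (\<forall>k. Ck k f)"

definition Cnorm :: "nat \<Rightarrow> (real \<Rightarrow> real) \<Rightarrow> real" where
  "Cnorm s f = (\<Sum>j\<le>s. (SUP x. \<bar>(deriv ^^ j) f x\<bar>))"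

definition nonlin :: "real \<Rightarrow> real \<Rightarrow> nat \<Rightarrow> (real \<Rightarrow> real) \<Rightarrow> real \<Rightarrow> real" where
  "nonlin \<alpha>1 \<mu>1 m v x =
     v x * (deriv ^^ 3) v x + \<alpha>1 * deriv v x * (deriv ^^ 2) v x
     + \<mu>1 / real m * deriv (\<lambda>y. (v y) ^ m) x"

text \<open>u : [0,delta] -> C^s(T) lies in L^infinity([0,delta]; C^s(T)) and solves the equation
  with u(0) = u0 in the (time-)integrated sense:
  u(t,x) = u0(x) - int_0^t N(u(tau))(x) dtau for a.e. t in [0,delta].\<close>
definition is_Linf_Cs_solution ::
  "real \<Rightarrow> real \<Rightarrow> nat \<Rightarrow> (real \<Rightarrow> real) \<Rightarrow> real \<Rightarrow> nat \<Rightarrow> (real \<Rightarrow> real \<Rightarrow> real) \<Rightarrow> bool" where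
  "is_Linf_Cs_solution \<alpha>1 \<mu>1 m u0 \<delta> s u \<longleftrightarrow>
     (\<exists>M. AE t in lborel. t \<in> {0..\<delta>} \<longrightarrow>
        torus_fun (u t) \<and> Ck s (u t) \<and> (\<forall>j\<le>s. \<forall>x. \<bar>(deriv ^^ j) (u t) x\<bar> \<le> M)) \<and>
     (AE t in lborel. t \<in> {0..\<delta>} \<longrightarrow>
        (\<forall>x. set_integrable lborel {0..t} (\<lambda>\<tau>. nonlin \<alpha>1 \<mu>1 m (u \<tau>) x) \<and>
             u t x = u0 x - (LINT \<tau>:{0..t}|lborel. nonlin \<alpha>1 \<mu>1 m (u \<tau>) x)))"

definition sigma_c :: "real \<Rightarrow> real" where
  "sigma_c \<alpha>1 = - (\<alpha>1 - 3/2)"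

definition s_c :: "real \<Rightarrow> int" where
  "s_c \<alpha>1 = max 5 (\<lfloor>sigma_c \<alpha>1 - 1/2\<rfloor> + 1)"

end

theory Submission
  imports Defs "HOL-Real_Asymp.Real_Asymp"
begin

text \<open>
  Take data close to \<open>e sin\<^sup>3 x\<close>. The triple zeros at \<open>0\<close> and \<open>\<pi>\<close> persist, so near \<open>0\<close> the equation is
  \<open>u\<^sub>t + e x\<^sup>3 u\<^sub>x\<^sub>x\<^sub>x + \<dots> = 0\<close>, which in \<open>z = ln x\<close> is Airy-like: a packet of frequency \<open>N\<close> moves towards
  \<open>x = 0\<close> with speed \<open>3 e N\<^sup>2\<close>. For the difference \<open>w\<close> of two solutions the energy
  \<open>\<integral> u powr (2 \<alpha> / 3 - 1) * w\<^sup>2\<close> is almost conserved on \<open>(0, \<pi>)\<close>, and it is finite exactly because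
  \<open>w = O(x\<^sup>s)\<close> and \<open>s + \<alpha> > 1\<close>. Testing \<open>w\<close> against an explicit travelling packet shows that a
  packet in \<open>w(0)\<close> would still be visible after it has moved to scale \<open>x = l exp (- j\<^sup>2)\<close>; there it
  contradicts \<open>w = O(x\<^sup>s)\<close>, since its amplitude is only \<open>exp (- j)\<close>.

  Hence put infinitely many packets into the data, switched on and off by \<open>c \<in> {0, 1}\<^sup>\<nat>\<close>. Two
  sequences whose data have solutions with the same bound on the same time interval first
  differ at a bounded index, so only finitely many sequences belong to each such bound, and
  only countably many have any solution at all.
\<close>

section \<open>From integrated to classical solutions\<close>

text \<open>No existence theory is invoked, so there is no reference solution: all estimates concern
  two hypothetical solutions, and their constants depend on the common bound \<open>M\<close>, the
  common time \<open>\<delta>\<close> and the fixed parameters, never on the pair or on the packet.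
  The counting needs exactly this uniformity. The obstacle is regularity. A solution has s space
  derivatives and the equation costs three, so it cannot be differentiated often enough to propagate
  w = O(x^s) through the jets at the zeros. The order of vanishing is read off the undifferentiated
  equation at distance h from a zero as h tends to 0, which works because the coefficients vanish
  there to matching orders. The threshold: at distance x from a zero the flux of the weighted energy
  is of size x powr (2 (s + \<alpha> - 1)), and a packet arriving at scale L pairs with w to at most
  L powr (s + \<alpha> - 1) up to a constant. Both become small because s + \<alpha> > 1, which is
  what \<open>s_c\<close> provides.\<close>

definition Nl :: "real \<Rightarrow> real \<Rightarrow> nat \<Rightarrow> (nat \<Rightarrow> real) \<Rightarrow> real" where
  "Nl \<alpha> \<mu> m v = v 0 * v 3 + \<alpha> * v 1 * v 2 + \<mu> * v 0 ^ (m - 1) * v 1"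

text \<open>\<open>U k\<close> plays the k-th space derivative of a solution, at every time of a
  closed interval. Only orders below \<open>s\<close> are kept as functions: a bound on the s-th
  derivative at almost every time passes to limits in time merely as the Lipschitz bound on
  \<open>U (s - 1)\<close>. The equation stays integrated in time, a form that survives the same
  limit.\<close>

definition classical ::
  "real \<Rightarrow> real \<Rightarrow> nat \<Rightarrow> nat \<Rightarrow> real \<Rightarrow> real \<Rightarrow> (nat \<Rightarrow> real \<Rightarrow> real \<Rightarrow> real) \<Rightarrow> bool" where
  "classical \<alpha> \<mu> m s M \<delta> U \<longleftrightarrow>
     (\<forall>k<s. continuous_on ({0..\<delta>} \<times> UNIV) (\<lambda>(t, x). U k t x)) \<and>
     (\<forall>k<s. \<forall>t\<in>{0..\<delta>}. \<forall>x. \<bar>U k t x\<bar> \<le> M) \<and>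
     (\<forall>k<s. \<forall>t\<in>{0..\<delta>}. \<forall>x y. \<bar>U k t x - U k t y\<bar> \<le> M * \<bar>x - y\<bar>) \<and>
     (\<forall>k. Suc k < s \<longrightarrow> (\<forall>t\<in>{0..\<delta>}. \<forall>x. (U k t has_real_derivative U (Suc k) t x) (at x))) \<and>
     (\<forall>t\<in>{0..\<delta>}. \<forall>x. U 0 t x = U 0 0 x - integral {0..t} (\<lambda>\<tau>. Nl \<alpha> \<mu> m (\<lambda>k. U k \<tau> x)))"

lemma AE_lborel_obtain_between:
  fixes a b :: real
  assumes "AE t in lborel. Q t" "a < b"
  obtains t where "a < t" "t < b" "Q t"
proof -
  have "\<exists>t. a < t \<and> t < b \<and> Q t"
  proof (rule ccontr)
    assume *: "\<not> ?thesis"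
    have "AE t in lborel. \<not> (a < t \<and> t < b)"
      using assms(1) by eventually_elim (use * in auto)
    then have "emeasure lborel {a<..<b} = 0"
      by (subst (asm) AE_iff_measurable[where N = "{a<..<b}"]) auto
    then show False using assms(2) by simp
  qed
  then show thesis using that by blast
qed

text \<open>The mean value theorem over a step \<open>h\<close> finds a point where the derivative
  is at most \<open>2 * a / h\<close>; Lipschitz continuity carries this back to \<open>x\<close> at
  cost \<open>L * h\<close>. It turns smallness of a function into smallness of its
  derivative.\<close>

lemma derivative_interpolation:
  fixes f f1 :: "real \<Rightarrow> real"
  assumes d: "\<And>x. (f has_real_derivative f1 x) (at x)"
    and lip: "\<And>x y. \<bar>f1 x - f1 y\<bar> \<le> L * \<bar>x - y\<bar>"
    and a: "\<And>x. \<bar>f x\<bar> \<le> a" and h: "h > 0"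
  shows "\<bar>f1 x\<bar> \<le> 2 * a / h + L * h"
proof -
  obtain z where z: "x < z" "z < x + h" "f (x + h) - f x = h * f1 z"
    using MVT2[of x "x + h" f f1] d h by auto
  have L0: "L \<ge> 0" using lip[of 1 0] by auto
  have "\<bar>h * f1 z\<bar> \<le> 2 * a"
    using z(3) a[of "x + h"] a[of x] by linarith
  then have "h * \<bar>f1 z\<bar> \<le> 2 * a"
    using h by (simp add: abs_mult)
  then have "\<bar>f1 z\<bar> \<le> 2 * a / h" using h by (simp add: field_simps)
  moreover have "\<bar>f1 x - f1 z\<bar> \<le> L * h"
    using lip[of x z] z(1,2) L0 by (smt (verit) mult_left_mono)
  ultimately show ?thesis by linarith
qed

lemma Nl_abs_le:
  assumes "\<And>k. k \<le> 3 \<Longrightarrow> \<bar>v k\<bar> \<le> M"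
  shows "\<bar>Nl \<alpha> \<mu> m v\<bar> \<le> M * M + \<bar>\<alpha>\<bar> * M * M + \<bar>\<mu>\<bar> * M ^ (m - 1) * M"
proof -
  have M0: "0 \<le> M" using assms[of 0] by auto
  have "\<bar>v 0 * v 3\<bar> \<le> M * M" using assms[of 0] assms[of 3] M0 by (simp add: abs_mult mult_mono)
  moreover have "\<bar>\<alpha> * v 1 * v 2\<bar> \<le> \<bar>\<alpha>\<bar> * M * M"
    using assms[of 1] assms[of 2] M0 by (simp add: abs_mult mult_mono)
  moreover have "\<bar>\<mu> * v 0 ^ (m - 1) * v 1\<bar> \<le> \<bar>\<mu>\<bar> * M ^ (m - 1) * M"
    using assms[of 0] assms[of 1] M0 by (simp add: abs_mult power_abs mult_mono power_mono)
  ultimately show ?thesis unfolding Nl_def by linarith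
qed

lemma nonlin_eq_Nl:
  assumes "Ck s v" "s \<ge> 3" "m \<ge> 1"
  shows "nonlin \<alpha> \<mu> m v x = Nl \<alpha> \<mu> m (\<lambda>k. (deriv ^^ k) v x)"
proof -
  have "(v has_real_derivative deriv v x) (at x)"
    using assms(1,2) unfolding Ck_def by (auto dest!: spec[of _ "0::nat"])
  then have "((\<lambda>y. v y ^ m) has_real_derivative (of_nat m * v x ^ (m - 1) * deriv v x)) (at x)"
    by (auto intro!: derivative_eq_intros)
  then have "deriv (\<lambda>y. v y ^ m) x = of_nat m * v x ^ (m - 1) * deriv v x"
    by (rule DERIV_imp_deriv)
  then show ?thesis using assms(3) by (simp add: nonlin_def Nl_def)
qed

lemma Ck_lipschitz:
  assumes "Ck s v" "\<forall>j\<le>s. \<forall>x. \<bar>(deriv ^^ j) v x\<bar> \<le> M" "k < s"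
  shows "\<bar>(deriv ^^ k) v x - (deriv ^^ k) v y\<bar> \<le> M * \<bar>x - y\<bar>"
proof -
  have d: "((deriv ^^ k) v has_real_derivative (deriv ^^ Suc k) v z) (at z)" for z
    using assms(1,3) by (simp add: Ck_def del: funpow.simps)
  have b: "norm ((deriv ^^ Suc k) v z) \<le> M" for z
    using assms(2,3) by (simp add: Suc_le_eq del: funpow.simps)
  have "norm ((deriv ^^ k) v x - (deriv ^^ k) v y) \<le> M * norm (x - y)"
    by (rule field_differentiable_bound[of UNIV _ "(deriv ^^ Suc k) v"]) (use d b in auto)
  then show ?thesis by simp
qed

text \<open>The equation controls the time variation of \<open>u 0\<close> only. Each further order
  inherits uniform continuity in time from the previous one, by interpolation against the Lipschitz
  bound in space.\<close>

lemma uniform_continuity_extension: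
  fixes u :: "nat \<Rightarrow> real \<Rightarrow> real \<Rightarrow> real"
  assumes lipt: "\<And>t t' x. t \<in> S \<Longrightarrow> t' \<in> S \<Longrightarrow> \<bar>u 0 t x - u 0 t' x\<bar> \<le> C * \<bar>t - t'\<bar>"
    and lipx: "\<And>k t x y. k < s \<Longrightarrow> t \<in> S \<Longrightarrow> \<bar>u k t x - u k t y\<bar> \<le> M * \<bar>x - y\<bar>"
    and der: "\<And>k t x. Suc k < s \<Longrightarrow> t \<in> S \<Longrightarrow> (u k t has_real_derivative u (Suc k) t x) (at x)"
    and k: "k < s" and e: "e > 0"
  shows "\<exists>d>0. \<forall>t\<in>S. \<forall>t'\<in>S. \<bar>t - t'\<bar> < d \<longrightarrow> (\<forall>x. \<bar>u k t x - u k t' x\<bar> \<le> e)"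
  using k e
proof (induction k arbitrary: e)
  case 0
  have "\<bar>u 0 t x - u 0 t' x\<bar> \<le> e" if "t \<in> S" "t' \<in> S" "\<bar>t - t'\<bar> < e / (\<bar>C\<bar> + 1)" for t t' x
  proof -
    have "\<bar>u 0 t x - u 0 t' x\<bar> \<le> C * \<bar>t - t'\<bar>" using lipt that by blast
    also have "\<dots> \<le> (\<bar>C\<bar> + 1) * \<bar>t - t'\<bar>" by (intro mult_right_mono) auto
    also have "\<dots> \<le> e" using that(3) by (simp add: field_simps)
    finally show ?thesis .
  qed
  moreover have "e / (\<bar>C\<bar> + 1) > 0" using 0 by (intro divide_pos_pos) auto
  ultimately show ?case by blast
next
  case (Suc k)
  \<comment> \<open>With this \<open>h\<close> the Lipschitz term of the interpolation costs at most
    \<open>e / 2\<close>; the bound \<open>e * h / 4\<close> requested from the induction hypothesis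
    makes the other term \<open>e / 2\<close> as well.\<close>
  define h where "h = e / (2 * (2 * \<bar>M\<bar> + 1))"
  have h: "h > 0" using Suc.prems by (auto simp: h_def intro!: divide_pos_pos)
  have Mh: "2 * \<bar>M\<bar> * h \<le> e / 2" using Suc.prems(2) by (auto simp: h_def field_simps)
  obtain d where d: "d > 0"
    "\<And>t t' x. t \<in> S \<Longrightarrow> t' \<in> S \<Longrightarrow> \<bar>t - t'\<bar> < d \<Longrightarrow> \<bar>u k t x - u k t' x\<bar> \<le> e * h / 4"
    using Suc.IH[of "e * h / 4"] Suc.prems h by (auto intro!: mult_pos_pos)
  have "\<bar>u (Suc k) t x - u (Suc k) t' x\<bar> \<le> e" if "t \<in> S" "t' \<in> S" "\<bar>t - t'\<bar> < d" for t t' x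
  proof -
    have "\<bar>u (Suc k) t x - u (Suc k) t' x\<bar> \<le> 2 * (e * h / 4) / h + (2 * \<bar>M\<bar>) * h"
    proof -
      have D: "((\<lambda>x. u k t x - u k t' x) has_real_derivative u (Suc k) t z - u (Suc k) t' z) (at z)" for z
        using der that Suc.prems(1) by (intro DERIV_diff) auto
      have L: "\<bar>u (Suc k) t z - u (Suc k) t' z - (u (Suc k) t y - u (Suc k) t' y)\<bar> \<le> 2 * \<bar>M\<bar> * \<bar>z - y\<bar>" for z y
      proof -
        have "\<bar>u (Suc k) t z - u (Suc k) t y\<bar> \<le> M * \<bar>z - y\<bar>" "\<bar>u (Suc k) t' z - u (Suc k) t' y\<bar> \<le> M * \<bar>z - y\<bar>"
          using lipx that Suc.prems(1) by auto
        moreover have "M * \<bar>z - y\<bar> \<le> \<bar>M\<bar> * \<bar>z - y\<bar>" by (intro mult_right_mono) auto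
        ultimately show ?thesis by linarith
      qed
      have B: "\<bar>u k t z - u k t' z\<bar> \<le> e * h / 4" for z using d(2) that by auto
      show ?thesis by (rule derivative_interpolation[OF D L B h])
    qed
    also have "\<dots> \<le> e" using Mh h by simp
    finally show ?thesis .
  qed
  then show ?case using d(1) by blast
qed

lemma set_integral_diff_le:
  fixes f :: "real \<Rightarrow> real"
  assumes int: "set_integrable lborel {0..t1} f"
    and AE: "AE \<tau> in lborel. \<tau> \<in> {0..t1} \<longrightarrow> \<bar>f \<tau>\<bar> \<le> C"
    and t: "0 \<le> t" "t \<le> t'" "t' \<le> t1"
  shows "\<bar>(LINT \<tau>:{0..t'}|lborel. f \<tau>) - (LINT \<tau>:{0..t}|lborel. f \<tau>)\<bar> \<le> C * (t' - t)"
proof -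
  have i1: "set_integrable lborel {0..t} f" and i2: "set_integrable lborel {t<..t'} f"
    using t by (auto intro!: set_integrable_subset[OF int])
  have "(LINT \<tau>:{0..t} \<union> {t<..t'}|lborel. f \<tau>) = (LINT \<tau>:{0..t}|lborel. f \<tau>) + (LINT \<tau>:{t<..t'}|lborel. f \<tau>)"
    by (rule set_integral_Un) (use i1 i2 in auto)
  moreover have "{0..t} \<union> {t<..t'} = {0..t'}" using t by auto
  ultimately have eq: "(LINT \<tau>:{0..t'}|lborel. f \<tau>) - (LINT \<tau>:{0..t}|lborel. f \<tau>) = (LINT \<tau>:{t<..t'}|lborel. f \<tau>)"
    by simp
  have "norm (LINT \<tau>:{t<..t'}|lborel. f \<tau>) \<le> (\<integral>\<tau>. norm (indicator {t<..t'} \<tau> *\<^sub>R f \<tau>) \<partial>lborel)"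
    unfolding set_lebesgue_integral_def by (rule integral_norm_bound)
  also have "\<dots> \<le> (\<integral>\<tau>. indicator {t<..t'} \<tau> *\<^sub>R C \<partial>lborel)"
  proof (rule integral_mono_AE)
    show "integrable lborel (\<lambda>\<tau>. norm (indicator {t<..t'} \<tau> *\<^sub>R f \<tau>))"
      using i2 unfolding set_integrable_def by (rule integrable_norm)
    show "integrable lborel (\<lambda>\<tau>. indicator {t<..t'} \<tau> *\<^sub>R C)"
      by (intro integrable_scaleR_left integrable_real_indicator) (use t in auto)
    show "AE \<tau> in lborel. norm (indicator {t<..t'} \<tau> *\<^sub>R f \<tau>) \<le> indicator {t<..t'} \<tau> *\<^sub>R C"
      using AE by eventually_elim (use t in \<open>auto simp: indicator_def\<close>)
  qed
  also have "\<dots> = C * (t' - t)"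
    using t by simp
  finally show ?thesis unfolding eq by simp
qed

text \<open>Exceptional times are thrown away. On the remaining dense set all orders below
  \<open>s\<close> are uniformly continuous, so they extend to the closed interval, and the
  properties in \<open>classical\<close> pass to the extension as closed conditions.\<close>

lemma classical_of_solution:
  assumes sol: "is_Linf_Cs_solution \<alpha> \<mu> m u0 \<delta> s u" and "\<delta> > 0" "s \<ge> 4" "m \<ge> 1"
  obtains M U where "classical \<alpha> \<mu> m s M (\<delta> / 2) U" "\<And>x. U 0 0 x = u0 x"
proof -
  obtain M where M: "AE t in lborel. t \<in> {0..\<delta>} \<longrightarrow>
        torus_fun (u t) \<and> Ck s (u t) \<and> (\<forall>j\<le>s. \<forall>x. \<bar>(deriv ^^ j) (u t) x\<bar> \<le> M)"
    and eqn: "AE t in lborel. t \<in> {0..\<delta>} \<longrightarrow>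
        (\<forall>x. set_integrable lborel {0..t} (\<lambda>\<tau>. nonlin \<alpha> \<mu> m (u \<tau>) x) \<and>
             u t x = u0 x - (LINT \<tau>:{0..t}|lborel. nonlin \<alpha> \<mu> m (u \<tau>) x))"
    using sol unfolding is_Linf_Cs_solution_def by blast
  define good where "good t \<longleftrightarrow> t \<in> {0..\<delta>} \<and> Ck s (u t) \<and> (\<forall>j\<le>s. \<forall>x. \<bar>(deriv ^^ j) (u t) x\<bar> \<le> M) \<and>
        (\<forall>x. set_integrable lborel {0..t} (\<lambda>\<tau>. nonlin \<alpha> \<mu> m (u \<tau>) x) \<and>
             u t x = u0 x - (LINT \<tau>:{0..t}|lborel. nonlin \<alpha> \<mu> m (u \<tau>) x))" for t
  have AEg: "AE t in lborel. t \<in> {0..\<delta>} \<longrightarrow> good t"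
    using M eqn by eventually_elim (auto simp: good_def)
  \<comment> \<open>A single good time beyond \<open>\<delta> / 2\<close> supplies integrability of
    the nonlinearity over every time interval compared below; hence the halved interval.\<close>
  obtain t1 where t1: "\<delta> / 2 < t1" "t1 < \<delta>" "good t1"
  proof (rule AE_lborel_obtain_between[OF AEg, of "\<delta> / 2" \<delta>])
    show "\<delta> / 2 < \<delta>" using \<open>\<delta> > 0\<close> by simp
  qed (use that \<open>\<delta> > 0\<close> in auto)
  define C where "C = M * M + \<bar>\<alpha>\<bar> * M * M + \<bar>\<mu>\<bar> * M ^ (m - 1) * M"
  have nl: "nonlin \<alpha> \<mu> m (u t) x = Nl \<alpha> \<mu> m (\<lambda>k. (deriv ^^ k) (u t) x)" if "good t" for t x
    using nonlin_eq_Nl[of s "u t"] that assms by (auto simp: good_def)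
  have nlC: "\<bar>nonlin \<alpha> \<mu> m (u t) x\<bar> \<le> C" if "good t" for t x
    unfolding nl[OF that] C_def using that assms by (intro Nl_abs_le) (auto simp: good_def)
  have int1: "set_integrable lborel {0..t1} (\<lambda>\<tau>. nonlin \<alpha> \<mu> m (u \<tau>) x)" for x
    using t1 by (auto simp: good_def)
  define S where "S = {t. t \<le> \<delta> / 2 \<and> good t}"
  define B where "B k t x = (deriv ^^ k) (u t) x" for k t x
  have lip0: "\<bar>B 0 t x - B 0 t' x\<bar> \<le> C * \<bar>t - t'\<bar>" if "t \<in> S" "t' \<in> S" for t t' x
  proof -
    have AE1: "AE \<tau> in lborel. \<tau> \<in> {0..t1} \<longrightarrow> \<bar>nonlin \<alpha> \<mu> m (u \<tau>) x\<bar> \<le> C"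
      using AEg by eventually_elim (use t1 nlC in auto)
    have *: "\<bar>u t x - u t' x\<bar> \<le> C * \<bar>t - t'\<bar>" if "t \<in> S" "t' \<in> S" "t \<le> t'" for t t'
    proof -
      have "0 \<le> t" "t' \<le> t1" using that t1 by (auto simp: S_def good_def)
      from set_integral_diff_le[OF int1 AE1 this(1) that(3) this(2)]
      have "\<bar>(LINT \<tau>:{0..t'}|lborel. nonlin \<alpha> \<mu> m (u \<tau>) x) - (LINT \<tau>:{0..t}|lborel. nonlin \<alpha> \<mu> m (u \<tau>) x)\<bar> \<le> C * (t' - t)" .
      moreover have "u t x = u0 x - (LINT \<tau>:{0..t}|lborel. nonlin \<alpha> \<mu> m (u \<tau>) x)"
        "u t' x = u0 x - (LINT \<tau>:{0..t'}|lborel. nonlin \<alpha> \<mu> m (u \<tau>) x)"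
        using that by (auto simp: S_def good_def)
      ultimately show ?thesis using that(3) by simp
    qed
    show ?thesis
    proof (cases "t \<le> t'")
      case True then show ?thesis using *[OF that] by (simp add: B_def)
    next
      case False
      then have "\<bar>u t' x - u t x\<bar> \<le> C * \<bar>t' - t\<bar>" using *[OF that(2,1)] by simp
      then show ?thesis by (simp add: B_def abs_minus_commute)
    qed
  qed
  have lipx: "\<bar>B k t x - B k t y\<bar> \<le> M * \<bar>x - y\<bar>" if "k < s" "t \<in> S" for k t x y
    using that Ck_lipschitz[of s "u t" M k x y] by (auto simp: B_def S_def good_def)
  have derB: "(B k t has_real_derivative B (Suc k) t x) (at x)" if "k < s" "t \<in> S" for k t x
    using that by (auto simp: B_def[abs_def] S_def good_def Ck_def)
  have bndB: "\<bar>B k t x\<bar> \<le> M" if "k \<le> s" "t \<in> S" for k t x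
    using that by (auto simp: B_def S_def good_def)
  have clS: "closure S = {0..\<delta> / 2}"
  proof
    show "closure S \<subseteq> {0..\<delta> / 2}" by (rule closure_minimal) (auto simp: S_def good_def)
    show "{0..\<delta> / 2} \<subseteq> closure S"
    proof
      fix t assume t: "t \<in> {0..\<delta> / 2}"
      show "t \<in> closure S" unfolding closure_approachable
      proof (intro allI impI)
        fix e :: real assume "e > 0"
        have "max 0 (t - e) < min (\<delta> / 2) (t + e)"
          using t \<open>e > 0\<close> \<open>\<delta> > 0\<close> by (auto simp: max_def min_def)
        then obtain t' where "max 0 (t - e) < t'" "t' < min (\<delta> / 2) (t + e)" "good t'"
          by (rule AE_lborel_obtain_between[OF AEg]) (use t \<open>\<delta> > 0\<close> in auto)
        then show "\<exists>y\<in>S. dist y t < e" by (intro bexI[of _ t']) (auto simp: S_def dist_real_def)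
      qed
    qed
  qed
  have ex: "\<exists>g. continuous_on ({0..\<delta> / 2} \<times> UNIV) g \<and> (\<forall>t\<in>S. \<forall>x. g (t, x) = B k t x)" if k: "k < s" for k
  proof -
    have "uniformly_continuous_on (S \<times> UNIV) (\<lambda>(t, x). B k t x)"
      unfolding uniformly_continuous_on_def
    proof (intro allI impI)
      fix e :: real assume "e > 0"
      obtain d where d: "d > 0" "\<And>t t' x. t \<in> S \<Longrightarrow> t' \<in> S \<Longrightarrow> \<bar>t - t'\<bar> < d \<Longrightarrow> \<bar>B k t x - B k t' x\<bar> \<le> e / 2"
      proof -
        have "\<exists>d>0. \<forall>t\<in>S. \<forall>t'\<in>S. \<bar>t - t'\<bar> < d \<longrightarrow> (\<forall>x. \<bar>B k t x - B k t' x\<bar> \<le> e / 2)"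
          by (rule uniform_continuity_extension[where u = B and C = C and s = s and M = M])
            (use lip0 lipx derB k \<open>e > 0\<close> in auto)
        then show ?thesis using that by blast
      qed
      define r where "r = min d (e / (2 * (\<bar>M\<bar> + 1)))"
      have r: "r > 0" using d \<open>e > 0\<close> by (auto simp: r_def intro!: divide_pos_pos)
      have "dist (B k t' x') (B k t x) < e" if "t \<in> S" "t' \<in> S" "dist (t', x') (t, x) < r" for t x t' x'
      proof -
        have a: "\<bar>t' - t\<bar> < r" "\<bar>x' - x\<bar> < r"
          using that(3) dist_fst_le[of "(t', x')" "(t, x)"] dist_snd_le[of "(t', x')" "(t, x)"] by (auto simp: dist_real_def)
        have "\<bar>B k t' x' - B k t x'\<bar> \<le> e / 2" using a that d(2)[of t' t] by (auto simp: r_def)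
        moreover have "\<bar>B k t x' - B k t x\<bar> < e / 2"
        proof -
          have "\<bar>B k t x' - B k t x\<bar> \<le> M * \<bar>x' - x\<bar>" using lipx k that by blast
          also have "\<dots> \<le> (\<bar>M\<bar> + 1) * \<bar>x' - x\<bar>" by (intro mult_right_mono) auto
          also have "\<dots> < (\<bar>M\<bar> + 1) * (e / (2 * (\<bar>M\<bar> + 1)))"
            using a(2) by (intro mult_strict_left_mono) (auto simp: r_def)
          also have "\<dots> = e / 2" by (simp add: field_simps)
          finally show ?thesis .
        qed
        ultimately show ?thesis unfolding dist_real_def by linarith
      qed
      then show "\<exists>d>0. \<forall>p\<in>S \<times> UNIV. \<forall>p'\<in>S \<times> UNIV. dist p' p < d \<longrightarrow>
          dist (case p' of (t, x) \<Rightarrow> B k t x) (case p of (t, x) \<Rightarrow> B k t x) < e"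
        using r by (intro exI[of _ r]) auto
    qed
    from uniformly_continuous_on_extension_on_closure[OF this] obtain g where
      "uniformly_continuous_on (closure (S \<times> UNIV)) g"
      "\<And>p. p \<in> S \<times> UNIV \<Longrightarrow> (case p of (t, x) \<Rightarrow> B k t x) = g p" by metis
    then show ?thesis
      by (intro exI[of _ g]) (auto simp: closure_Times clS dest: uniformly_continuous_imp_continuous)
  qed
  define g where "g k = (SOME g. continuous_on ({0..\<delta> / 2} \<times> UNIV) g \<and> (\<forall>t\<in>S. \<forall>x. g (t, x) = B k t x))" for k
  define U where "U k t x = g k (t, x)" for k t x
  have cU: "continuous_on ({0..\<delta> / 2} \<times> UNIV) (\<lambda>(t, x). U k t x)" and UB: "t \<in> S \<Longrightarrow> U k t x = B k t x"
    if "k < s" for k t x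
    using someI_ex[OF ex[OF that], folded g_def] by (auto simp: U_def)
  have cUt: "continuous_on (closure S) (\<lambda>t. U k t x)" if "k < s" for k x
  proof -
    have "continuous_on (closure S) (\<lambda>t. (t, x))" by (intro continuous_intros)
    from continuous_on_compose2[OF cU[OF that] this] show ?thesis by (auto simp: clS)
  qed
  have bnd: "\<bar>U k t x\<bar> \<le> M" if k: "k < s" and t: "t \<in> {0..\<delta> / 2}" for k t x
  proof (rule continuous_le_on_closure[where S = S and f = "\<lambda>t. \<bar>U k t x\<bar>"])
    show "continuous_on (closure S) (\<lambda>t. \<bar>U k t x\<bar>)" by (intro continuous_on_rabs cUt k)
  qed (use k t clS UB bndB in auto)
  have lip: "\<bar>U k t x - U k t y\<bar> \<le> M * \<bar>x - y\<bar>" if k: "k < s" and t: "t \<in> {0..\<delta> / 2}" for k t x y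
  proof (rule continuous_le_on_closure[where S = S and f = "\<lambda>t. \<bar>U k t x - U k t y\<bar>"])
    show "continuous_on (closure S) (\<lambda>t. \<bar>U k t x - U k t y\<bar>)"
      by (intro continuous_on_rabs continuous_on_diff cUt k)
  qed (use k t clS UB lipx in auto)
  have der: "(U k t has_real_derivative U (Suc k) t x) (at x)" if k: "Suc k < s" and t: "t \<in> {0..\<delta> / 2}" for k t x
  proof -
    \<comment> \<open>Differentiability alone does not pass to limits in time. This first-order
      Taylor inequality with a fixed constant does, and it implies the derivative.\<close>
    have est: "\<bar>U k t (x + h) - U k t x - h * U (Suc k) t x\<bar> \<le> M * \<bar>h\<bar> * \<bar>h\<bar>" for h
    proof (rule continuous_le_on_closure[where S = S and f = "\<lambda>t. \<bar>U k t (x + h) - U k t x - h * U (Suc k) t x\<bar>"])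
      show "continuous_on (closure S) (\<lambda>t. \<bar>U k t (x + h) - U k t x - h * U (Suc k) t x\<bar>)"
        by (intro continuous_on_rabs continuous_on_diff continuous_on_mult continuous_on_const cUt)
          (use k in auto)
      fix \<tau> assume \<tau>: "\<tau> \<in> S"
      have "norm ((B k \<tau> (x + h) - (x + h) * B (Suc k) \<tau> x) - (B k \<tau> x - x * B (Suc k) \<tau> x)) \<le> (M * \<bar>h\<bar>) * norm (x + h - x)"
      proof (rule field_differentiable_bound[of "cball x \<bar>h\<bar>" _ "\<lambda>y. B (Suc k) \<tau> y - B (Suc k) \<tau> x"])
        fix y assume y: "y \<in> cball x \<bar>h\<bar>"
        show "((\<lambda>y. B k \<tau> y - y * B (Suc k) \<tau> x) has_field_derivative B (Suc k) \<tau> y - B (Suc k) \<tau> x) (at y within cball x \<bar>h\<bar>)"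
          by (rule has_field_derivative_at_within) (use derB[of k \<tau> y] k \<tau> in \<open>auto intro!: derivative_eq_intros\<close>)
        have "\<bar>B (Suc k) \<tau> y - B (Suc k) \<tau> x\<bar> \<le> M * \<bar>y - x\<bar>" using lipx k \<tau> by auto
        also have "\<dots> \<le> M * \<bar>h\<bar>"
          using y bndB[of 0 \<tau> 0] \<tau> by (intro mult_left_mono) (auto simp: dist_real_def)
        finally show "norm (B (Suc k) \<tau> y - B (Suc k) \<tau> x) \<le> M * \<bar>h\<bar>" by simp
      qed (auto simp: dist_real_def)
      then show "\<bar>U k \<tau> (x + h) - U k \<tau> x - h * U (Suc k) \<tau> x\<bar> \<le> M * \<bar>h\<bar> * \<bar>h\<bar>"
        using k \<tau> by (simp add: UB algebra_simps)
    qed (use t clS in auto)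
    show ?thesis unfolding DERIV_def
    proof (rule Lim_null_comparison[where g = "\<lambda>h. M * \<bar>h\<bar>", THEN LIM_zero_cancel])
      have "\<bar>(U k t (x + h) - U k t x) / h - U (Suc k) t x\<bar> \<le> M * \<bar>h\<bar>" if "h \<noteq> 0" for h
      proof -
        have "\<bar>(U k t (x + h) - U k t x) / h - U (Suc k) t x\<bar> = \<bar>U k t (x + h) - U k t x - h * U (Suc k) t x\<bar> / \<bar>h\<bar>"
          using that by (simp add: field_simps flip: abs_divide)
        also have "\<dots> \<le> M * \<bar>h\<bar>" using est[of h] that by (simp add: field_simps)
        finally show ?thesis .
      qed
      then show "\<forall>\<^sub>F h in at 0. norm ((U k t (x + h) - U k t x) / h - U (Suc k) t x) \<le> M * \<bar>h\<bar>"
        by (auto simp: eventually_at_filter)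
      show "(\<lambda>h. M * \<bar>h\<bar>) \<midarrow>0\<rightarrow> 0" by (auto intro!: tendsto_eq_intros)
    qed
  qed
  have cN: "continuous_on {0..\<delta> / 2} (\<lambda>\<tau>. Nl \<alpha> \<mu> m (\<lambda>k. U k \<tau> x))" for x
    unfolding Nl_def
    by (intro continuous_on_add continuous_on_mult continuous_on_power continuous_on_const cUt[unfolded clS])
      (use assms in auto)
  have eqU: "U 0 t x = u0 x - integral {0..t} (\<lambda>\<tau>. Nl \<alpha> \<mu> m (\<lambda>k. U k \<tau> x))" if t: "t \<in> {0..\<delta> / 2}" for t x
  proof -
    have "U 0 t x - u0 x + integral {0..t} (\<lambda>\<tau>. Nl \<alpha> \<mu> m (\<lambda>k. U k \<tau> x)) = 0"
    proof (rule continuous_constant_on_closure[where S = S and a = 0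
          and f = "\<lambda>t. U 0 t x - u0 x + integral {0..t} (\<lambda>\<tau>. Nl \<alpha> \<mu> m (\<lambda>k. U k \<tau> x))"])
      show "continuous_on (closure S) (\<lambda>t. U 0 t x - u0 x + integral {0..t} (\<lambda>\<tau>. Nl \<alpha> \<mu> m (\<lambda>k. U k \<tau> x)))"
        unfolding clS using indefinite_integral_continuous_1[OF integrable_continuous_interval[OF cN]]
        by (intro continuous_on_add continuous_on_diff continuous_on_const cUt[unfolded clS])
          (use assms in auto)
      fix t assume t: "t \<in> S"
      then have t01: "0 \<le> t" "t \<le> \<delta> / 2" by (auto simp: S_def good_def)
      have i1: "set_integrable lborel {0..t} (\<lambda>\<tau>. nonlin \<alpha> \<mu> m (u \<tau>) x)"
        using t by (auto simp: S_def good_def)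
      have i2: "set_integrable lborel {0..t} (\<lambda>\<tau>. Nl \<alpha> \<mu> m (\<lambda>k. U k \<tau> x))"
        unfolding set_integrable_def using continuous_on_subset[OF cN] t01
        by (intro borel_integrable_compact) auto
      have "(LINT \<tau>:{0..t}|lborel. nonlin \<alpha> \<mu> m (u \<tau>) x) = (LINT \<tau>:{0..t}|lborel. Nl \<alpha> \<mu> m (\<lambda>k. U k \<tau> x))"
        unfolding set_lebesgue_integral_def
      proof (rule integral_cong_AE)
        show "AE \<tau> in lborel. indicator {0..t} \<tau> *\<^sub>R nonlin \<alpha> \<mu> m (u \<tau>) x = indicator {0..t} \<tau> *\<^sub>R Nl \<alpha> \<mu> m (\<lambda>k. U k \<tau> x)"
          using AEg
        proof eventually_elim
          case (elim \<tau>)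
          show ?case
          proof (cases "\<tau> \<in> {0..t}")
            case True
            then have \<tau>: "\<tau> \<in> S" "good \<tau>" using elim t01 \<open>\<delta> > 0\<close> by (auto simp: S_def)
            have "U k \<tau> x = (deriv ^^ k) (u \<tau>) x" if "k \<le> 3" for k
              using that UB[of k \<tau> x] \<tau>(1) assms by (simp add: B_def)
            then show ?thesis using nl[OF \<tau>(2), of x] by (simp add: Nl_def)
          qed auto
        qed
      qed (use i1 i2 in \<open>auto simp: set_integrable_def dest: borel_measurable_integrable\<close>)
      also have "\<dots> = integral {0..t} (\<lambda>\<tau>. Nl \<alpha> \<mu> m (\<lambda>k. U k \<tau> x))"
        using set_borel_integral_eq_integral(2)[OF i2] .
      finally show "U 0 t x - u0 x + integral {0..t} (\<lambda>\<tau>. Nl \<alpha> \<mu> m (\<lambda>k. U k \<tau> x)) = 0"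
        using t UB[of 0 t x] assms by (auto simp: B_def S_def good_def)
    qed (use t clS in auto)
    then show ?thesis by simp
  qed
  have U0: "U 0 0 x = u0 x" for x using eqU[of 0 x] \<open>\<delta> > 0\<close> by simp
  have "classical \<alpha> \<mu> m s M (\<delta> / 2) U"
    unfolding classical_def using cU bnd lip der eqU by (auto simp: U0)
  then show thesis using that U0 by blast
qed

section \<open>Persistence of zeros\<close>

text \<open>Big O, uniformly over a set of parameter points. The points bundle jets, distances and
  frequencies, so a constant extracted by \<open>domE\<close> is uniform in all of them, while the
  rules below assemble bounds on polynomials in jets term by term without explicit
  constants.\<close>

definition dom :: "'q set \<Rightarrow> ('q \<Rightarrow> real) \<Rightarrow> ('q \<Rightarrow> real) \<Rightarrow> bool" where
  "dom S f g \<longleftrightarrow> (\<exists>C. \<forall>q\<in>S. \<bar>f q\<bar> \<le> C * \<bar>g q\<bar>)"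

lemma domI: "(\<And>q. q \<in> S \<Longrightarrow> \<bar>f q\<bar> \<le> C * \<bar>g q\<bar>) \<Longrightarrow> dom S f g"
  unfolding dom_def by blast

lemma domE:
  assumes "dom S f g"
  obtains C where "C > 0" "\<And>q. q \<in> S \<Longrightarrow> \<bar>f q\<bar> \<le> C * \<bar>g q\<bar>"
proof -
  from assms obtain C where C: "\<And>q. q \<in> S \<Longrightarrow> \<bar>f q\<bar> \<le> C * \<bar>g q\<bar>" unfolding dom_def by blast
  have "\<bar>f q\<bar> \<le> (\<bar>C\<bar> + 1) * \<bar>g q\<bar>" if "q \<in> S" for q
  proof -
    have "C * \<bar>g q\<bar> \<le> (\<bar>C\<bar> + 1) * \<bar>g q\<bar>" by (intro mult_right_mono) auto
    then show ?thesis using C[OF that] by linarith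
  qed
  then show thesis using that[of "\<bar>C\<bar> + 1"] by auto
qed

lemma dom_refl: "dom S f f"
  by (rule domI[where C = 1]) auto

lemma dom_mult:
  assumes "dom S f f'" "dom S g g'"
  shows "dom S (\<lambda>q. f q * g q) (\<lambda>q. f' q * g' q)"
proof -
  obtain C C' where "C > 0" "\<And>q. q \<in> S \<Longrightarrow> \<bar>f q\<bar> \<le> C * \<bar>f' q\<bar>"
    and "C' > 0" "\<And>q. q \<in> S \<Longrightarrow> \<bar>g q\<bar> \<le> C' * \<bar>g' q\<bar>" using assms by (metis domE)
  then have "\<bar>f q * g q\<bar> \<le> (C * C') * \<bar>f' q * g' q\<bar>" if "q \<in> S" for q
    using mult_mono[of "\<bar>f q\<bar>" "C * \<bar>f' q\<bar>" "\<bar>g q\<bar>" "C' * \<bar>g' q\<bar>"] that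
    by (simp add: abs_mult mult_ac)
  then show ?thesis by (rule domI)
qed

lemma dom_trans:
  assumes "dom S f g" "dom S g h"
  shows "dom S f h"
proof -
  obtain C C' where C: "C > 0" "\<And>q. q \<in> S \<Longrightarrow> \<bar>f q\<bar> \<le> C * \<bar>g q\<bar>"
    and C': "C' > 0" "\<And>q. q \<in> S \<Longrightarrow> \<bar>g q\<bar> \<le> C' * \<bar>h q\<bar>" using assms by (metis domE)
  have "\<bar>f q\<bar> \<le> (C * C') * \<bar>h q\<bar>" if "q \<in> S" for q
  proof -
    have "C * \<bar>g q\<bar> \<le> C * (C' * \<bar>h q\<bar>)" using C' C that by (intro mult_left_mono) auto
    then show ?thesis using C(2)[OF that] by (simp add: mult_ac)
  qed
  then show ?thesis by (rule domI)
qed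

lemma dom_add:
  assumes "dom S f h" "dom S g h"
  shows "dom S (\<lambda>q. f q + g q) h"
proof -
  obtain C C' where "C > 0" "\<And>q. q \<in> S \<Longrightarrow> \<bar>f q\<bar> \<le> C * \<bar>h q\<bar>"
    and "C' > 0" "\<And>q. q \<in> S \<Longrightarrow> \<bar>g q\<bar> \<le> C' * \<bar>h q\<bar>" using assms by (metis domE)
  then have "\<bar>f q + g q\<bar> \<le> (C + C') * \<bar>h q\<bar>" if "q \<in> S" for q
    using that by (smt (verit, best) distrib_right)
  then show ?thesis by (rule domI)
qed

lemma dom_uminus: "dom S f h \<Longrightarrow> dom S (\<lambda>q. - f q) h"
  unfolding dom_def by simp

lemma dom_diff: "dom S f h \<Longrightarrow> dom S g h \<Longrightarrow> dom S (\<lambda>q. f q - g q) h"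
  using dom_add[of S f h "\<lambda>q. - g q"] dom_uminus[of S g h] by simp

lemma dom_mult_bdd:
  assumes "dom S f (\<lambda>_. 1)" "dom S g h"
  shows "dom S (\<lambda>q. f q * g q) h"
  using dom_mult[OF assms] by simp

lemma dom_mult_bdd':
  assumes "dom S f h" "dom S g (\<lambda>_. 1)"
  shows "dom S (\<lambda>q. f q * g q) h"
  using dom_mult[OF assms] by simp

lemma dom_const: "dom S (\<lambda>_. c) (\<lambda>_. 1)"
  by (rule domI[where C = "\<bar>c\<bar>"]) auto

lemma dom_cmult: "dom S g h \<Longrightarrow> dom S (\<lambda>q. c * g q) h"
  by (rule dom_mult_bdd[OF dom_const])

lemma dom_cdiv: "dom S g h \<Longrightarrow> dom S (\<lambda>q. g q / c) h"
  using dom_cmult[of S g h "inverse c"] by (simp add: field_simps)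

lemma dom_power: "dom S f (\<lambda>_. 1) \<Longrightarrow> dom S (\<lambda>q. f q ^ n) (\<lambda>_. 1)"
proof (induction n)
  case 0 then show ?case using dom_const[of S 1] by simp
next
  case (Suc n) then show ?case using dom_mult[of S f "\<lambda>_. 1" "\<lambda>q. f q ^ n" "\<lambda>_. 1"] by simp
qed

lemma dom_sum: "finite I \<Longrightarrow> (\<And>i. i \<in> I \<Longrightarrow> dom S (f i) h) \<Longrightarrow> dom S (\<lambda>q. \<Sum>i\<in>I. f i q) h"
proof (induction I rule: finite_induct)
  case empty show ?case by (rule domI[where C = 0]) auto
next
  case (insert x F)
  then show ?case using dom_add[of S "f x" h "\<lambda>q. \<Sum>i\<in>F. f i q"] by simp
qed

lemma dom_cong: "dom S f g \<Longrightarrow> (\<And>q. q \<in> S \<Longrightarrow> f' q = f q) \<Longrightarrow> dom S f' g"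
  unfolding dom_def by auto

section \<open>The equation differentiated in space\<close>

definition Nl1 :: "real \<Rightarrow> real \<Rightarrow> nat \<Rightarrow> (nat \<Rightarrow> real) \<Rightarrow> real" where
  "Nl1 \<alpha> \<mu> m v = v 1 * v 3 + v 0 * v 4 + \<alpha> * (v 2 * v 2 + v 1 * v 3)
     + \<mu> * (real (m - 1) * v 0 ^ (m - 2) * v 1 * v 1 + v 0 ^ (m - 1) * v 2)"

text \<open>Every summand shows a factor \<open>v 0\<close>, \<open>v 1\<close> or
  \<open>v 2\<close>, which explains the split \<open>v 0 ^ (m - 2) * v 3 * v 0\<close>. For
  \<open>m = 2\<close> the exponent \<open>m - 2 - 1\<close> is truncated to 0, harmlessly because
  its coefficient \<open>real (m - 2)\<close> is then 0.\<close>

definition Nl2 :: "real \<Rightarrow> real \<Rightarrow> nat \<Rightarrow> (nat \<Rightarrow> real) \<Rightarrow> real" where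
  "Nl2 \<alpha> \<mu> m v = v 3 * v 2 + 2 * v 4 * v 1 + v 5 * v 0 + \<alpha> * (3 * v 3 * v 2 + v 4 * v 1)
     + \<mu> * (real (m - 1) * (real (m - 2) * v 0 ^ (m - 2 - 1) * v 1 * v 1 * v 1 + 3 * v 0 ^ (m - 2) * v 2 * v 1)
            + v 0 ^ (m - 2) * v 3 * v 0)"

lemma Nl_derivs:
  fixes u :: "nat \<Rightarrow> real \<Rightarrow> real"
  assumes d: "\<And>k x. k \<le> 4 \<Longrightarrow> (u k has_real_derivative u (Suc k) x) (at x)" and m: "m \<ge> 2"
  shows "((\<lambda>x. Nl \<alpha> \<mu> m (\<lambda>k. u k x)) has_real_derivative Nl1 \<alpha> \<mu> m (\<lambda>k. u k x)) (at x)"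
    and "((\<lambda>x. Nl1 \<alpha> \<mu> m (\<lambda>k. u k x)) has_real_derivative Nl2 \<alpha> \<mu> m (\<lambda>k. u k x)) (at x)"
proof -
  obtain n where n: "m = Suc (Suc n)" using m by (metis Suc_le_D numeral_2_eq_2 Suc_le_mono)
  have d': "(u 0 has_real_derivative u 1 x) (at x)" "(u (Suc 0) has_real_derivative u 2 x) (at x)"
    "(u 1 has_real_derivative u 2 x) (at x)" "(u 2 has_real_derivative u 3 x) (at x)"
    "(u 3 has_real_derivative u 4 x) (at x)" "(u 4 has_real_derivative u 5 x) (at x)" for x
    using d[of 0 x] d[of 1 x] d[of 2 x] d[of 3 x] d[of 4 x] by (simp_all add: numeral_2_eq_2 eval_nat_numeral)
  have p: "((\<lambda>x. u 0 x ^ Suc n) has_real_derivative real (Suc n) * (u 1 x * u 0 x ^ n)) (at x)" for x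
    using DERIV_power[OF d'(1), of "Suc n"] by simp
  have q: "((\<lambda>x. u 0 x ^ n) has_real_derivative real n * (u 1 x * u 0 x ^ (n - 1))) (at x)" for x
    using DERIV_power[OF d'(1), of n] by simp
  have "((\<lambda>x. u 0 x * u 3 x + \<alpha> * (u 1 x * u 2 x) + \<mu> * (u 0 x ^ Suc n * u 1 x)) has_real_derivative
      (u 1 x * u 3 x + u 4 x * u 0 x) + \<alpha> * (u 2 x * u 2 x + u 3 x * u 1 x)
      + \<mu> * ((real (Suc n) * (u 1 x * u 0 x ^ n)) * u 1 x + u 2 x * u 0 x ^ Suc n)) (at x)"
    by (intro DERIV_add DERIV_cmult DERIV_mult p d')
  then show "((\<lambda>x. Nl \<alpha> \<mu> m (\<lambda>k. u k x)) has_real_derivative Nl1 \<alpha> \<mu> m (\<lambda>k. u k x)) (at x)"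
    unfolding Nl_def Nl1_def n by (simp add: mult_ac del: of_nat_Suc)
  have "((\<lambda>x. u 1 x * u 3 x + u 0 x * u 4 x + \<alpha> * (u 2 x * u 2 x + u 1 x * u 3 x)
      + \<mu> * (real (m - 1) * (u 0 x ^ n * (u 1 x * u 1 x)) + u 0 x ^ Suc n * u 2 x)) has_real_derivative
      (u 2 x * u 3 x + u 4 x * u 1 x) + (u 1 x * u 4 x + u 5 x * u 0 x)
      + \<alpha> * ((u 3 x * u 2 x + u 3 x * u 2 x) + (u 2 x * u 3 x + u 4 x * u 1 x))
      + \<mu> * (real (m - 1) * ((real n * (u 1 x * u 0 x ^ (n - 1))) * (u 1 x * u 1 x)
                + (u 2 x * u 1 x + u 2 x * u 1 x) * u 0 x ^ n)
          + ((real (Suc n) * (u 1 x * u 0 x ^ n)) * u 2 x + u 3 x * u 0 x ^ Suc n))) (at x)"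
    by (intro DERIV_add DERIV_cmult DERIV_mult p q d')
  moreover have "(\<lambda>x. Nl1 \<alpha> \<mu> m (\<lambda>k. u k x)) = (\<lambda>x. u 1 x * u 3 x + u 0 x * u 4 x + \<alpha> * (u 2 x * u 2 x + u 1 x * u 3 x)
      + \<mu> * (real (m - 1) * (u 0 x ^ n * (u 1 x * u 1 x)) + u 0 x ^ Suc n * u 2 x))"
    unfolding Nl1_def n by (simp add: mult.assoc)
  moreover have "(u 2 x * u 3 x + u 4 x * u 1 x) + (u 1 x * u 4 x + u 5 x * u 0 x)
      + \<alpha> * ((u 3 x * u 2 x + u 3 x * u 2 x) + (u 2 x * u 3 x + u 4 x * u 1 x))
      + \<mu> * (real (m - 1) * ((real n * (u 1 x * u 0 x ^ (n - 1))) * (u 1 x * u 1 x)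
                + (u 2 x * u 1 x + u 2 x * u 1 x) * u 0 x ^ n)
          + ((real (Suc n) * (u 1 x * u 0 x ^ n)) * u 2 x + u 3 x * u 0 x ^ Suc n)) = Nl2 \<alpha> \<mu> m (\<lambda>k. u k x)"
    unfolding Nl2_def n by (simp add: algebra_simps)
  ultimately show "((\<lambda>x. Nl1 \<alpha> \<mu> m (\<lambda>k. u k x)) has_real_derivative Nl2 \<alpha> \<mu> m (\<lambda>k. u k x)) (at x)"
    by metis
qed

lemma classicalD:
  assumes "classical \<alpha> \<mu> m s M \<delta> U"
  shows "k < s \<Longrightarrow> continuous_on ({0..\<delta>} \<times> UNIV) (\<lambda>q. U k (fst q) (snd q))"
    and "k < s \<Longrightarrow> 0 \<le> t \<Longrightarrow> t \<le> \<delta> \<Longrightarrow> \<bar>U k t x\<bar> \<le> M"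
    and "k < s \<Longrightarrow> 0 \<le> t \<Longrightarrow> t \<le> \<delta> \<Longrightarrow> \<bar>U k t x - U k t y\<bar> \<le> M * \<bar>x - y\<bar>"
    and "Suc k < s \<Longrightarrow> 0 \<le> t \<Longrightarrow> t \<le> \<delta> \<Longrightarrow> (U k t has_real_derivative U (Suc k) t x) (at x)"
    and "0 \<le> t \<Longrightarrow> t \<le> \<delta> \<Longrightarrow> U 0 t x = U 0 0 x - integral {0..t} (\<lambda>\<tau>. Nl \<alpha> \<mu> m (\<lambda>k. U k \<tau> x))"
proof -
  note a = assms[unfolded classical_def split_def]
  show "k < s \<Longrightarrow> continuous_on ({0..\<delta>} \<times> UNIV) (\<lambda>q. U k (fst q) (snd q))"
    using a by blast
  show "k < s \<Longrightarrow> 0 \<le> t \<Longrightarrow> t \<le> \<delta> \<Longrightarrow> \<bar>U k t x\<bar> \<le> M"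
    using a by simp
  show "k < s \<Longrightarrow> 0 \<le> t \<Longrightarrow> t \<le> \<delta> \<Longrightarrow> \<bar>U k t x - U k t y\<bar> \<le> M * \<bar>x - y\<bar>"
    using a by simp
  show "Suc k < s \<Longrightarrow> 0 \<le> t \<Longrightarrow> t \<le> \<delta> \<Longrightarrow> (U k t has_real_derivative U (Suc k) t x) (at x)"
    using a by simp
  show "0 \<le> t \<Longrightarrow> t \<le> \<delta> \<Longrightarrow> U 0 t x = U 0 0 x - integral {0..t} (\<lambda>\<tau>. Nl \<alpha> \<mu> m (\<lambda>k. U k \<tau> x))"
    using a by (meson atLeastAtMost_iff)
qed

text \<open>The integrated equation for \<open>H\<close> is differentiated in \<open>x\<close> under
  the integral sign. It is applied twice, to pass from \<open>U 0\<close> to \<open>U 1\<close> and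
  from there to \<open>U 2\<close>.\<close>

lemma integral_has_derivative_param:
  fixes F G H K :: "real \<Rightarrow> real \<Rightarrow> real"
  assumes cF: "continuous_on ({0..\<delta>} \<times> UNIV) (\<lambda>q. F (fst q) (snd q))"
    and cG: "continuous_on ({0..\<delta>} \<times> UNIV) (\<lambda>q. G (fst q) (snd q))"
    and FG: "\<And>\<tau> x. 0 \<le> \<tau> \<Longrightarrow> \<tau> \<le> \<delta> \<Longrightarrow> (F \<tau> has_real_derivative G \<tau> x) (at x)"
    and H: "\<And>t x. 0 \<le> t \<Longrightarrow> t \<le> \<delta> \<Longrightarrow> H t x = H 0 x - integral {0..t} (\<lambda>\<tau>. F \<tau> x)"
    and HK: "\<And>t x. 0 \<le> t \<Longrightarrow> t \<le> \<delta> \<Longrightarrow> (H t has_real_derivative K t x) (at x)"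
    and t: "0 \<le> t" "t \<le> \<delta>"
  shows "K t x = K 0 x - integral {0..t} (\<lambda>\<tau>. G \<tau> x)"
proof -
  have "((\<lambda>x. integral (cbox 0 t) (\<lambda>\<tau>. F \<tau> x)) has_field_derivative integral (cbox 0 t) (\<lambda>\<tau>. G \<tau> x)) (at x within UNIV)"
  proof (rule leibniz_rule_field_derivative)
    show "((\<lambda>x. F \<tau> x) has_field_derivative G \<tau> x) (at x within UNIV)" if "\<tau> \<in> cbox 0 t" for x \<tau>
      using FG that t by auto
    show "(\<lambda>\<tau>. F \<tau> x) integrable_on cbox 0 t" for x
    proof -
      have "continuous_on {0..t} (\<lambda>\<tau>. F (fst (\<tau>, x)) (snd (\<tau>, x)))"
        by (rule continuous_on_compose2[OF cF]) (use t in \<open>auto intro!: continuous_intros\<close>)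
      then show ?thesis by (simp add: integrable_continuous_interval)
    qed
    have "continuous_on (UNIV \<times> cbox 0 t) (\<lambda>p. G (fst (snd p, fst p)) (snd (snd p, fst p)))"
      by (rule continuous_on_compose2[OF cG]) (use t in \<open>auto intro!: continuous_intros\<close>)
    then show "continuous_on (UNIV \<times> cbox 0 t) (\<lambda>(x, \<tau>). G \<tau> x)" by (simp add: split_def)
  qed auto
  then have "((\<lambda>x. H 0 x - integral {0..t} (\<lambda>\<tau>. F \<tau> x)) has_real_derivative K 0 x - integral {0..t} (\<lambda>\<tau>. G \<tau> x)) (at x)"
    using HK[of 0 x] t by (intro DERIV_diff) auto
  moreover have "H t = (\<lambda>x. H 0 x - integral {0..t} (\<lambda>\<tau>. F \<tau> x))" by (intro ext H t)
  ultimately show ?thesis using HK[of t x] t DERIV_unique by metis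
qed

lemma classical_jets:
  assumes c: "classical \<alpha> \<mu> m s M \<delta> U" and s: "s \<ge> 6" and m: "m \<ge> 2" and t: "0 \<le> t" "t \<le> \<delta>"
  shows "U 1 t x = U 1 0 x - integral {0..t} (\<lambda>\<tau>. Nl1 \<alpha> \<mu> m (\<lambda>k. U k \<tau> x))"
    and "U 2 t x = U 2 0 x - integral {0..t} (\<lambda>\<tau>. Nl2 \<alpha> \<mu> m (\<lambda>k. U k \<tau> x))"
proof -
  have cU: "continuous_on ({0..\<delta>} \<times> UNIV) (\<lambda>q. U k (fst q) (snd q))" if "k \<le> 5" for k
    using classicalD(1)[OF c] that s by auto
  have cN: "continuous_on ({0..\<delta>} \<times> UNIV) (\<lambda>q. Nl \<alpha> \<mu> m (\<lambda>k. U k (fst q) (snd q)))"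
    "continuous_on ({0..\<delta>} \<times> UNIV) (\<lambda>q. Nl1 \<alpha> \<mu> m (\<lambda>k. U k (fst q) (snd q)))"
    "continuous_on ({0..\<delta>} \<times> UNIV) (\<lambda>q. Nl2 \<alpha> \<mu> m (\<lambda>k. U k (fst q) (snd q)))"
    unfolding Nl_def Nl1_def Nl2_def
    by (intro continuous_on_add continuous_on_mult continuous_on_power continuous_on_const cU; simp)+
  have d: "(U k \<tau> has_real_derivative U (Suc k) \<tau> x) (at x)" if "0 \<le> \<tau>" "\<tau> \<le> \<delta>" "k \<le> 4" for k \<tau> x
    using classicalD(4)[OF c] that s by auto
  have d01: "(U 0 \<tau> has_real_derivative U 1 \<tau> x) (at x)" "(U 1 \<tau> has_real_derivative U 2 \<tau> x) (at x)"
    if "0 \<le> \<tau>" "\<tau> \<le> \<delta>" for \<tau> x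
    using d[of \<tau> 0 x] d[of \<tau> 1 x] that by (simp_all add: numeral_2_eq_2)
  have e1: "((\<lambda>x. Nl \<alpha> \<mu> m (\<lambda>k. U k \<tau> x)) has_real_derivative Nl1 \<alpha> \<mu> m (\<lambda>k. U k \<tau> x)) (at x)"
    and e2: "((\<lambda>x. Nl1 \<alpha> \<mu> m (\<lambda>k. U k \<tau> x)) has_real_derivative Nl2 \<alpha> \<mu> m (\<lambda>k. U k \<tau> x)) (at x)"
    if \<tau>: "0 \<le> \<tau>" "\<tau> \<le> \<delta>" for \<tau> x
    by (rule Nl_derivs[where u = "\<lambda>k. U k \<tau>", OF d[OF \<tau>] m]; assumption)+
  have 1: "U 1 t x = U 1 0 x - integral {0..t} (\<lambda>\<tau>. Nl1 \<alpha> \<mu> m (\<lambda>k. U k \<tau> x))"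
    if "0 \<le> t" "t \<le> \<delta>" for t x
    by (rule integral_has_derivative_param[OF cN(1,2) e1 classicalD(5)[OF c] d01(1) that])
  show "U 1 t x = U 1 0 x - integral {0..t} (\<lambda>\<tau>. Nl1 \<alpha> \<mu> m (\<lambda>k. U k \<tau> x))"
    by (rule 1[OF t])
  show "U 2 t x = U 2 0 x - integral {0..t} (\<lambda>\<tau>. Nl2 \<alpha> \<mu> m (\<lambda>k. U k \<tau> x))"
    by (rule integral_has_derivative_param[OF cN(2,3) e2 1 d01(2) t])
qed

text \<open>Takes the place of Gronwall's inequality: a quantity all of whose bounds can be halved
  is zero. The index set is arbitrary, so it may range over times and over several jet components at
  once, and no maximum has to be attained.\<close>

lemma halving_zero:
  fixes q :: "'a \<Rightarrow> real"
  assumes step: "\<And>B. (\<And>x. x \<in> T \<Longrightarrow> \<bar>q x\<bar> \<le> B) \<Longrightarrow> (\<And>x. x \<in> T \<Longrightarrow> \<bar>q x\<bar> \<le> B / 2)"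
    and B0: "\<And>x. x \<in> T \<Longrightarrow> \<bar>q x\<bar> \<le> B0" and x: "x \<in> T"
  shows "q x = 0"
proof -
  have "\<bar>q x\<bar> \<le> B0 / 2 ^ n" if "x \<in> T" for n x
    using that
  proof (induction n arbitrary: x)
    case (Suc n)
    have "\<bar>q x\<bar> \<le> (B0 / 2 ^ n) / 2" by (rule step) (use Suc in auto)
    then show ?case by (simp add: field_simps)
  qed (use B0 in simp)
  from this[OF x] have "\<And>n. \<bar>q x\<bar> \<le> B0 * (1 / 2) ^ n" by (simp add: power_divide)
  moreover have "(\<lambda>n. B0 * (1 / 2) ^ n) \<longlonglongrightarrow> B0 * 0"
    by (intro tendsto_mult tendsto_const LIMSEQ_power_zero) auto
  ultimately have "\<bar>q x\<bar> \<le> B0 * 0" by (intro LIMSEQ_le_const) auto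
  then show ?thesis by simp
qed

text \<open>At a fixed point the values \<open>U 0\<close>, \<open>U 1\<close>, \<open>U 2\<close>
  satisfy a closed system: each summand on the right contains one of the three, and the orders 3 to
  5 act as coefficients bounded by \<open>M\<close>. Hence a triple zero stays where it is.\<close>

lemma Nl_jets_bound:
  obtains C where "C > 0" "\<And>v B. (\<And>k. k \<le> 5 \<Longrightarrow> \<bar>v k\<bar> \<le> M) \<Longrightarrow> (\<And>k. k \<le> 2 \<Longrightarrow> \<bar>v k\<bar> \<le> B) \<Longrightarrow> m \<ge> 2 \<Longrightarrow>
     \<bar>Nl \<alpha> \<mu> m v\<bar> \<le> C * B \<and> \<bar>Nl1 \<alpha> \<mu> m v\<bar> \<le> C * B \<and> \<bar>Nl2 \<alpha> \<mu> m v\<bar> \<le> C * B"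
proof -
  define S where "S = {q :: (nat \<Rightarrow> real) \<times> real. (\<forall>k\<le>5. \<bar>fst q k\<bar> \<le> M) \<and> (\<forall>k\<le>2. \<bar>fst q k\<bar> \<le> snd q)}"
  have b: "dom S (\<lambda>q. fst q k) (\<lambda>_. 1)" if "k \<le> 5" for k
    using that by (intro domI[where C = M]) (auto simp: S_def)
  have v: "dom S (\<lambda>q. fst q k) snd" if "k \<le> 2" for k
    using that by (intro domI[where C = 1]) (force simp: S_def)
  note r = dom_add dom_cmult dom_mult_bdd[OF _ v] dom_mult_bdd b dom_power dom_const
  have "dom S (\<lambda>q. Nl \<alpha> \<mu> m (fst q)) snd"
  proof -
    have "dom S (\<lambda>q. fst q 3 * fst q 0 + \<alpha> * (fst q 1 * fst q 2) + \<mu> * (fst q 0 ^ (m - 1) * fst q 1)) snd"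
      by (intro r) auto
    then show ?thesis by (rule dom_cong) (simp add: Nl_def algebra_simps)
  qed
  moreover have "dom S (\<lambda>q. Nl1 \<alpha> \<mu> m (fst q)) snd"
  proof -
    have "dom S (\<lambda>q. fst q 3 * fst q 1 + fst q 4 * fst q 0 + \<alpha> * (fst q 2 * fst q 2 + fst q 3 * fst q 1)
        + \<mu> * (real (m - 1) * ((fst q 0 ^ (m - 2) * fst q 1) * fst q 1) + fst q 0 ^ (m - 1) * fst q 2)) snd"
      by (intro r) auto
    then show ?thesis by (rule dom_cong) (simp add: Nl1_def algebra_simps)
  qed
  moreover have "dom S (\<lambda>q. Nl2 \<alpha> \<mu> m (fst q)) snd"
  proof -
    have "dom S (\<lambda>q. fst q 3 * fst q 2 + (2 * fst q 4) * fst q 1 + fst q 5 * fst q 0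
        + \<alpha> * ((3 * fst q 3) * fst q 2 + fst q 4 * fst q 1)
        + \<mu> * (real (m - 1) * (((real (m - 2) * fst q 0 ^ (m - 2 - 1)) * fst q 1 * fst q 1) * fst q 1
               + (3 * fst q 0 ^ (m - 2) * fst q 2) * fst q 1)
              + (fst q 0 ^ (m - 2) * fst q 3) * fst q 0)) snd"
      by (intro r) auto
    then show ?thesis by (rule dom_cong) (simp add: Nl2_def)
  qed
  ultimately obtain C1 C2 C3 where C: "C1 > 0" "\<And>q. q \<in> S \<Longrightarrow> \<bar>Nl \<alpha> \<mu> m (fst q)\<bar> \<le> C1 * \<bar>snd q\<bar>"
    "C2 > 0" "\<And>q. q \<in> S \<Longrightarrow> \<bar>Nl1 \<alpha> \<mu> m (fst q)\<bar> \<le> C2 * \<bar>snd q\<bar>"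
    "C3 > 0" "\<And>q. q \<in> S \<Longrightarrow> \<bar>Nl2 \<alpha> \<mu> m (fst q)\<bar> \<le> C3 * \<bar>snd q\<bar>" by (metis domE)
  show thesis
  proof (rule that[of "C1 + C2 + C3"])
    fix v :: "nat \<Rightarrow> real" and B :: real
    assume *: "\<And>k. k \<le> 5 \<Longrightarrow> \<bar>v k\<bar> \<le> M" "\<And>k. k \<le> 2 \<Longrightarrow> \<bar>v k\<bar> \<le> B"
    have B: "0 \<le> B" using *(2)[of 0] abs_ge_zero[of "v 0"] by linarith
    have q: "(v, B) \<in> S" using * by (auto simp: S_def)
    have "C1 * B \<ge> 0" "C2 * B \<ge> 0" "C3 * B \<ge> 0" using B C by simp_all
    then show "\<bar>Nl \<alpha> \<mu> m v\<bar> \<le> (C1 + C2 + C3) * B \<and> \<bar>Nl1 \<alpha> \<mu> m v\<bar> \<le> (C1 + C2 + C3) * B \<and> \<bar>Nl2 \<alpha> \<mu> m v\<bar> \<le> (C1 + C2 + C3) * B"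
      using C(2)[OF q] C(4)[OF q] C(6)[OF q] B by (simp add: distrib_right)
  qed (use C in auto)
qed

lemma integral_abs_le:
  fixes f :: "real \<Rightarrow> real"
  assumes "continuous_on {0..t} f" "\<And>x. x \<in> {0..t} \<Longrightarrow> \<bar>f x\<bar> \<le> C" "0 \<le> t"
  shows "\<bar>integral {0..t} f\<bar> \<le> C * t"
  using integral_bound[of 0 t f C] assms by simp

lemma classical_cont_t:
  assumes "classical \<alpha> \<mu> m s M \<delta> U" "s \<ge> 6" "t \<le> \<delta>"
  shows "continuous_on {0..t} (\<lambda>\<tau>. Nl \<alpha> \<mu> m (\<lambda>k. U k \<tau> x))"
    and "continuous_on {0..t} (\<lambda>\<tau>. Nl1 \<alpha> \<mu> m (\<lambda>k. U k \<tau> x))"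
    and "continuous_on {0..t} (\<lambda>\<tau>. Nl2 \<alpha> \<mu> m (\<lambda>k. U k \<tau> x))"
proof -
  have cU: "continuous_on {0..t} (\<lambda>\<tau>. U k \<tau> x)" if "k \<le> 5" for k
  proof -
    have "k < s" using that assms by auto
    have "continuous_on {0..t} (\<lambda>\<tau>. (\<tau>, x))" by (intro continuous_intros)
    from continuous_on_compose2[OF classicalD(1)[OF assms(1) \<open>k < s\<close>] this] show ?thesis using assms by force
  qed
  show "continuous_on {0..t} (\<lambda>\<tau>. Nl \<alpha> \<mu> m (\<lambda>k. U k \<tau> x))"
    and "continuous_on {0..t} (\<lambda>\<tau>. Nl1 \<alpha> \<mu> m (\<lambda>k. U k \<tau> x))"
    and "continuous_on {0..t} (\<lambda>\<tau>. Nl2 \<alpha> \<mu> m (\<lambda>k. U k \<tau> x))"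
    unfolding Nl_def Nl1_def Nl2_def
    by (intro continuous_on_add continuous_on_mult continuous_on_power continuous_on_const cU; simp)+
qed

text \<open>For short times a bound on the jet at the zero can be halved; iterating this gives zero.\<close>

lemma triple_zero_persists:
  assumes s: "s \<ge> 6" and m: "m \<ge> 2"
  obtains t0 where "t0 > 0"
    "\<And>U \<delta> z t k. classical \<alpha> \<mu> m s M \<delta> U \<Longrightarrow> (\<And>k. k \<le> 2 \<Longrightarrow> U k 0 z = 0) \<Longrightarrow>
       0 \<le> t \<Longrightarrow> t \<le> t0 \<Longrightarrow> t \<le> \<delta> \<Longrightarrow> k \<le> 2 \<Longrightarrow> U k t z = 0"
proof -
  obtain C where C: "C > 0" "\<And>v B. (\<And>k. k \<le> 5 \<Longrightarrow> \<bar>v k\<bar> \<le> M) \<Longrightarrow> (\<And>k. k \<le> 2 \<Longrightarrow> \<bar>v k\<bar> \<le> B) \<Longrightarrow>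
     \<bar>Nl \<alpha> \<mu> m v\<bar> \<le> C * B \<and> \<bar>Nl1 \<alpha> \<mu> m v\<bar> \<le> C * B \<and> \<bar>Nl2 \<alpha> \<mu> m v\<bar> \<le> C * B"
    by (rule Nl_jets_bound[of M m \<alpha> \<mu>]) (use m in blast)
  show thesis
  proof (rule that[of "1 / (2 * C)"])
    fix U \<delta> z t and k :: nat
    assume c: "classical \<alpha> \<mu> m s M \<delta> U" and z: "\<And>k. k \<le> 2 \<Longrightarrow> U k 0 z = 0"
      and t: "0 \<le> t" "t \<le> 1 / (2 * C)" "t \<le> \<delta>" and k: "k \<le> 2"
    define T where "T = {(k :: nat, \<tau>). k \<le> 2 \<and> \<tau> \<in> {0..t}}"
    define g where "g = (\<lambda>(k, \<tau>). U k \<tau> z)"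
    have kT: "(k, t) \<in> T" using k t by (simp add: T_def)
    have gM: "\<bar>g q\<bar> \<le> M" if "q \<in> T" for q
      using that classicalD(2)[OF c] t s by (auto simp: T_def g_def)
    have step: "\<bar>g q\<bar> \<le> B / 2" if B: "\<And>q. q \<in> T \<Longrightarrow> \<bar>g q\<bar> \<le> B" and q: "q \<in> T" for B q
    proof -
      have B': "\<bar>U k \<tau> z\<bar> \<le> B" if "k \<le> 2" "0 \<le> \<tau>" "\<tau> \<le> t" for k \<tau>
        using B[of "(k, \<tau>)"] that by (auto simp: T_def g_def)
      have bnd: "\<bar>Nl \<alpha> \<mu> m (\<lambda>k. U k \<tau> z)\<bar> \<le> C * B \<and> \<bar>Nl1 \<alpha> \<mu> m (\<lambda>k. U k \<tau> z)\<bar> \<le> C * B \<and> \<bar>Nl2 \<alpha> \<mu> m (\<lambda>k. U k \<tau> z)\<bar> \<le> C * B"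
        if "0 \<le> \<tau>" "\<tau> \<le> t" for \<tau>
        by (rule C(2)) (use B' that classicalD(2)[OF c] t s in auto)
      obtain k' \<tau> where q': "q = (k', \<tau>)" and kt: "k' \<le> 2" "0 \<le> \<tau>" "\<tau> \<le> t" using q by (auto simp: T_def)
      have "\<bar>U k' \<tau> z\<bar> \<le> (C * B) * \<tau>"
      proof -
        have i: "\<bar>integral {0..\<tau>} (\<lambda>\<tau>. Nl \<alpha> \<mu> m (\<lambda>k. U k \<tau> z))\<bar> \<le> (C * B) * \<tau>"
          "\<bar>integral {0..\<tau>} (\<lambda>\<tau>. Nl1 \<alpha> \<mu> m (\<lambda>k. U k \<tau> z))\<bar> \<le> (C * B) * \<tau>"
          "\<bar>integral {0..\<tau>} (\<lambda>\<tau>. Nl2 \<alpha> \<mu> m (\<lambda>k. U k \<tau> z))\<bar> \<le> (C * B) * \<tau>"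
          by (rule integral_abs_le[OF classical_cont_t(1)[OF c s]]
              integral_abs_le[OF classical_cont_t(2)[OF c s]]
              integral_abs_le[OF classical_cont_t(3)[OF c s]]; use bnd kt t in force)+
        from kt consider "k' = 0" | "k' = 1" | "k' = 2" by linarith
        then show ?thesis
          using classicalD(5)[OF c, of \<tau> z] classical_jets[OF c s m, of \<tau> z] kt t z[of 0] z[of 1] z[of 2] i
          by cases auto
      qed
      also have "\<dots> \<le> (C * B) * (1 / (2 * C))"
        using B'[of 0 0] t kt C(1) by (intro mult_left_mono) auto
      also have "\<dots> = B / 2" using C(1) by simp
      finally show ?thesis by (simp add: q' g_def)
    qed
    have "g (k, t) = 0" by (rule halving_zero[OF step gM kT])
    then show "U k t z = 0" by (simp add: g_def)
  qed (use C in auto)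
qed

text \<open>A Taylor expansion that does not differentiate the top function. Starting from the
  Lipschitz bound on \<open>f n\<close>, each step down the chain integrates the remainder from
  \<open>z\<close>, where the lower functions vanish, and gains one factor
  \<open>\<bar>x - z\<bar>\<close>.\<close>

lemma chain_expansion:
  fixes f :: "nat \<Rightarrow> real \<Rightarrow> real"
  assumes der: "\<And>j x. j < n \<Longrightarrow> (f j has_real_derivative f (Suc j) x) (at x)"
    and lip: "\<And>x. \<bar>f n x - c\<bar> \<le> L * \<bar>x - z\<bar>"
    and z: "\<And>j. j < n \<Longrightarrow> f j z = 0" and "j \<le> n"
  shows "\<bar>f j x - c * (x - z) ^ (n - j) / fact (n - j)\<bar> \<le> L * \<bar>x - z\<bar> ^ Suc (n - j)"
  using \<open>j \<le> n\<close>
proof (induction j arbitrary: x rule: inc_induct)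
  case base
  show ?case using lip[of x] by simp
next
  case (step j)
  have L: "L \<ge> 0" using lip[of "z + 1"] by auto
  obtain i where i: "n - j = Suc i" "n - Suc j = i" using step.hyps by (metis Suc_diff_Suc)
  define g where "g y = f j y - c * (y - z) ^ Suc i / fact (Suc i)" for y
  have "norm (g x - g z) \<le> (L * \<bar>x - z\<bar> ^ Suc i) * norm (x - z)"
  proof (rule field_differentiable_bound[of "cball z \<bar>x - z\<bar>" g "\<lambda>y. f (Suc j) y - c * (y - z) ^ i / fact i"])
    fix y assume y: "y \<in> cball z \<bar>x - z\<bar>"
    have "((\<lambda>y. c * (y - z) ^ Suc i / fact (Suc i)) has_real_derivative c * (y - z) ^ i / fact i) (at y)"
    proof -
      have "((\<lambda>y. (y - z) ^ Suc i) has_real_derivative real (Suc i) * (1 * (y - z) ^ i)) (at y)"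
      proof -
        have "((\<lambda>y. y - z) has_real_derivative 1) (at y)" by (auto intro!: derivative_eq_intros)
        from DERIV_power[OF this, of "Suc i"] show ?thesis by simp
      qed
      from DERIV_cdivide[OF DERIV_cmult[OF this, of c], of "fact (Suc i)"]
      show ?thesis by (simp add: fact_Suc mult_ac del: of_nat_Suc)
    qed
    then have "(g has_real_derivative f (Suc j) y - c * (y - z) ^ i / fact i) (at y)"
      unfolding g_def using der[OF step.hyps(2)] by (intro DERIV_diff)
    then show "(g has_real_derivative f (Suc j) y - c * (y - z) ^ i / fact i) (at y within cball z \<bar>x - z\<bar>)"
      by (rule has_field_derivative_at_within)
    have "\<bar>f (Suc j) y - c * (y - z) ^ i / fact i\<bar> \<le> L * \<bar>y - z\<bar> ^ Suc i"
      using step.IH[of y] unfolding i .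
    also have "\<dots> \<le> L * \<bar>x - z\<bar> ^ Suc i"
      using y L by (intro mult_left_mono power_mono) (auto simp: dist_real_def)
    finally show "norm (f (Suc j) y - c * (y - z) ^ i / fact i) \<le> L * \<bar>x - z\<bar> ^ Suc i" by simp
  qed (auto simp: dist_real_def)
  moreover have "g z = 0" using z step.hyps by (simp add: g_def)
  ultimately have "\<bar>g x\<bar> \<le> L * \<bar>x - z\<bar> ^ Suc (Suc i)" by (simp add: mult_ac)
  then show ?case unfolding i g_def .
qed

section \<open>Differences of two solutions near a common triple zero\<close>

definition Hf :: "nat \<Rightarrow> real \<Rightarrow> real \<Rightarrow> real" where
  "Hf n a b = (\<Sum>i<n. b ^ (n - Suc i) * a ^ i)"

definition lin1 :: "real \<Rightarrow> real \<Rightarrow> nat \<Rightarrow> (nat \<Rightarrow> real) \<Rightarrow> (nat \<Rightarrow> real) \<Rightarrow> real" where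
  "lin1 \<alpha> \<mu> m u v = \<alpha> * v 2 + \<mu> * u 0 ^ (m - 1)"

definition lin0 :: "real \<Rightarrow> real \<Rightarrow> nat \<Rightarrow> (nat \<Rightarrow> real) \<Rightarrow> (nat \<Rightarrow> real) \<Rightarrow> real" where
  "lin0 \<alpha> \<mu> m u v = v 3 + \<mu> * Hf (m - 1) (u 0) (v 0) * v 1"

text \<open>An exact linearisation: \<open>Hf\<close>, the divided difference of a power, absorbs
  what would be the quadratic remainder. The coefficients of the two highest derivatives depend on
  \<open>u\<close> alone, so the energy weight and the leading part of the adjoint involve
  \<open>u\<close> only.\<close>

lemma Nl_diff:
  "Nl \<alpha> \<mu> m u - Nl \<alpha> \<mu> m v = u 0 * (u 3 - v 3) + \<alpha> * u 1 * (u 2 - v 2)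
     + lin1 \<alpha> \<mu> m u v * (u 1 - v 1) + lin0 \<alpha> \<mu> m u v * (u 0 - v 0)"
proof -
  have H: "u 0 ^ (m - 1) - v 0 ^ (m - 1) = (u 0 - v 0) * Hf (m - 1) (u 0) (v 0)"
    unfolding Hf_def by (rule power_diff_sumr2)
  have "Nl \<alpha> \<mu> m u - Nl \<alpha> \<mu> m v = u 0 * (u 3 - v 3) + v 3 * (u 0 - v 0)
      + \<alpha> * (u 1 * (u 2 - v 2) + v 2 * (u 1 - v 1))
      + \<mu> * (u 0 ^ (m - 1) * (u 1 - v 1) + (u 0 ^ (m - 1) - v 0 ^ (m - 1)) * v 1)"
    unfolding Nl_def by (simp add: algebra_simps)
  then show ?thesis unfolding H lin1_def lin0_def by (simp add: algebra_simps)
qed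

lemma dom_Hf:
  assumes "dom S a (\<lambda>_. 1)" "dom S b (\<lambda>_. 1)"
  shows "dom S (\<lambda>q. Hf n (a q) (b q)) (\<lambda>_. 1)"
  unfolding Hf_def by (intro dom_sum dom_mult_bdd dom_power assms) auto

text \<open>A degenerate operator: the coefficients of \<open>u 3 - v 3\<close>,
  \<open>u 2 - v 2\<close> and \<open>u 1 - v 1\<close> are of order \<open>h ^ 3\<close>,
  \<open>h ^ 2\<close> and \<open>h\<close>, which repays exactly the powers lost by
  differentiation. So a difference of order \<open>h ^ k\<close> is mapped to one of order
  \<open>h ^ k\<close>.\<close>

lemma Nl_diff_bound:
  assumes m: "m \<ge> 2"
  obtains C where "C > 0" "\<And>u v h B k. (\<And>j. j \<le> 3 \<Longrightarrow> \<bar>u j\<bar> \<le> M \<and> \<bar>v j\<bar> \<le> M) \<Longrightarrow>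
     \<bar>u 0\<bar> \<le> M * h ^ 3 \<Longrightarrow> \<bar>u 1\<bar> \<le> M * h ^ 2 \<Longrightarrow> \<bar>v 2\<bar> \<le> M * h \<Longrightarrow> 0 \<le> h \<Longrightarrow> h \<le> 1 \<Longrightarrow> k \<ge> 3 \<Longrightarrow>
     (\<And>j. j \<le> 3 \<Longrightarrow> \<bar>u j - v j\<bar> \<le> B * h ^ (k - j)) \<Longrightarrow>
     \<bar>Nl \<alpha> \<mu> m u - Nl \<alpha> \<mu> m v\<bar> \<le> C * B * h ^ k"
proof -
  define S where "S = {(u :: nat \<Rightarrow> real, v :: nat \<Rightarrow> real, h :: real). (\<forall>j\<le>3. \<bar>u j\<bar> \<le> M \<and> \<bar>v j\<bar> \<le> M) \<and>
     \<bar>u 0\<bar> \<le> M * h ^ 3 \<and> \<bar>v 2\<bar> \<le> M * h \<and> 0 \<le> h \<and> h \<le> 1}"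
  have b: "dom S (\<lambda>q. fst q j) (\<lambda>_. 1)" "dom S (\<lambda>q. fst (snd q) j) (\<lambda>_. 1)" if "j \<le> 3" for j
    using that by (intro domI[where C = M]; force simp: S_def)+
  have h3: "h ^ 3 \<le> h" if "0 \<le> h" "h \<le> 1" for h :: real
    using power_decreasing[of 1 3 h] that by simp
  have u0: "dom S (\<lambda>q. fst q 0) (\<lambda>q. snd (snd q))"
  proof (rule domI[where C = M])
    fix q assume q: "q \<in> S"
    then have M: "0 \<le> M" and h: "0 \<le> snd (snd q)" "snd (snd q) \<le> 1"
      unfolding S_def by (force, auto)
    have "\<bar>fst q 0\<bar> \<le> M * snd (snd q) ^ 3" using q by (auto simp: S_def)
    also have "\<dots> \<le> M * snd (snd q)" using M h h3 by (intro mult_left_mono) auto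
    finally show "\<bar>fst q 0\<bar> \<le> M * \<bar>snd (snd q)\<bar>" using h by simp
  qed
  have v2: "dom S (\<lambda>q. fst (snd q) 2) (\<lambda>q. snd (snd q))"
    by (rule domI[where C = M]) (auto simp: S_def)
  have "dom S (\<lambda>q. \<alpha> * fst (snd q) 2 + \<mu> * (fst q 0 ^ (m - 2) * fst q 0)) (\<lambda>q. snd (snd q))"
    by (intro dom_add dom_cmult v2 dom_mult_bdd[OF _ u0] dom_power b) auto
  moreover have "m - 1 = Suc (m - 2)" using m by simp
  ultimately have "dom S (\<lambda>q. lin1 \<alpha> \<mu> m (fst q) (fst (snd q))) (\<lambda>q. snd (snd q))"
    by (simp add: lin1_def mult.commute)
  then obtain C1 where C1: "C1 > 0" "\<And>q. q \<in> S \<Longrightarrow> \<bar>lin1 \<alpha> \<mu> m (fst q) (fst (snd q))\<bar> \<le> C1 * \<bar>snd (snd q)\<bar>"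
    by (rule domE) blast
  have "dom S (\<lambda>q. lin0 \<alpha> \<mu> m (fst q) (fst (snd q))) (\<lambda>_. 1)"
    unfolding lin0_def by (intro dom_add dom_mult_bdd dom_const dom_Hf b) auto
  then obtain C0 where C0: "C0 > 0" "\<And>q. q \<in> S \<Longrightarrow> \<bar>lin0 \<alpha> \<mu> m (fst q) (fst (snd q))\<bar> \<le> C0 * \<bar>1\<bar>"
    by (rule domE) blast
  show thesis
  proof (rule that[of "\<bar>M\<bar> + \<bar>\<alpha>\<bar> * \<bar>M\<bar> + C1 + C0"])
    show "\<bar>M\<bar> + \<bar>\<alpha>\<bar> * \<bar>M\<bar> + C1 + C0 > 0" using C1(1) C0(1) by (smt (verit) mult_nonneg_nonneg)
    fix u v :: "nat \<Rightarrow> real" and h B :: real and k :: nat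
    assume *: "\<And>j. j \<le> 3 \<Longrightarrow> \<bar>u j\<bar> \<le> M \<and> \<bar>v j\<bar> \<le> M"
      "\<bar>u 0\<bar> \<le> M * h ^ 3" "\<bar>u 1\<bar> \<le> M * h ^ 2" "\<bar>v 2\<bar> \<le> M * h" "0 \<le> h" "h \<le> 1" "k \<ge> 3"
      and w: "\<And>j. j \<le> 3 \<Longrightarrow> \<bar>u j - v j\<bar> \<le> B * h ^ (k - j)"
    have M: "0 \<le> M" using *(1)[of 0] by linarith
    have q: "(u, v, h) \<in> S" using * by (auto simp: S_def)
    note l = C1(2)[OF q] C0(2)[OF q]
    obtain i where k: "k = i + 3" using \<open>k \<ge> 3\<close> by (metis add.commute le_Suc_ex)
    have "\<bar>u 0 * (u 3 - v 3)\<bar> \<le> (M * h ^ 3) * (B * h ^ (k - 3))"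
      unfolding abs_mult using * w[of 3] M by (intro mult_mono) auto
    then have 1: "\<bar>u 0 * (u 3 - v 3)\<bar> \<le> \<bar>M\<bar> * B * h ^ k" using M by (simp add: k power_add mult_ac)
    have "\<bar>\<alpha> * u 1 * (u 2 - v 2)\<bar> \<le> (\<bar>\<alpha>\<bar> * (M * h ^ 2)) * (B * h ^ (k - 2))"
      unfolding abs_mult using * w[of 2] M by (intro mult_mono) auto
    then have 2: "\<bar>\<alpha> * u 1 * (u 2 - v 2)\<bar> \<le> \<bar>\<alpha>\<bar> * \<bar>M\<bar> * B * h ^ k"
      using M by (simp add: k power_add mult_ac power2_eq_square power3_eq_cube numeral_3_eq_3)
    have "\<bar>lin1 \<alpha> \<mu> m u v * (u 1 - v 1)\<bar> \<le> (C1 * h) * (B * h ^ (k - 1))"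
      unfolding abs_mult using * w[of 1] l C1 by (intro mult_mono) auto
    then have 3: "\<bar>lin1 \<alpha> \<mu> m u v * (u 1 - v 1)\<bar> \<le> C1 * B * h ^ k"
      by (simp add: k power_add mult_ac numeral_3_eq_3)
    have "\<bar>lin0 \<alpha> \<mu> m u v * (u 0 - v 0)\<bar> \<le> C0 * (B * h ^ (k - 0))"
      unfolding abs_mult using * w[of 0] l C0 by (intro mult_mono) auto
    then have 4: "\<bar>lin0 \<alpha> \<mu> m u v * (u 0 - v 0)\<bar> \<le> C0 * B * h ^ k"
      by (simp add: mult_ac)
    show "\<bar>Nl \<alpha> \<mu> m u - Nl \<alpha> \<mu> m v\<bar> \<le> (\<bar>M\<bar> + \<bar>\<alpha>\<bar> * \<bar>M\<bar> + C1 + C0) * B * h ^ k"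
      unfolding Nl_diff distrib_right using 1 2 3 4 by linarith
  qed
qed

lemma le_of_le_add_small:
  fixes a b E :: real
  assumes "\<And>h. 0 < h \<Longrightarrow> h \<le> 1 \<Longrightarrow> a \<le> b + h * E"
  shows "a \<le> b"
proof (rule field_le_epsilon)
  fix e :: real assume "e > 0"
  define h where "h = min 1 (e / (\<bar>E\<bar> + 1))"
  have h: "0 < h" "h \<le> 1" using \<open>e > 0\<close> by (auto simp: h_def)
  have "h * E \<le> h * (\<bar>E\<bar> + 1)" using h by (intro mult_left_mono) auto
  also have "\<dots> \<le> e / (\<bar>E\<bar> + 1) * (\<bar>E\<bar> + 1)" by (intro mult_right_mono) (auto simp: h_def)
  also have "\<dots> = e" by simp
  finally show "a \<le> b + e" using assms[OF h] by linarith
qed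

lemma triple_zero_bounds:
  assumes c: "classical \<alpha> \<mu> m s M \<delta> U" and s: "s \<ge> 6" and t: "0 \<le> t" "t \<le> \<delta>"
    and z: "\<And>k. k \<le> 2 \<Longrightarrow> U k t z = 0" and k: "k \<le> 2"
  shows "\<bar>U k t x\<bar> \<le> M * \<bar>x - z\<bar> ^ (3 - k)"
proof -
  have "\<bar>U k t x - 0 * (x - z) ^ (2 - k) / fact (2 - k)\<bar> \<le> M * \<bar>x - z\<bar> ^ Suc (2 - k)"
  proof (rule chain_expansion)
    show "\<bar>U 2 t x - 0\<bar> \<le> M * \<bar>x - z\<bar>" for x
      using classicalD(3)[OF c, of 2 t x z] s t z[of 2] by simp
  qed (use classicalD(4)[OF c] s t z k in auto)
  moreover have "Suc (2 - k) = 3 - k" using k by simp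
  ultimately show ?thesis by simp
qed

text \<open>Induction on the order k. Once the lower jets agree at \<open>z\<close>, the difference
  at distance \<open>h\<close> is its k-th jet times \<open>h ^ k / fact k\<close> up to sign and
  O(h^(k+1)). Dividing the undifferentiated equation by \<open>h ^ k\<close> and letting
  \<open>h\<close> tend to 0 gives a closed estimate for that jet, whereas differentiating k times
  would need order k + 3. The sign \<open>\<sigma>\<close> is the side from which \<open>z\<close>
  is approached.\<close>

lemma pair_jets_persist:
  assumes s: "s \<ge> 6" and m: "m \<ge> 2"
  obtains t0 where "t0 > 0"
    "\<And>U V \<delta> z \<sigma> t k C. classical \<alpha> \<mu> m s M \<delta> U \<Longrightarrow> classical \<alpha> \<mu> m s M \<delta> V \<Longrightarrow> \<bar>\<sigma>\<bar> = 1 \<Longrightarrow>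
       (\<And>\<tau> k. 0 \<le> \<tau> \<Longrightarrow> \<tau> \<le> t \<Longrightarrow> k \<le> 2 \<Longrightarrow> U k \<tau> z = 0 \<and> V k \<tau> z = 0) \<Longrightarrow>
       (\<And>h. 0 \<le> h \<Longrightarrow> h \<le> 1 \<Longrightarrow> \<bar>U 0 0 (z + \<sigma> * h) - V 0 0 (z + \<sigma> * h)\<bar> \<le> C * h ^ s) \<Longrightarrow>
       0 \<le> t \<Longrightarrow> t \<le> t0 \<Longrightarrow> t \<le> \<delta> \<Longrightarrow> k < s \<Longrightarrow> U k t z = V k t z"
proof -
  obtain C1 where C1: "C1 > 0" "\<And>u v h B k. (\<And>j. j \<le> 3 \<Longrightarrow> \<bar>u j\<bar> \<le> M \<and> \<bar>v j\<bar> \<le> M) \<Longrightarrow>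
     \<bar>u 0\<bar> \<le> M * h ^ 3 \<Longrightarrow> \<bar>u 1\<bar> \<le> M * h ^ 2 \<Longrightarrow> \<bar>v 2\<bar> \<le> M * h \<Longrightarrow> 0 \<le> h \<Longrightarrow> h \<le> 1 \<Longrightarrow> k \<ge> 3 \<Longrightarrow>
     (\<And>j. j \<le> 3 \<Longrightarrow> \<bar>u j - v j\<bar> \<le> B * h ^ (k - j)) \<Longrightarrow>
     \<bar>Nl \<alpha> \<mu> m u - Nl \<alpha> \<mu> m v\<bar> \<le> C1 * B * h ^ k"
    by (rule Nl_diff_bound[OF m, of M \<alpha> \<mu>]) blast
  show thesis
  \<comment> \<open>\<open>fact s\<close> bounds the Taylor factor \<open>fact k\<close> for all
    orders at once, and the remaining \<open>1 / (2 * C1)\<close> makes the contribution of the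
    equation at most half of any bound \<open>B\<close>.\<close>
  proof (rule that[of "1 / (2 * C1 * fact s)"])
    show "1 / (2 * C1 * fact s) > 0" using C1(1) by simp
    fix U V \<delta> z \<sigma> t C and k :: nat
    assume cU: "classical \<alpha> \<mu> m s M \<delta> U" and cV: "classical \<alpha> \<mu> m s M \<delta> V" and \<sigma>: "\<bar>\<sigma>\<bar> = (1::real)"
      and zero: "\<And>\<tau> k. 0 \<le> \<tau> \<Longrightarrow> \<tau> \<le> t \<Longrightarrow> k \<le> 2 \<Longrightarrow> U k \<tau> z = 0 \<and> V k \<tau> z = 0"
      and flat: "\<And>h. 0 \<le> h \<Longrightarrow> h \<le> 1 \<Longrightarrow> \<bar>U 0 0 (z + \<sigma> * h) - V 0 0 (z + \<sigma> * h)\<bar> \<le> C * h ^ s"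
      and t: "0 \<le> t" "t \<le> 1 / (2 * C1 * fact s)" "t \<le> \<delta>" and k: "k < s"
    define W where "W k \<tau> x = U k \<tau> x - V k \<tau> x" for k \<tau> x
    have M: "0 \<le> M" using classicalD(2)[OF cU, of 0 0 0] s t by force
    have C: "0 \<le> C" using flat[of 1] by simp
    have zU: "\<And>k. k \<le> 2 \<Longrightarrow> U k \<tau> z = 0" and zV: "\<And>k. k \<le> 2 \<Longrightarrow> V k \<tau> z = 0" if "0 \<le> \<tau>" "\<tau> \<le> t" for \<tau>
      using zero that by auto
    have "\<forall>\<tau>\<in>{0..t}. W k \<tau> z = 0"
      using k
    proof (induction k rule: less_induct)
      case (less k)
      show ?case
      proof (cases "k \<le> 2")
        case True
        then show ?thesis using zero by (simp add: W_def)
      next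
        case False
        have step: "\<bar>W k \<tau> z\<bar> \<le> B / 2" if B: "\<And>\<tau>. \<tau> \<in> {0..t} \<Longrightarrow> \<bar>W k \<tau> z\<bar> \<le> B" and \<tau>: "\<tau> \<in> {0..t}" for B \<tau>
        proof -
          have B0: "0 \<le> B" using B[OF \<tau>] by linarith
          have \<tau>\<delta>: "0 \<le> \<tau>" "\<tau> \<le> \<delta>" using \<tau> t by auto
          have exp: "\<bar>W j \<tau>' x - W k \<tau>' z * (x - z) ^ (k - j) / fact (k - j)\<bar> \<le> 2 * M * \<bar>x - z\<bar> ^ Suc (k - j)"
            if "j \<le> k" "\<tau>' \<in> {0..t}" for j \<tau>' x
          proof (rule chain_expansion[where f = "\<lambda>j. W j \<tau>'"])
            show "(W j \<tau>' has_real_derivative W (Suc j) \<tau>' x) (at x)" if "j < k" for j x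
              unfolding W_def using that less.prems \<open>\<tau>' \<in> {0..t}\<close> t
              by (intro DERIV_diff classicalD(4)[OF cU] classicalD(4)[OF cV]) auto
            show "\<bar>W k \<tau>' x - W k \<tau>' z\<bar> \<le> 2 * M * \<bar>x - z\<bar>" for x
              using classicalD(3)[OF cU, of k \<tau>' x z] classicalD(3)[OF cV, of k \<tau>' x z] less.prems that t
              by (auto simp: W_def)
            show "W j \<tau>' z = 0" if "j < k" for j
              using less.IH[OF that] less.prems that \<open>\<tau>' \<in> {0..t}\<close> by auto
          qed (use that in auto)
          \<comment> \<open>The term with the factor \<open>h\<close> collects the Taylor remainders
            and the initial difference, which is of order \<open>h ^ s\<close> with
            \<open>s > k\<close>. It disappears as \<open>h\<close> tends to 0 and leaves a multiple
            of \<open>\<tau> * B\<close>.\<close>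
          have "\<bar>W k \<tau> z\<bar> \<le> fact k * (C1 * \<tau> * B) + h * (fact k * (2 * M + C + 2 * M * C1 * \<tau>))"
            if h: "0 < h" "h \<le> 1" for h
          proof -
            define x where "x = z + \<sigma> * h"
            have xz: "\<bar>x - z\<bar> = h" using h \<sigma> by (simp add: x_def abs_mult)
            have bnd: "\<bar>Nl \<alpha> \<mu> m (\<lambda>k. U k \<tau>' x) - Nl \<alpha> \<mu> m (\<lambda>k. V k \<tau>' x)\<bar> \<le> C1 * (B + 2 * M * h) * h ^ k"
              if \<tau>': "\<tau>' \<in> {0..t}" for \<tau>'
            proof (rule C1(2))
              show "\<bar>U j \<tau>' x\<bar> \<le> M \<and> \<bar>V j \<tau>' x\<bar> \<le> M" if "j \<le> 3" for j
                using classicalD(2)[OF cU] classicalD(2)[OF cV] that \<tau>' t s by auto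
              have "\<bar>U j \<tau>' x\<bar> \<le> M * h ^ (3 - j)" "\<bar>V j \<tau>' x\<bar> \<le> M * h ^ (3 - j)" if "j \<le> 2" for j
                using triple_zero_bounds[OF cU s, of \<tau>' z j x] triple_zero_bounds[OF cV s, of \<tau>' z j x]
                  zU[of \<tau>'] zV[of \<tau>'] that \<tau>' t by (auto simp: xz)
              from this(1)[of 0] this(1)[of 1] this(2)[of 2]
              show "\<bar>U 0 \<tau>' x\<bar> \<le> M * h ^ 3" "\<bar>U 1 \<tau>' x\<bar> \<le> M * h ^ 2" "\<bar>V 2 \<tau>' x\<bar> \<le> M * h" by auto
              show "\<bar>U j \<tau>' x - V j \<tau>' x\<bar> \<le> (B + 2 * M * h) * h ^ (k - j)" if "j \<le> 3" for j
              proof -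
                have "\<bar>W k \<tau>' z * (x - z) ^ (k - j) / fact (k - j)\<bar> = \<bar>W k \<tau>' z\<bar> * h ^ (k - j) / fact (k - j)"
                  by (simp add: abs_mult power_abs xz)
                also have "\<dots> \<le> B * h ^ (k - j) / 1"
                  using B[OF \<tau>'] h B0 by (intro frac_le mult_right_mono) auto
                finally have 1: "\<bar>W k \<tau>' z * (x - z) ^ (k - j) / fact (k - j)\<bar> \<le> B * h ^ (k - j)" by simp
                have "j \<le> k" using that False by simp
                from exp[OF this \<tau>', of x]
                have "\<bar>W j \<tau>' x - W k \<tau>' z * (x - z) ^ (k - j) / fact (k - j)\<bar> \<le> 2 * M * h ^ Suc (k - j)"
                  unfolding xz .
                with 1 have "\<bar>W j \<tau>' x\<bar> \<le> B * h ^ (k - j) + 2 * M * h ^ Suc (k - j)" by linarith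
                then show ?thesis by (simp add: W_def algebra_simps)
              qed
            qed (use h False in auto)
            have "W 0 \<tau> x = W 0 0 x - integral {0..\<tau>} (\<lambda>\<tau>. Nl \<alpha> \<mu> m (\<lambda>k. U k \<tau> x) - Nl \<alpha> \<mu> m (\<lambda>k. V k \<tau> x))"
              using classicalD(5)[OF cU \<tau>\<delta>, of x] classicalD(5)[OF cV \<tau>\<delta>, of x]
                integral_diff[OF integrable_continuous_interval[OF classical_cont_t(1)[OF cU s \<tau>\<delta>(2)]]
                  integrable_continuous_interval[OF classical_cont_t(1)[OF cV s \<tau>\<delta>(2)]], of x x]
              by (simp add: W_def)
            moreover have "\<bar>integral {0..\<tau>} (\<lambda>\<tau>. Nl \<alpha> \<mu> m (\<lambda>k. U k \<tau> x) - Nl \<alpha> \<mu> m (\<lambda>k. V k \<tau> x))\<bar> \<le> (C1 * (B + 2 * M * h) * h ^ k) * \<tau>"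
              by (rule integral_abs_le[OF continuous_on_diff[OF classical_cont_t(1)[OF cU s \<tau>\<delta>(2)] classical_cont_t(1)[OF cV s \<tau>\<delta>(2)]]])
                (use bnd \<tau> in auto)
            moreover have "\<bar>W 0 0 x\<bar> \<le> C * h ^ Suc k"
            proof -
              have "\<bar>W 0 0 x\<bar> \<le> C * h ^ s" using flat[of h] h by (simp add: W_def x_def)
              also have "\<dots> \<le> C * h ^ Suc k" using less.prems h C by (intro mult_left_mono power_decreasing) auto
              finally show ?thesis .
            qed
            ultimately have "\<bar>W 0 \<tau> x\<bar> \<le> C * h ^ Suc k + (C1 * (B + 2 * M * h) * h ^ k) * \<tau>" by linarith
            moreover have "\<bar>W k \<tau> z\<bar> * h ^ k / fact k \<le> \<bar>W 0 \<tau> x\<bar> + 2 * M * h ^ Suc k"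
            proof -
              have "\<bar>W k \<tau> z * (x - z) ^ k / fact k\<bar> = \<bar>W k \<tau> z\<bar> * h ^ k / fact k"
                by (simp add: abs_mult power_abs xz)
              moreover have "\<bar>W 0 \<tau> x - W k \<tau> z * (x - z) ^ k / fact k\<bar> \<le> 2 * M * h ^ Suc k"
                using exp[of 0 \<tau> x] \<tau> by (simp add: xz)
              ultimately show ?thesis by linarith
            qed
            ultimately have "\<bar>W k \<tau> z\<bar> * h ^ k / fact k \<le> (C1 * \<tau> * B + h * (2 * M + C + 2 * M * C1 * \<tau>)) * h ^ k"
              by (simp add: algebra_simps)
            then have "(\<bar>W k \<tau> z\<bar> / fact k) * h ^ k \<le> (C1 * \<tau> * B + h * (2 * M + C + 2 * M * C1 * \<tau>)) * h ^ k" by simp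
            then have "\<bar>W k \<tau> z\<bar> / fact k \<le> C1 * \<tau> * B + h * (2 * M + C + 2 * M * C1 * \<tau>)"
              using h by (simp only: mult_le_cancel_right_pos zero_less_power)
            then show ?thesis by (simp add: pos_divide_le_eq algebra_simps)
          qed
          then have "\<bar>W k \<tau> z\<bar> \<le> fact k * (C1 * \<tau> * B)" by (rule le_of_le_add_small)
          also have "\<dots> \<le> fact s * (C1 * (1 / (2 * C1 * fact s)) * B)"
          proof (rule mult_mono)
            show "(fact k :: real) \<le> fact s" using less.prems by (intro fact_mono) auto
            show "C1 * \<tau> * B \<le> C1 * (1 / (2 * C1 * fact s)) * B"
              using \<tau> t C1(1) B0 by (intro mult_right_mono mult_left_mono) auto
          qed (use C1(1) B0 \<tau> in auto)
          also have "\<dots> = B / 2" using C1(1) by simp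
          finally show ?thesis .
        qed
        have bnd: "\<bar>W k \<tau> z\<bar> \<le> 2 * M" if "\<tau> \<in> {0..t}" for \<tau>
          using classicalD(2)[OF cU, of k \<tau> z] classicalD(2)[OF cV, of k \<tau> z] less.prems that t by (auto simp: W_def)
        show ?thesis
        proof
          fix \<tau> assume \<tau>: "\<tau> \<in> {0..t}"
          show "W k \<tau> z = 0"
            by (rule halving_zero[of "{0..t}" "\<lambda>\<tau>. W k \<tau> z" "2 * M"])
              (blast intro: step, blast intro: bnd, rule \<tau>)
        qed
      qed
    qed
    then show "U k t z = V k t z" using t by (simp add: W_def)
  qed
qed

section \<open>Uniform bounds for a pair of solutions on a short time interval\<close>

definition dpi :: "real \<Rightarrow> real" where "dpi x = min x (pi - x)"

text \<open>What the energy and the testing argument use about a pair, beyond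
  \<open>classical\<close>. On the interval from 0 to pi, \<open>dpi\<close> is the distance to the
  two zeros. \<open>A\<close> stands for the cubic coefficient at time 0, so freezing it costs a
  relative error of order \<open>x + t\<close>.\<close>

definition good_pair :: "nat \<Rightarrow> real \<Rightarrow> real \<Rightarrow> real \<Rightarrow> real \<Rightarrow>
    (nat \<Rightarrow> real \<Rightarrow> real \<Rightarrow> real) \<Rightarrow> (nat \<Rightarrow> real \<Rightarrow> real \<Rightarrow> real) \<Rightarrow> bool" where
  "good_pair s A c K t0 U V \<longleftrightarrow> (\<forall>t\<in>{0..t0}. \<forall>x\<in>{0..pi}.
     (\<forall>k\<le>2. \<bar>U k t x\<bar> \<le> K * dpi x ^ (3 - k) \<and> \<bar>V k t x\<bar> \<le> K * dpi x ^ (3 - k) \<and>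
            \<bar>U k t x - V k t x\<bar> \<le> K * dpi x ^ (s - k)) \<and>
     c * dpi x ^ 3 \<le> U 0 t x \<and>
     (x \<le> 1 \<longrightarrow> \<bar>U 0 t x - A * x ^ 3\<bar> \<le> K * (x + t) * x ^ 3 \<and>
               \<bar>U 1 t x - 3 * A * x ^ 2\<bar> \<le> K * (x + t) * x ^ 2))"

lemma Nl_small:
  assumes m: "m \<ge> 2"
  obtains C where "C > 0" "\<And>v h. (\<And>k. k \<le> 5 \<Longrightarrow> \<bar>v k\<bar> \<le> M) \<Longrightarrow> 0 \<le> h \<Longrightarrow> h \<le> 4 \<Longrightarrow>
     (\<And>k. k \<le> 2 \<Longrightarrow> \<bar>v k\<bar> \<le> M * h ^ (3 - k)) \<Longrightarrow>
     \<bar>Nl \<alpha> \<mu> m v\<bar> \<le> C * h ^ 3 \<and> \<bar>Nl1 \<alpha> \<mu> m v\<bar> \<le> C * h ^ 2"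
proof -
  define S where "S = {(v :: nat \<Rightarrow> real, h :: real). (\<forall>k\<le>5. \<bar>v k\<bar> \<le> M) \<and> 0 \<le> h \<and> h \<le> 4 \<and>
     (\<forall>k\<le>2. \<bar>v k\<bar> \<le> M * h ^ (3 - k))}"
  have b: "dom S (\<lambda>q. fst q k) (\<lambda>_. 1)" if "k \<le> 5" for k
    using that by (intro domI[where C = M]) (auto simp: S_def)
  have v: "dom S (\<lambda>q. fst q k) (\<lambda>q. snd q ^ (3 - k))" if "k \<le> 2" for k
    using that by (intro domI[where C = M]) (auto simp: S_def)
  have v0: "dom S (\<lambda>q. fst q 0) (\<lambda>q. snd q ^ 3)" and v1: "dom S (\<lambda>q. fst q 1) (\<lambda>q. snd q ^ 2)"
    and v2: "dom S (\<lambda>q. fst q 2) snd"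
    using v[of 0] v[of 1] v[of 2] by simp_all
  have h: "dom S snd (\<lambda>_. 1)" by (rule domI[where C = 4]) (auto simp: S_def)
  have v0': "dom S (\<lambda>q. fst q 0) (\<lambda>q. snd q ^ 2)"
    by (rule dom_trans[OF v0]) (use dom_mult_bdd[OF h dom_refl[of S "\<lambda>q. snd q ^ 2"]] in \<open>simp add: power3_eq_cube power2_eq_square mult.assoc\<close>)
  have v12: "dom S (\<lambda>q. fst q 1 * fst q 2) (\<lambda>q. snd q ^ 3)"
    using dom_mult[OF v1 v2] by (simp add: power3_eq_cube power2_eq_square)
  have v22: "dom S (\<lambda>q. fst q 2 * fst q 2) (\<lambda>q. snd q ^ 2)"
    using dom_mult[OF v2 v2] by (simp add: power2_eq_square)
  have m1: "m - Suc 0 = Suc (m - 2)" using m by simp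
  have "dom S (\<lambda>q. fst q 3 * fst q 0 + \<alpha> * (fst q 1 * fst q 2) + \<mu> * ((fst q 0 ^ (m - 2) * fst q 1) * fst q 0)) (\<lambda>q. snd q ^ 3)"
    by (intro dom_add dom_cmult v12 dom_mult_bdd[OF _ v0] dom_mult_bdd dom_power b) auto
  then have "dom S (\<lambda>q. Nl \<alpha> \<mu> m (fst q)) (\<lambda>q. snd q ^ 3)"
    by (rule dom_cong) (simp add: Nl_def m1)
  then obtain C0 where C0: "C0 > 0" "\<And>q. q \<in> S \<Longrightarrow> \<bar>Nl \<alpha> \<mu> m (fst q)\<bar> \<le> C0 * \<bar>snd q ^ 3\<bar>"
    by (rule domE) blast
  have "dom S (\<lambda>q. fst q 3 * fst q 1 + fst q 4 * fst q 0 + \<alpha> * (fst q 2 * fst q 2 + fst q 3 * fst q 1)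
       + \<mu> * (real (m - 1) * ((fst q 0 ^ (m - 2) * fst q 1) * fst q 1) + (fst q 0 ^ (m - 2) * fst q 2) * fst q 0)) (\<lambda>q. snd q ^ 2)"
    by (intro dom_add dom_cmult v22 dom_mult_bdd[OF _ v0'] dom_mult_bdd[OF _ v1] dom_mult_bdd dom_power b) auto
  then have "dom S (\<lambda>q. Nl1 \<alpha> \<mu> m (fst q)) (\<lambda>q. snd q ^ 2)"
    by (rule dom_cong) (simp add: Nl1_def m1 mult_ac)
  then obtain C1 where C1: "C1 > 0" "\<And>q. q \<in> S \<Longrightarrow> \<bar>Nl1 \<alpha> \<mu> m (fst q)\<bar> \<le> C1 * \<bar>snd q ^ 2\<bar>"
    by (rule domE) blast
  show thesis
  proof (rule that[of "C0 + C1"])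
    fix v :: "nat \<Rightarrow> real" and h :: real
    assume "\<And>k. k \<le> 5 \<Longrightarrow> \<bar>v k\<bar> \<le> M" "0 \<le> h" "h \<le> 4" "\<And>k. k \<le> 2 \<Longrightarrow> \<bar>v k\<bar> \<le> M * h ^ (3 - k)"
    then have q: "(v, h) \<in> S" by (auto simp: S_def)
    have "0 \<le> C0 * h ^ 2" "0 \<le> C1 * h ^ 3" using \<open>0 \<le> h\<close> C0(1) C1(1) by simp_all
    then show "\<bar>Nl \<alpha> \<mu> m v\<bar> \<le> (C0 + C1) * h ^ 3 \<and> \<bar>Nl1 \<alpha> \<mu> m v\<bar> \<le> (C0 + C1) * h ^ 2"
      using C0(2)[OF q] C1(2)[OF q] \<open>0 \<le> h\<close> by (simp add: distrib_right)
  qed (use C0 C1 in auto)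
qed

text \<open>\<open>t0\<close> and \<open>K\<close> are fixed before the pair and before the flatness
  constant \<open>C\<close>. That constant serves qualitatively, to make the jets of the two
  solutions agree at the zeros; the size of the difference then comes from the Lipschitz bound
  \<open>M\<close>.\<close>

lemma short_time:
  assumes s: "s \<ge> 6" and m: "m \<ge> 2" and M: "M \<ge> 0" and "\<delta> > 0" and c0: "c0 > 0"
  obtains t0 K where "t0 > 0" "t0 \<le> \<delta>" "K > 0"
    "\<And>U V C. classical \<alpha> \<mu> m s M \<delta> U \<Longrightarrow> classical \<alpha> \<mu> m s M \<delta> V \<Longrightarrow>
       (\<And>z k. z \<in> {0, pi} \<Longrightarrow> k \<le> 2 \<Longrightarrow> U k 0 z = 0 \<and> V k 0 z = 0) \<Longrightarrow> U 3 0 0 = 6 * A \<Longrightarrow>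
       (\<And>x. x \<in> {0..pi} \<Longrightarrow> c0 * dpi x ^ 3 \<le> U 0 0 x) \<Longrightarrow>
       (\<And>x. x \<in> {0..pi} \<Longrightarrow> \<bar>U 0 0 x - V 0 0 x\<bar> \<le> C * dpi x ^ s) \<Longrightarrow>
       good_pair s A (c0 / 2) K t0 U V"
proof -
  obtain t1 where t1: "t1 > 0" "\<And>U \<delta> z t k. classical \<alpha> \<mu> m s M \<delta> U \<Longrightarrow> (\<And>k. k \<le> 2 \<Longrightarrow> U k 0 z = 0) \<Longrightarrow>
       0 \<le> t \<Longrightarrow> t \<le> t1 \<Longrightarrow> t \<le> \<delta> \<Longrightarrow> k \<le> 2 \<Longrightarrow> U k t z = 0"
    by (rule triple_zero_persists[OF s m, of \<alpha> \<mu> M]) blast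
  obtain t2 where t2: "t2 > 0" "\<And>U V \<delta> z \<sigma> t k C. classical \<alpha> \<mu> m s M \<delta> U \<Longrightarrow> classical \<alpha> \<mu> m s M \<delta> V \<Longrightarrow> \<bar>\<sigma>\<bar> = 1 \<Longrightarrow>
       (\<And>\<tau> k. 0 \<le> \<tau> \<Longrightarrow> \<tau> \<le> t \<Longrightarrow> k \<le> 2 \<Longrightarrow> U k \<tau> z = 0 \<and> V k \<tau> z = 0) \<Longrightarrow>
       (\<And>h. 0 \<le> h \<Longrightarrow> h \<le> 1 \<Longrightarrow> \<bar>U 0 0 (z + \<sigma> * h) - V 0 0 (z + \<sigma> * h)\<bar> \<le> C * h ^ s) \<Longrightarrow>
       0 \<le> t \<Longrightarrow> t \<le> t2 \<Longrightarrow> t \<le> \<delta> \<Longrightarrow> k < s \<Longrightarrow> U k t z = V k t z"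
    by (rule pair_jets_persist[OF s m, of \<alpha> \<mu> M]) blast
  obtain C2 where C2: "C2 > 0" "\<And>v h. (\<And>k. k \<le> 5 \<Longrightarrow> \<bar>v k\<bar> \<le> M) \<Longrightarrow> 0 \<le> h \<Longrightarrow> h \<le> 4 \<Longrightarrow>
     (\<And>k. k \<le> 2 \<Longrightarrow> \<bar>v k\<bar> \<le> M * h ^ (3 - k)) \<Longrightarrow>
     \<bar>Nl \<alpha> \<mu> m v\<bar> \<le> C2 * h ^ 3 \<and> \<bar>Nl1 \<alpha> \<mu> m v\<bar> \<le> C2 * h ^ 2"
    by (rule Nl_small[OF m, of M \<alpha> \<mu>]) blast
  \<comment> \<open>\<open>c0 / (2 * C2)\<close> is a time during which the equation removes at most
    half of the lower bound \<open>c0 * dpi x ^ 3\<close>.\<close>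
  define t0 where "t0 = min (min t1 t2) (min \<delta> (c0 / (2 * C2)))"
  have t0: "t0 > 0" "t0 \<le> t1" "t0 \<le> t2" "t0 \<le> \<delta>" "t0 \<le> c0 / (2 * C2)"
    using t1(1) t2(1) C2(1) c0 \<open>\<delta> > 0\<close> by (auto simp: t0_def)
  define K where "K = 2 * M + C2 + 1"
  show thesis
  proof (rule that[of t0 K])
    show "K > 0" using M C2(1) by (simp add: K_def)
    fix U V C
    assume cU: "classical \<alpha> \<mu> m s M \<delta> U" and cV: "classical \<alpha> \<mu> m s M \<delta> V"
      and z: "\<And>z k. z \<in> {0, pi} \<Longrightarrow> k \<le> 2 \<Longrightarrow> U k 0 z = 0 \<and> V k 0 z = 0" and A: "U 3 0 0 = 6 * A"
      and low: "\<And>x. x \<in> {0..pi} \<Longrightarrow> c0 * dpi x ^ 3 \<le> U 0 0 x"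
      and flat: "\<And>x. x \<in> {0..pi} \<Longrightarrow> \<bar>U 0 0 x - V 0 0 x\<bar> \<le> C * dpi x ^ s"
    have zU: "U k t z = 0" and zV: "V k t z = 0" if "0 \<le> t" "t \<le> t0" "k \<le> 2" "z \<in> {0, pi}" for k t z
      using t1(2)[OF cU, of z t k] t1(2)[OF cV, of z t k] that z t0 by auto
    have h_pi: "1 \<le> pi / 2" using pi_gt3 by simp
    have zW: "U k t z = V k t z" if "0 \<le> t" "t \<le> t0" "k < s" "z \<in> {0, pi}" for k t z
    proof (rule t2(2)[OF cU cV, where C = C])
      define \<sigma> :: real where "\<sigma> = (if z = 0 then 1 else -1)"
      show "\<bar>\<sigma>\<bar> = 1" by (simp add: \<sigma>_def)
      show "\<bar>U 0 0 (z + \<sigma> * h) - V 0 0 (z + \<sigma> * h)\<bar> \<le> C * h ^ s" if "0 \<le> h" "h \<le> 1" for h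
      proof -
        have "z + \<sigma> * h \<in> {0..pi}" "dpi (z + \<sigma> * h) = h"
          using that \<open>z \<in> {0, pi}\<close> h_pi by (auto simp: \<sigma>_def dpi_def)
        then show ?thesis using flat[of "z + \<sigma> * h"] by simp
      qed
      show "U k \<tau> z = 0 \<and> V k \<tau> z = 0" if "0 \<le> \<tau>" "\<tau> \<le> t" "k \<le> 2" for \<tau> k
        using zU zV that \<open>t \<le> t0\<close> \<open>z \<in> {0, pi}\<close> by auto
    qed (use that t0 in auto)
    have dpi: "\<exists>z\<in>{0, pi}. \<bar>x - z\<bar> = dpi x" if "x \<in> {0..pi}" for x
      using that by (auto simp: dpi_def min_def)
    have bU: "\<bar>U k t x\<bar> \<le> M * dpi x ^ (3 - k)" and bV: "\<bar>V k t x\<bar> \<le> M * dpi x ^ (3 - k)"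
      if t: "0 \<le> t" "t \<le> t0" and k: "k \<le> 2" and x: "x \<in> {0..pi}" for k t x
    proof -
      obtain z where z: "z \<in> {0, pi}" "\<bar>x - z\<bar> = dpi x" using dpi[OF x] by blast
      have "t \<le> \<delta>" using t t0 by simp
      show "\<bar>U k t x\<bar> \<le> M * dpi x ^ (3 - k)"
        using triple_zero_bounds[OF cU s t(1) \<open>t \<le> \<delta>\<close> zU[OF t _ z(1)] k, of x] z(2) by simp
      show "\<bar>V k t x\<bar> \<le> M * dpi x ^ (3 - k)"
        using triple_zero_bounds[OF cV s t(1) \<open>t \<le> \<delta>\<close> zV[OF t _ z(1)] k, of x] z(2) by simp
    qed
    have bW: "\<bar>U k t x - V k t x\<bar> \<le> 2 * M * dpi x ^ (s - k)"
      if t: "0 \<le> t" "t \<le> t0" and k: "k \<le> 2" and x: "x \<in> {0..pi}" for k t x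
    proof -
      obtain z where z: "z \<in> {0, pi}" "\<bar>x - z\<bar> = dpi x" using dpi[OF x] by blast
      have "t \<le> \<delta>" using t t0 by simp
      have "\<bar>(U k t x - V k t x) - 0 * (x - z) ^ (s - 1 - k) / fact (s - 1 - k)\<bar> \<le> (2 * M) * \<bar>x - z\<bar> ^ Suc (s - 1 - k)"
      proof (rule chain_expansion[where f = "\<lambda>k x. U k t x - V k t x"])
        show "((\<lambda>x. U j t x - V j t x) has_real_derivative U (Suc j) t x - V (Suc j) t x) (at x)" if "j < s - 1" for j x
          using that t \<open>t \<le> \<delta>\<close> by (intro DERIV_diff classicalD(4)[OF cU] classicalD(4)[OF cV]) auto
        \<comment> \<open>All jets below order \<open>s\<close> agree at \<open>z\<close>, so the
          difference of the top ones vanishes there and has Lipschitz constant \<open>2 * M\<close>.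
          The expansion turns this into order \<open>s - k\<close> at level
          \<open>k\<close>.\<close>
        show "\<bar>U (s - 1) t x - V (s - 1) t x - 0\<bar> \<le> 2 * M * \<bar>x - z\<bar>" for x
        proof -
          have s1: "s - 1 < s" using s by simp
          have "U (s - 1) t z = V (s - 1) t z" by (rule zW[OF t s1 z(1)])
          with classicalD(3)[OF cU s1 t(1) \<open>t \<le> \<delta>\<close>, of x z] classicalD(3)[OF cV s1 t(1) \<open>t \<le> \<delta>\<close>, of x z]
          show ?thesis by linarith
        qed
        show "U j t z - V j t z = 0" if "j < s - 1" for j using zW[OF t, of j z] z that by auto
      qed (use k s in auto)
      moreover have e: "Suc (s - 1 - k) = s - k" using k s by simp
      ultimately show ?thesis unfolding e z(2) by simp
    qed
    have dpi4: "0 \<le> dpi x \<and> dpi x \<le> 4 \<and> dpi x \<le> x" if "x \<in> {0..pi}" for x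
      using that pi_less_4 by (auto simp: dpi_def min_def)
    have N: "\<bar>Nl \<alpha> \<mu> m (\<lambda>k. U k t x)\<bar> \<le> C2 * dpi x ^ 3 \<and> \<bar>Nl1 \<alpha> \<mu> m (\<lambda>k. U k t x)\<bar> \<le> C2 * dpi x ^ 2"
      if t: "0 \<le> t" "t \<le> t0" and x: "x \<in> {0..pi}" for t x
      by (rule C2(2)) (use bU[OF t _ x] classicalD(2)[OF cU] t t0 s dpi4[OF x] in auto)
    have d0: "\<bar>U 0 t x - U 0 0 x\<bar> \<le> C2 * dpi x ^ 3 * t" and d1: "\<bar>U 1 t x - U 1 0 x\<bar> \<le> C2 * dpi x ^ 2 * t"
      if t: "0 \<le> t" "t \<le> t0" and x: "x \<in> {0..pi}" for t x
    proof -
      have "t \<le> \<delta>" using t t0 by simp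
      have "\<bar>integral {0..t} (\<lambda>\<tau>. Nl \<alpha> \<mu> m (\<lambda>k. U k \<tau> x))\<bar> \<le> (C2 * dpi x ^ 3) * t"
        by (rule integral_abs_le[OF classical_cont_t(1)[OF cU s \<open>t \<le> \<delta>\<close>]]) (use N[OF _ _ x] t in auto)
      then show "\<bar>U 0 t x - U 0 0 x\<bar> \<le> C2 * dpi x ^ 3 * t"
        using classicalD(5)[OF cU t(1) \<open>t \<le> \<delta>\<close>, of x] by simp
      have "\<bar>integral {0..t} (\<lambda>\<tau>. Nl1 \<alpha> \<mu> m (\<lambda>k. U k \<tau> x))\<bar> \<le> (C2 * dpi x ^ 2) * t"
        by (rule integral_abs_le[OF classical_cont_t(2)[OF cU s \<open>t \<le> \<delta>\<close>]]) (use N[OF _ _ x] t in auto)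
      then show "\<bar>U 1 t x - U 1 0 x\<bar> \<le> C2 * dpi x ^ 2 * t"
        using classical_jets(1)[OF cU s m t(1) \<open>t \<le> \<delta>\<close>, of x] by simp
    qed
    have lowt: "c0 / 2 * dpi x ^ 3 \<le> U 0 t x" if t: "0 \<le> t" "t \<le> t0" and x: "x \<in> {0..pi}" for t x
    proof -
      have "C2 * dpi x ^ 3 * t \<le> C2 * dpi x ^ 3 * (c0 / (2 * C2))"
        using t t0 C2(1) dpi4[OF x] by (intro mult_left_mono) auto
      also have "\<dots> = c0 / 2 * dpi x ^ 3" using C2(1) by simp
      finally show ?thesis using d0[OF t x] low[OF x] by linarith
    qed
    have near: "\<bar>U 0 t x - A * x ^ 3\<bar> \<le> K * (x + t) * x ^ 3 \<and> \<bar>U 1 t x - 3 * A * x ^ 2\<bar> \<le> K * (x + t) * x ^ 2"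
      if t: "0 \<le> t" "t \<le> t0" and x: "x \<in> {0..pi}" for t x
    proof -
      have e: "\<bar>U j 0 x - 6 * A * (x - 0) ^ (3 - j) / fact (3 - j)\<bar> \<le> M * \<bar>x - 0\<bar> ^ Suc (3 - j)" if "j \<le> 3" for j
      proof (rule chain_expansion[where f = "\<lambda>j. U j 0"])
        show "(U j 0 has_real_derivative U (Suc j) 0 x) (at x)" if "j < 3" for j x
          using classicalD(4)[OF cU, of j 0 x] that s \<open>\<delta> > 0\<close> by auto
        show "\<bar>U 3 0 x - 6 * A\<bar> \<le> M * \<bar>x - 0\<bar>" for x
          using classicalD(3)[OF cU, of 3 0 x 0] s \<open>\<delta> > 0\<close> A by auto
        show "U j 0 0 = 0" if "j < 3" for j using z[of 0 j] that by auto
      qed (rule that)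
      have x0: "0 \<le> x" "0 \<le> dpi x" "dpi x \<le> x" using dpi4[OF x] by auto
      have f: "fact 3 = (6::real)" "fact 2 = (2::real)" by (simp_all add: fact_numeral)
      have e0: "\<bar>U 0 0 x - A * x ^ 3\<bar> \<le> M * x * x ^ 3" and e1: "\<bar>U 1 0 x - 3 * A * x ^ 2\<bar> \<le> M * x * x ^ 2"
        using e[of 0] e[of 1] x0 f by (simp_all add: power4_eq_xxxx power3_eq_cube power2_eq_square mult_ac numeral_2_eq_2 numeral_3_eq_3)
      have p: "dpi x ^ 3 \<le> x ^ 3" "dpi x ^ 2 \<le> x ^ 2" using x0 by (auto intro: power_mono)
      have "\<bar>U 0 t x - A * x ^ 3\<bar> \<le> M * x * x ^ 3 + C2 * x ^ 3 * t"
      proof -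
        have "C2 * dpi x ^ 3 * t \<le> C2 * x ^ 3 * t" using p C2(1) t by (intro mult_right_mono mult_left_mono) auto
        then show ?thesis using d0[OF t x] e0 by linarith
      qed
      also have "\<dots> = (M * x + C2 * t) * x ^ 3" by (simp add: algebra_simps)
      also have "\<dots> \<le> K * (x + t) * x ^ 3"
        using x0 t M C2(1) by (intro mult_right_mono) (auto simp: K_def algebra_simps)
      finally have 1: "\<bar>U 0 t x - A * x ^ 3\<bar> \<le> K * (x + t) * x ^ 3" .
      have "\<bar>U 1 t x - 3 * A * x ^ 2\<bar> \<le> M * x * x ^ 2 + C2 * x ^ 2 * t"
      proof -
        have "C2 * dpi x ^ 2 * t \<le> C2 * x ^ 2 * t" using p C2(1) t by (intro mult_right_mono mult_left_mono) auto
        then show ?thesis using d1[OF t x] e1 by linarith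
      qed
      also have "\<dots> = (M * x + C2 * t) * x ^ 2" by (simp add: algebra_simps)
      also have "\<dots> \<le> K * (x + t) * x ^ 2"
        using x0 t M C2(1) by (intro mult_right_mono) (auto simp: K_def algebra_simps)
      finally show ?thesis using 1 by blast
    qed
    have wk: "B * dpi x ^ i \<le> K * dpi x ^ i" if "x \<in> {0..pi}" "B \<le> K" for x i B
      using dpi4[OF that(1)] that by (intro mult_right_mono) auto
    have MK: "M \<le> K" "2 * M \<le> K" using M C2(1) by (auto simp: K_def)
    show "good_pair s A (c0 / 2) K t0 U V"
      unfolding good_pair_def
    proof (intro ballI conjI allI impI)
      fix t x k assume t: "t \<in> {0..t0}" and x: "x \<in> {0..pi}"
      then have t': "0 \<le> t" "t \<le> t0" by auto
      show "\<bar>U k t x\<bar> \<le> K * dpi x ^ (3 - k)" if "k \<le> 2"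
        using bU[OF t' that x] wk[OF x MK(1), of "3 - k"] by linarith
      show "\<bar>V k t x\<bar> \<le> K * dpi x ^ (3 - k)" if "k \<le> 2"
        using bV[OF t' that x] wk[OF x MK(1), of "3 - k"] by linarith
      show "\<bar>U k t x - V k t x\<bar> \<le> K * dpi x ^ (s - k)" if "k \<le> 2"
        using bW[OF t' that x] wk[OF x MK(2), of "s - k"] by linarith
      show "c0 / 2 * dpi x ^ 3 \<le> U 0 t x" by (rule lowt[OF t' x])
      show "\<bar>U 0 t x - A * x ^ 3\<bar> \<le> K * (x + t) * x ^ 3" "\<bar>U 1 t x - 3 * A * x ^ 2\<bar> \<le> K * (x + t) * x ^ 2"
        using near[OF t' x] by auto
    qed
  qed (use t0 in auto)
qed

section \<open>Weighted energy estimate\<close>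

lemma gronwall_derivative:
  fixes E E' :: "real \<Rightarrow> real"
  assumes d: "\<And>t. t \<in> {0..T} \<Longrightarrow> (E has_real_derivative E' t) (at t within {0..T})"
    and le: "\<And>t. t \<in> {0..T} \<Longrightarrow> E' t \<le> C * E t + B"
    and C: "C \<ge> 0" and B: "B \<ge> 0" and t: "0 \<le> t" "t \<le> T"
  shows "E t \<le> exp (C * t) * (E 0 + B * t)"
proof (cases "t = 0")
  case False
  define g where "g t = exp (- (C * t)) * E t - B * t" for t
  have cont: "continuous_on {0..T} E"
    using d by (intro DERIV_continuous_on)
  have "g t \<le> g 0"
  proof (rule DERIV_nonpos_imp_decreasing_open[of 0 t g])
    show "0 \<le> t" by (rule t)
    show "\<exists>y. DERIV g x :> y \<and> y \<le> 0" if x: "0 < x" "x < t" for x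
    proof -
      have "x \<in> interior {0..T}" using x t by simp
      then have "(E has_real_derivative E' x) (at x)"
        using d[of x] x t by (metis at_within_interior atLeastAtMost_iff less_eq_real_def order_trans)
      then have "(g has_real_derivative (exp (- (C * x)) * (E' x - C * E x) - B)) (at x)"
        unfolding g_def by (auto intro!: derivative_eq_intros simp: algebra_simps)
      moreover have "exp (- (C * x)) * (E' x - C * E x) \<le> 1 * B"
      proof (cases "E' x - C * E x \<ge> 0")
        case True
        then show ?thesis using le[of x] x t C by (intro mult_mono) auto
      next
        case False
        then have "exp (- (C * x)) * (E' x - C * E x) \<le> 0" by (simp add: mult_le_0_iff)
        then show ?thesis using B by simp
      qed
      ultimately show ?thesis by force
    qed
    show "continuous_on {0..t} g"
      unfolding g_def by (intro continuous_intros continuous_on_subset[OF cont]) (use t in auto)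
  qed
  have "E t = exp (C * t) * (exp (- (C * t)) * E t)" by (simp add: exp_minus)
  also have "\<dots> \<le> exp (C * t) * (E 0 + B * t)"
    using \<open>g t \<le> g 0\<close> by (intro mult_left_mono) (auto simp: g_def)
  finally show ?thesis .
qed simp

lemma DERIV_powr_pos:
  assumes "(g has_real_derivative g') (at x within A)" "g x > 0"
  shows "((\<lambda>x. g x powr r) has_real_derivative r * g x powr (r - 1) * g') (at x within A)"
  using DERIV_chain2[OF has_real_derivative_powr[OF assms(2), of r] assms(1)] by simp

lemma dom_powr_mono:
  assumes "r \<le> a" "\<And>q. q \<in> S \<Longrightarrow> 0 < d q \<and> d q \<le> b" "dom S f (\<lambda>q. d q powr a)"
  shows "dom S f (\<lambda>q. d q powr r)"
proof (rule dom_trans[OF assms(3)], rule domI)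
  fix q assume q: "q \<in> S"
  have "d q powr a = d q powr (a - r) * d q powr r" by (simp flip: powr_add)
  also have "\<dots> \<le> b powr (a - r) * d q powr r"
    using assms(1) assms(2)[OF q] by (intro mult_right_mono powr_mono2) auto
  finally show "\<bar>d q powr a\<bar> \<le> b powr (a - r) * \<bar>d q powr r\<bar>" by simp
qed

lemma dom_powr_mult:
  assumes "dom S f (\<lambda>q. d q powr a)" "dom S g (\<lambda>q. d q powr b)"
  shows "dom S (\<lambda>q. f q * g q) (\<lambda>q. d q powr (a + b))"
  using dom_mult[OF assms] by (simp add: powr_add)

text \<open>The pointwise content of \<open>good_pair\<close> at distance \<open>d\<close> from the
  nearer zero, detached from any solution, so that the bounds that follow are pure algebra on
  jets.\<close>

definition jetset :: "nat \<Rightarrow> real \<Rightarrow> real \<Rightarrow> real \<Rightarrow> ((nat \<Rightarrow> real) \<times> (nat \<Rightarrow> real) \<times> real) set" where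
  "jetset s M c K = {(u, v, d). 0 < d \<and> d \<le> 4 \<and> (\<forall>k\<le>3. \<bar>u k\<bar> \<le> M \<and> \<bar>v k\<bar> \<le> M) \<and>
     (\<forall>k\<le>2. \<bar>u k\<bar> \<le> K * d ^ (3 - k) \<and> \<bar>v k\<bar> \<le> K * d ^ (3 - k) \<and> \<bar>u k - v k\<bar> \<le> K * d ^ (s - k)) \<and>
     c * d ^ 3 \<le> u 0}"

definition lin1' :: "real \<Rightarrow> real \<Rightarrow> nat \<Rightarrow> (nat \<Rightarrow> real) \<Rightarrow> (nat \<Rightarrow> real) \<Rightarrow> real" where
  "lin1' \<alpha> \<mu> m u v = \<alpha> * v 3 + \<mu> * (real (m - 1) * (u 1 * u 0 ^ (m - 2)))"

text \<open>With a = u powr \<kappa>, the first four terms differentiate to 2 a w w_xxx + 3 a_x w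
  w_xx - a_xxx w^2 / 2, while the equation produces 2 a w w_xxx and 2 \<alpha> u powr (\<kappa> - 1)
  u_x w w_xx. These match exactly for 3 \<kappa> = 2 \<alpha>; the last term of the flux absorbs the
  first-order part.\<close>

definition eflux :: "real \<Rightarrow> real \<Rightarrow> nat \<Rightarrow> (nat \<Rightarrow> real) \<Rightarrow> (nat \<Rightarrow> real) \<Rightarrow> real" where
  "eflux \<alpha> \<mu> m u v = (let \<kappa> = 2 * \<alpha> / 3; w = \<lambda>k. u k - v k in
     2 * (u 0 powr \<kappa> * (w 0 * w 2)) - u 0 powr \<kappa> * (w 1 * w 1)
     + (\<kappa> * u 0 powr (\<kappa> - 1) * u 1) * (w 0 * w 1)
     - (\<kappa> * ((\<kappa> - 1) * u 0 powr (\<kappa> - 1 - 1) * u 1) * u 1 + \<kappa> * u 0 powr (\<kappa> - 1) * u 2) * (w 0 * w 0) / 2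
     + (u 0 powr (\<kappa> - 1) * lin1 \<alpha> \<mu> m u v) * (w 0 * w 0))"

text \<open>All derivatives of \<open>u - v\<close> drop out of the energy identity because of the exponent \<open>2 * \<alpha> / 3 - 1\<close>.\<close>

definition eres :: "real \<Rightarrow> real \<Rightarrow> nat \<Rightarrow> (nat \<Rightarrow> real) \<Rightarrow> (nat \<Rightarrow> real) \<Rightarrow> real" where
  "eres \<alpha> \<mu> m u v = (let \<kappa> = 2 * \<alpha> / 3 in
     - (\<kappa> * (\<kappa> - 1) * (\<kappa> - 2) * (u 0 powr (\<kappa> - 3) * u 1 * u 1 * u 1)
        + 3 * \<kappa> * (\<kappa> - 1) * (u 0 powr (\<kappa> - 2) * u 1 * u 2) + \<kappa> * (u 0 powr (\<kappa> - 1) * u 3)) / 2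
     + (\<kappa> - 1) * (u 0 powr (\<kappa> - 2) * u 1 * lin1 \<alpha> \<mu> m u v) + u 0 powr (\<kappa> - 1) * lin1' \<alpha> \<mu> m u v
     - 2 * (u 0 powr (\<kappa> - 1) * lin0 \<alpha> \<mu> m u v) - (\<kappa> - 1) * (u 0 powr (\<kappa> - 2) * Nl \<alpha> \<mu> m u))"

text \<open>The time derivative of the energy density, with the time derivatives of both solutions
  replaced by means of the equation.\<close>

definition edot :: "real \<Rightarrow> real \<Rightarrow> nat \<Rightarrow> (nat \<Rightarrow> real) \<Rightarrow> (nat \<Rightarrow> real) \<Rightarrow> real" where
  "edot \<alpha> \<mu> m u v = (let \<kappa> = 2 * \<alpha> / 3 in
     - (\<kappa> - 1) * u 0 powr (\<kappa> - 2) * Nl \<alpha> \<mu> m u * (u 0 - v 0) ^ 2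
     - 2 * u 0 powr (\<kappa> - 1) * (u 0 - v 0) * (Nl \<alpha> \<mu> m u - Nl \<alpha> \<mu> m v))"

text \<open>\<open>u 0\<close> is comparable with \<open>d ^ 3\<close> from both sides, which allows
  real powers of either sign, such as the negative exponents produced by differentiating the weight.
  From here on every quantity is measured by its exponent of \<open>d\<close>.\<close>

lemma jetset_bounds:
  fixes M K :: real
  assumes m: "m \<ge> 2" and s: "s \<ge> 6" and c: "c > 0"
  defines "S \<equiv> jetset s M c K"
  shows "k \<le> 2 \<Longrightarrow> dom S (\<lambda>q. fst q k) (\<lambda>q. snd (snd q) powr (3 - real k))"
    and "k \<le> 2 \<Longrightarrow> dom S (\<lambda>q. fst (snd q) k) (\<lambda>q. snd (snd q) powr (3 - real k))"
    and "k \<le> 2 \<Longrightarrow> dom S (\<lambda>q. fst q k - fst (snd q) k) (\<lambda>q. snd (snd q) powr (real s - real k))"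
    and "k \<le> 3 \<Longrightarrow> dom S (\<lambda>q. fst q k) (\<lambda>_. 1)"
    and "k \<le> 3 \<Longrightarrow> dom S (\<lambda>q. fst (snd q) k) (\<lambda>_. 1)"
    and "dom S (\<lambda>q. fst q 0 powr r) (\<lambda>q. snd (snd q) powr (3 * r))"
    and "dom S (\<lambda>q. snd (snd q) powr (3 * r)) (\<lambda>q. fst q 0 powr r)"
    and "dom S (\<lambda>q. lin1 \<alpha> \<mu> m (fst q) (fst (snd q))) (\<lambda>q. snd (snd q) powr 1)"
    and "dom S (\<lambda>q. lin1' \<alpha> \<mu> m (fst q) (fst (snd q))) (\<lambda>_. 1)"
    and "dom S (\<lambda>q. lin0 \<alpha> \<mu> m (fst q) (fst (snd q))) (\<lambda>_. 1)"
    and "dom S (\<lambda>q. Nl \<alpha> \<mu> m (fst q)) (\<lambda>q. snd (snd q) powr 3)"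
proof -
  have d: "0 < snd (snd q) \<and> snd (snd q) \<le> 4" if "q \<in> S" for q
    using that by (auto simp: S_def jetset_def)
  have pw: "snd (snd q) ^ n = snd (snd q) powr real n" if "q \<in> S" for q n
    using d[OF that] by (simp add: powr_realpow)
  show u: "dom S (\<lambda>q. fst q k) (\<lambda>q. snd (snd q) powr (3 - real k))" if "k \<le> 2" for k
  proof (rule domI[where C = K])
    fix q assume q: "q \<in> S"
    then have "\<bar>fst q k\<bar> \<le> K * snd (snd q) ^ (3 - k)" using that by (auto simp: S_def jetset_def)
    then show "\<bar>fst q k\<bar> \<le> K * \<bar>snd (snd q) powr (3 - real k)\<bar>"
      unfolding pw[OF q] using that by (simp add: of_nat_diff)
  qed
  show v: "dom S (\<lambda>q. fst (snd q) k) (\<lambda>q. snd (snd q) powr (3 - real k))" if "k \<le> 2" for k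
  proof (rule domI[where C = K])
    fix q assume q: "q \<in> S"
    then have "\<bar>fst (snd q) k\<bar> \<le> K * snd (snd q) ^ (3 - k)" using that by (auto simp: S_def jetset_def)
    then show "\<bar>fst (snd q) k\<bar> \<le> K * \<bar>snd (snd q) powr (3 - real k)\<bar>"
      unfolding pw[OF q] using that by (simp add: of_nat_diff)
  qed
  show "dom S (\<lambda>q. fst q k - fst (snd q) k) (\<lambda>q. snd (snd q) powr (real s - real k))" if "k \<le> 2" for k
  proof (rule domI[where C = K])
    fix q assume q: "q \<in> S"
    then have "\<bar>fst q k - fst (snd q) k\<bar> \<le> K * snd (snd q) ^ (s - k)" using that by (auto simp: S_def jetset_def)
    then show "\<bar>fst q k - fst (snd q) k\<bar> \<le> K * \<bar>snd (snd q) powr (real s - real k)\<bar>"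
      unfolding pw[OF q] using that s by (simp add: of_nat_diff)
  qed
  show bu: "dom S (\<lambda>q. fst q k) (\<lambda>_. 1)" if "k \<le> 3" for k
    by (rule domI[where C = M]) (use that in \<open>auto simp: S_def jetset_def\<close>)
  show bv: "dom S (\<lambda>q. fst (snd q) k) (\<lambda>_. 1)" if "k \<le> 3" for k
    by (rule domI[where C = M]) (use that in \<open>auto simp: S_def jetset_def\<close>)
  have two: "c * snd (snd q) powr 3 \<le> fst q 0" "fst q 0 \<le> K * snd (snd q) powr 3" "0 < K" if q: "q \<in> S" for q
  proof -
    have *: "c * snd (snd q) ^ 3 \<le> fst q 0" "\<bar>fst q 0\<bar> \<le> K * snd (snd q) ^ 3"
      using q by (auto simp: S_def jetset_def dest!: spec[of _ "0::nat"])
    then show "c * snd (snd q) powr 3 \<le> fst q 0" "fst q 0 \<le> K * snd (snd q) powr 3"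
      using pw[OF q, of 3] by auto
    have "0 < c * snd (snd q) ^ 3" using c d[OF q] by simp
    then have "0 < K * snd (snd q) ^ 3" using * by linarith
    then show "0 < K" using d[OF q] by (simp add: zero_less_mult_iff)
  qed
  have pos: "0 < fst q 0" if "q \<in> S" for q
    using two(1)[OF that] c d[OF that] by (smt (verit) powr_gt_zero zero_less_mult_iff)
  show "dom S (\<lambda>q. fst q 0 powr r) (\<lambda>q. snd (snd q) powr (3 * r))"
  proof (rule domI[where C = "c powr r + \<bar>K\<bar> powr r"])
    fix q assume q: "q \<in> S"
    have e: "(B * snd (snd q) powr 3) powr r = B powr r * snd (snd q) powr (3 * r)" if "0 < B" for B
      using that by (simp add: powr_mult powr_powr)
    have "fst q 0 powr r \<le> c powr r * snd (snd q) powr (3 * r) + \<bar>K\<bar> powr r * snd (snd q) powr (3 * r)"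
    proof (cases "r \<ge> 0")
      case True
      have "fst q 0 powr r \<le> (K * snd (snd q) powr 3) powr r"
        using True two[OF q] pos[OF q] by (intro powr_mono2) auto
      then show ?thesis using e[OF two(3)[OF q]] two(3)[OF q] by (simp add: add_increasing)
    next
      case False
      have "fst q 0 powr r \<le> (c * snd (snd q) powr 3) powr r"
        using False two[OF q] c d[OF q] by (intro powr_mono2') auto
      then show ?thesis using e[OF c] by (simp add: add_increasing2)
    qed
    then show "\<bar>fst q 0 powr r\<bar> \<le> (c powr r + \<bar>K\<bar> powr r) * \<bar>snd (snd q) powr (3 * r)\<bar>"
      by (simp add: distrib_right)
  qed
  show "dom S (\<lambda>q. snd (snd q) powr (3 * r)) (\<lambda>q. fst q 0 powr r)"
  proof (rule domI[where C = "c powr (- r) + \<bar>K\<bar> powr (- r)"])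
    fix q assume q: "q \<in> S"
    have e: "snd (snd q) powr (3 * r) = B powr (- r) * (B * snd (snd q) powr 3) powr r" if "0 < B" for B
      using that by (simp add: powr_mult powr_powr powr_minus field_simps)
    have "snd (snd q) powr (3 * r) \<le> c powr (- r) * fst q 0 powr r + \<bar>K\<bar> powr (- r) * fst q 0 powr r"
    proof (cases "r \<ge> 0")
      case True
      have "(c * snd (snd q) powr 3) powr r \<le> fst q 0 powr r"
        using True two[OF q] c d[OF q] by (intro powr_mono2) auto
      then have "c powr (- r) * (c * snd (snd q) powr 3) powr r \<le> c powr (- r) * fst q 0 powr r"
        by (intro mult_left_mono) auto
      then show ?thesis unfolding e[OF c, symmetric] by (simp add: add_increasing2)
    next
      case False
      have "(K * snd (snd q) powr 3) powr r \<le> fst q 0 powr r"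
        using False two[OF q] pos[OF q] by (intro powr_mono2') auto
      then have "K powr (- r) * (K * snd (snd q) powr 3) powr r \<le> K powr (- r) * fst q 0 powr r"
        by (intro mult_left_mono) auto
      then show ?thesis unfolding e[OF two(3)[OF q], symmetric] using two(3)[OF q] by (simp add: add_increasing)
    qed
    then show "\<bar>snd (snd q) powr (3 * r)\<bar> \<le> (c powr (- r) + \<bar>K\<bar> powr (- r)) * \<bar>fst q 0 powr r\<bar>"
      by (simp add: distrib_right)
  qed
  have m1: "m - Suc 0 = Suc (m - 2)" using m by simp
  have v2: "dom S (\<lambda>q. fst (snd q) 2) (\<lambda>q. snd (snd q) powr 1)" using v[of 2] by simp
  have u0: "dom S (\<lambda>q. fst q 0) (\<lambda>q. snd (snd q) powr 3)" using u[of 0] by simp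
  have u0': "dom S (\<lambda>q. fst q 0) (\<lambda>q. snd (snd q) powr 1)"
    by (rule dom_powr_mono[OF _ d u0]) auto
  have "dom S (\<lambda>q. \<alpha> * fst (snd q) 2 + \<mu> * (fst q 0 ^ (m - 2) * fst q 0)) (\<lambda>q. snd (snd q) powr 1)"
    by (intro dom_add dom_cmult v2 dom_mult_bdd[OF _ u0'] dom_power bu) auto
  then show "dom S (\<lambda>q. lin1 \<alpha> \<mu> m (fst q) (fst (snd q))) (\<lambda>q. snd (snd q) powr 1)"
    by (rule dom_cong) (simp add: lin1_def m1 mult_ac)
  show "dom S (\<lambda>q. lin1' \<alpha> \<mu> m (fst q) (fst (snd q))) (\<lambda>_. 1)"
    unfolding lin1'_def by (intro dom_add dom_cmult dom_mult_bdd dom_power bu bv) auto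
  show "dom S (\<lambda>q. lin0 \<alpha> \<mu> m (fst q) (fst (snd q))) (\<lambda>_. 1)"
    unfolding lin0_def by (intro dom_add dom_mult_bdd dom_const dom_Hf bu bv) auto
  have "dom S (\<lambda>q. fst q 1 * fst q 2) (\<lambda>q. snd (snd q) powr ((3 - real 1) + (3 - real 2)))"
    by (intro dom_powr_mult u) auto
  then have u12: "dom S (\<lambda>q. fst q 1 * fst q 2) (\<lambda>q. snd (snd q) powr 3)" by simp
  have "dom S (\<lambda>q. fst q 3 * fst q 0 + \<alpha> * (fst q 1 * fst q 2) + \<mu> * ((fst q 0 ^ (m - 2) * fst q 1) * fst q 0)) (\<lambda>q. snd (snd q) powr 3)"
    by (intro dom_add dom_cmult u12 dom_mult_bdd[OF _ u0] dom_mult_bdd dom_power bu) auto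
  then show "dom S (\<lambda>q. Nl \<alpha> \<mu> m (fst q)) (\<lambda>q. snd (snd q) powr 3)"
    by (rule dom_cong) (simp add: Nl_def m1)
qed

text \<open>Counting exponents of \<open>d\<close> with \<kappa> = 2 \<alpha> / 3: each summand of
  \<open>eres\<close> has order 3 (\<kappa> - 1) or better, the order of the weight itself, so the
  residual is dominated by the weight without a singular factor. The flux has order 3 \<kappa> + 2 s
  - 2 = 2 (s + \<alpha> - 1), positive exactly above the threshold.\<close>

lemma energy_bounds:
  assumes m: "m \<ge> 2" and s: "s \<ge> 6" and c: "c > 0"
  obtains C where "C > 0" "\<And>u v d. (u, v, d) \<in> jetset s M c K \<Longrightarrow>
      \<bar>eres \<alpha> \<mu> m u v\<bar> \<le> C * u 0 powr (2 * \<alpha> / 3 - 1) \<and> \<bar>eflux \<alpha> \<mu> m u v\<bar> \<le> C * d powr (2 * (real s + \<alpha> - 1))"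
proof -
  define S where "S = jetset s M c K"
  define \<kappa> where "\<kappa> = 2 * \<alpha> / 3"
  note b = jetset_bounds[OF m s c, where M = M and K = K, folded S_def]
  have d: "0 < snd (snd q) \<and> snd (snd q) \<le> 4" if "q \<in> S" for q
    using that by (auto simp: S_def jetset_def)
  let ?u = "\<lambda>k (q :: (nat \<Rightarrow> real) \<times> (nat \<Rightarrow> real) \<times> real). fst q k"
  let ?w = "\<lambda>k (q :: (nat \<Rightarrow> real) \<times> (nat \<Rightarrow> real) \<times> real). fst q k - fst (snd q) k"
  let ?p = "\<lambda>r (q :: (nat \<Rightarrow> real) \<times> (nat \<Rightarrow> real) \<times> real). fst q 0 powr r"
  let ?D = "\<lambda>(q :: (nat \<Rightarrow> real) \<times> (nat \<Rightarrow> real) \<times> real). snd (snd q)"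
  have u1: "dom S (?u 1) (\<lambda>q. ?D q powr 2)" and u2: "dom S (?u 2) (\<lambda>q. ?D q powr 1)"
    using b(1)[of 1] b(1)[of 2] by auto
  have w0: "dom S (?w 0) (\<lambda>q. ?D q powr real s)" and w1: "dom S (?w 1) (\<lambda>q. ?D q powr (real s - 1))"
    and w2: "dom S (?w 2) (\<lambda>q. ?D q powr (real s - 2))"
    using b(3)[of 0] b(3)[of 1] b(3)[of 2] by auto
  have t1: "dom S (\<lambda>q. ?p (\<kappa> - 3) q * ?u 1 q * ?u 1 q * ?u 1 q) (\<lambda>q. ?D q powr (3 * (\<kappa> - 1)))"
    by (rule dom_powr_mono[OF _ d, rotated], assumption, (rule dom_powr_mult u1 b(6))+) simp
  have t2: "dom S (\<lambda>q. ?p (\<kappa> - 2) q * ?u 1 q * ?u 2 q) (\<lambda>q. ?D q powr (3 * (\<kappa> - 1)))"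
    by (rule dom_powr_mono[OF _ d, rotated], assumption, (rule dom_powr_mult u1 u2 b(6))+) simp
  have t3: "dom S (\<lambda>q. ?p (\<kappa> - 1) q * f q) (\<lambda>q. ?D q powr (3 * (\<kappa> - 1)))" if "dom S f (\<lambda>_. 1)" for f
    by (rule dom_mult_bdd'[OF b(6) that])
  have t4: "dom S (\<lambda>q. ?p (\<kappa> - 2) q * ?u 1 q * lin1 \<alpha> \<mu> m (fst q) (fst (snd q))) (\<lambda>q. ?D q powr (3 * (\<kappa> - 1)))"
    by (rule dom_powr_mono[OF _ d, rotated], assumption, (rule dom_powr_mult u1 b(6) b(8))+) simp
  have t5: "dom S (\<lambda>q. ?p (\<kappa> - 2) q * Nl \<alpha> \<mu> m (fst q)) (\<lambda>q. ?D q powr (3 * (\<kappa> - 1)))"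
    by (rule dom_powr_mono[OF _ d, rotated], assumption, (rule dom_powr_mult b(6) b(11))+) simp
  have "dom S (\<lambda>q. eres \<alpha> \<mu> m (fst q) (fst (snd q))) (\<lambda>q. ?D q powr (3 * (\<kappa> - 1)))"
    unfolding eres_def Let_def \<kappa>_def[symmetric]
    by (intro dom_add dom_diff dom_uminus dom_cdiv dom_cmult t1 t2 t3 t4 t5 b(4) b(9) b(10)) auto
  then have R: "dom S (\<lambda>q. eres \<alpha> \<mu> m (fst q) (fst (snd q))) (?p (\<kappa> - 1))"
    using b(7) by (rule dom_trans)
  let ?\<sigma> = "2 * (real s + \<alpha> - 1)"
  have f1: "dom S (\<lambda>q. ?p \<kappa> q * (?w 0 q * ?w 2 q)) (\<lambda>q. ?D q powr ?\<sigma>)"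
    by (rule dom_powr_mono[OF _ d, rotated], assumption, (rule dom_powr_mult w0 w2 b(6))+) (simp add: \<kappa>_def)
  have f2: "dom S (\<lambda>q. ?p \<kappa> q * (?w 1 q * ?w 1 q)) (\<lambda>q. ?D q powr ?\<sigma>)"
    by (rule dom_powr_mono[OF _ d, rotated], assumption, (rule dom_powr_mult w1 b(6))+) (simp add: \<kappa>_def)
  have f3: "dom S (\<lambda>q. (\<kappa> * ?p (\<kappa> - 1) q * ?u 1 q) * (?w 0 q * ?w 1 q)) (\<lambda>q. ?D q powr ?\<sigma>)"
    by (rule dom_powr_mono[OF _ d, rotated], assumption, (rule dom_powr_mult u1 w0 w1 dom_cmult b(6))+) (simp add: \<kappa>_def)
  have f4: "dom S (\<lambda>q. \<kappa> * ((\<kappa> - 1) * ?p (\<kappa> - 1 - 1) q * ?u 1 q) * ?u 1 q) (\<lambda>q. ?D q powr (3 * \<kappa> - 2))"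
    by (rule dom_powr_mono[OF _ d, rotated], assumption, (rule dom_powr_mult u1 dom_cmult b(6))+) simp
  have f5: "dom S (\<lambda>q. \<kappa> * ?p (\<kappa> - 1) q * ?u 2 q) (\<lambda>q. ?D q powr (3 * \<kappa> - 2))"
    by (rule dom_powr_mono[OF _ d, rotated], assumption, (rule dom_powr_mult u2 dom_cmult b(6))+) simp
  have f6: "dom S (\<lambda>q. (\<kappa> * ((\<kappa> - 1) * ?p (\<kappa> - 1 - 1) q * ?u 1 q) * ?u 1 q + \<kappa> * ?p (\<kappa> - 1) q * ?u 2 q) * (?w 0 q * ?w 0 q)) (\<lambda>q. ?D q powr ?\<sigma>)"
    by (rule dom_powr_mono[OF _ d, rotated], assumption, (rule dom_powr_mult w0 dom_add[OF f4 f5])+) (simp add: \<kappa>_def)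
  have f7: "dom S (\<lambda>q. (?p (\<kappa> - 1) q * lin1 \<alpha> \<mu> m (fst q) (fst (snd q))) * (?w 0 q * ?w 0 q)) (\<lambda>q. ?D q powr ?\<sigma>)"
    by (rule dom_powr_mono[OF _ d, rotated], assumption, (rule dom_powr_mult w0 b(6) b(8))+) (simp add: \<kappa>_def)
  have F: "dom S (\<lambda>q. eflux \<alpha> \<mu> m (fst q) (fst (snd q))) (\<lambda>q. ?D q powr ?\<sigma>)"
    unfolding eflux_def Let_def \<kappa>_def[symmetric]
    by (intro dom_add dom_diff dom_cdiv dom_cmult f1 f2 f3 f6 f7)
  obtain C1 where C1: "C1 > 0" "\<And>q. q \<in> S \<Longrightarrow> \<bar>eres \<alpha> \<mu> m (fst q) (fst (snd q))\<bar> \<le> C1 * \<bar>?p (\<kappa> - 1) q\<bar>"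
    using R by (rule domE) blast
  obtain C2 where C2: "C2 > 0" "\<And>q. q \<in> S \<Longrightarrow> \<bar>eflux \<alpha> \<mu> m (fst q) (fst (snd q))\<bar> \<le> C2 * \<bar>?D q powr ?\<sigma>\<bar>"
    using F by (rule domE) blast
  show thesis
  proof (rule that[of "C1 + C2"])
    fix u v d assume q: "(u, v, d) \<in> jetset s M c K"
    have "0 \<le> C2 * u 0 powr (\<kappa> - 1)" "0 \<le> C1 * d powr ?\<sigma>" using C1(1) C2(1) by auto
    then show "\<bar>eres \<alpha> \<mu> m u v\<bar> \<le> (C1 + C2) * u 0 powr (2 * \<alpha> / 3 - 1) \<and> \<bar>eflux \<alpha> \<mu> m u v\<bar> \<le> (C1 + C2) * d powr ?\<sigma>"
      using C1(2)[of "(u, v, d)"] C2(2)[of "(u, v, d)"] q by (simp add: S_def \<kappa>_def distrib_right)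
  qed (use C1 C2 in auto)
qed

lemma lin1_derivative:
  fixes u v :: "nat \<Rightarrow> real \<Rightarrow> real"
  assumes "(u 0 has_real_derivative u 1 x) (at x)" "(v 2 has_real_derivative v 3 x) (at x)"
  shows "((\<lambda>x. lin1 \<alpha> \<mu> m (\<lambda>k. u k x) (\<lambda>k. v k x)) has_real_derivative lin1' \<alpha> \<mu> m (\<lambda>k. u k x) (\<lambda>k. v k x)) (at x)"
proof -
  have "((\<lambda>x. \<alpha> * v 2 x + \<mu> * u 0 x ^ (m - 1)) has_real_derivative
      \<alpha> * v 3 x + \<mu> * (real (m - 1) * (u 1 x * u 0 x ^ (m - 1 - Suc 0)))) (at x)"
    by (intro DERIV_add DERIV_cmult DERIV_power assms)
  moreover have "m - 1 - Suc 0 = m - 2" by simp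
  ultimately show ?thesis unfolding lin1_def lin1'_def by (simp only:)
qed

lemma eflux_derivative:
  fixes u v :: "nat \<Rightarrow> real \<Rightarrow> real"
  assumes du: "\<And>k. k \<le> 2 \<Longrightarrow> (u k has_real_derivative u (Suc k) x) (at x)"
    and dv: "\<And>k. k \<le> 2 \<Longrightarrow> (v k has_real_derivative v (Suc k) x) (at x)"
    and pos: "u 0 x > 0" and m: "m \<ge> 2"
  shows "((\<lambda>x. eflux \<alpha> \<mu> m (\<lambda>k. u k x) (\<lambda>k. v k x)) has_real_derivative
     eres \<alpha> \<mu> m (\<lambda>k. u k x) (\<lambda>k. v k x) * (u 0 x - v 0 x) ^ 2 - edot \<alpha> \<mu> m (\<lambda>k. u k x) (\<lambda>k. v k x)) (at x)"
proof -
  define \<kappa> where "\<kappa> = 2 * \<alpha> / 3"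
  define w where "w k x = u k x - v k x" for k x
  have d: "(u 0 has_real_derivative u 1 x) (at x)" "(u 1 has_real_derivative u 2 x) (at x)" "(u 2 has_real_derivative u 3 x) (at x)"
    using du[of 0] du[of 1] du[of 2] by (simp_all add: eval_nat_numeral)
  have dvv: "(v 0 has_real_derivative v 1 x) (at x)" "(v 1 has_real_derivative v 2 x) (at x)" "(v 2 has_real_derivative v 3 x) (at x)"
    using dv[of 0] dv[of 1] dv[of 2] by (simp_all add: eval_nat_numeral)
  have dw: "(w 0 has_real_derivative w 1 x) (at x)" "(w 1 has_real_derivative w 2 x) (at x)" "(w 2 has_real_derivative w 3 x) (at x)"
    unfolding w_def by (intro DERIV_diff d dvv)+
  have P: "((\<lambda>x. u 0 x powr r) has_real_derivative r * u 0 x powr (r - 1) * u 1 x) (at x)" for r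
    by (rule DERIV_powr_pos[OF d(1) pos])
  define a where "a x = u 0 x powr \<kappa>" for x
  define a1 where "a1 x = \<kappa> * u 0 x powr (\<kappa> - 1) * u 1 x" for x
  define a2 where "a2 x = \<kappa> * ((\<kappa> - 1) * u 0 x powr (\<kappa> - 1 - 1) * u 1 x) * u 1 x + \<kappa> * u 0 x powr (\<kappa> - 1) * u 2 x" for x
  define g where "g x = u 0 x powr (\<kappa> - 1) * lin1 \<alpha> \<mu> m (\<lambda>k. u k x) (\<lambda>k. v k x)" for x
  \<comment> \<open>All powers of \<open>u 0 x\<close> that occur become \<open>B\<close> times a
    nonnegative integer power of \<open>u 0 x\<close>, so the final comparison is a polynomial
    identity.\<close>
  define B where "B = u 0 x powr (\<kappa> - 3)"
  have pw: "u 0 x powr (\<kappa> - 2) = B * u 0 x" "u 0 x powr (\<kappa> - 1) = B * u 0 x * u 0 x"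
    "u 0 x powr \<kappa> = B * u 0 x * u 0 x * u 0 x" "u 0 x powr (\<kappa> - 1 - 1) = B * u 0 x"
    "u 0 x powr (\<kappa> - 1 - 1 - 1) = B"
  proof -
    have s: "u 0 x powr (r + 1) = u 0 x powr r * u 0 x" for r using pos by (simp add: powr_add)
    show 2: "u 0 x powr (\<kappa> - 2) = B * u 0 x" using s[of "\<kappa> - 3"] by (simp add: B_def)
    show 1: "u 0 x powr (\<kappa> - 1) = B * u 0 x * u 0 x" using s[of "\<kappa> - 2"] by (simp add: 2)
    show "u 0 x powr \<kappa> = B * u 0 x * u 0 x * u 0 x" using s[of "\<kappa> - 1"] by (simp add: 1)
    show "u 0 x powr (\<kappa> - 1 - 1) = B * u 0 x" using 2 by (simp add: algebra_simps)
    show "u 0 x powr (\<kappa> - 1 - 1 - 1) = B" by (simp add: B_def algebra_simps)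
  qed
  have da: "(a has_real_derivative a1 x) (at x)" unfolding a_def a1_def by (rule P)
  have da1: "(a1 has_real_derivative a2 x) (at x)"
    unfolding a1_def a2_def
    using DERIV_mult[OF DERIV_cmult[OF P[of "\<kappa> - 1"], of \<kappa>] d(2)] by (simp add: mult_ac)
  define a3 where "a3 = \<kappa> * (\<kappa> - 1) * (\<kappa> - 2) * (B * u 1 x * u 1 x * u 1 x)
        + 3 * \<kappa> * (\<kappa> - 1) * (B * u 0 x * u 1 x * u 2 x) + \<kappa> * (B * u 0 x * u 0 x * u 3 x)"
  have "(a2 has_real_derivative (\<kappa> * ((\<kappa> - 1) * ((\<kappa> - 1 - 1) * u 0 x powr (\<kappa> - 1 - 1 - 1) * u 1 x) * u 1 x + u 2 x * ((\<kappa> - 1) * u 0 x powr (\<kappa> - 1 - 1)))) * u 1 x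
      + u 2 x * (\<kappa> * ((\<kappa> - 1) * u 0 x powr (\<kappa> - 1 - 1) * u 1 x))
      + (\<kappa> * ((\<kappa> - 1) * u 0 x powr (\<kappa> - 1 - 1) * u 1 x) * u 2 x + u 3 x * (\<kappa> * u 0 x powr (\<kappa> - 1)))) (at x)"
    unfolding a2_def by (intro DERIV_add DERIV_mult DERIV_cmult P d)
  then have da2: "(a2 has_real_derivative a3) (at x)"
    by (rule DERIV_cong) (simp only: pw a3_def, simp add: algebra_simps)
  have dl: "((\<lambda>x. lin1 \<alpha> \<mu> m (\<lambda>k. u k x) (\<lambda>k. v k x)) has_real_derivative lin1' \<alpha> \<mu> m (\<lambda>k. u k x) (\<lambda>k. v k x)) (at x)"
    by (rule lin1_derivative[OF d(1) dvv(3)])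
  define g' where "g' = (\<kappa> - 1) * (B * u 0 x * u 1 x * lin1 \<alpha> \<mu> m (\<lambda>k. u k x) (\<lambda>k. v k x))
      + B * u 0 x * u 0 x * lin1' \<alpha> \<mu> m (\<lambda>k. u k x) (\<lambda>k. v k x)"
  have dg: "(g has_real_derivative g') (at x)"
    unfolding g_def using DERIV_mult[OF P[of "\<kappa> - 1"] dl] by (rule DERIV_cong) (simp only: pw g'_def, simp add: algebra_simps)
  have "((\<lambda>x. 2 * (a x * (w 0 x * w 2 x)) - a x * (w 1 x * w 1 x) + a1 x * (w 0 x * w 1 x)
      - a2 x * (w 0 x * w 0 x) / 2 + g x * (w 0 x * w 0 x)) has_real_derivative
      2 * (a1 x * (w 0 x * w 2 x) + (w 1 x * w 2 x + w 3 x * w 0 x) * a x)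
      - (a1 x * (w 1 x * w 1 x) + (w 2 x * w 1 x + w 2 x * w 1 x) * a x)
      + (a2 x * (w 0 x * w 1 x) + (w 1 x * w 1 x + w 2 x * w 0 x) * a1 x)
      - (a3 * (w 0 x * w 0 x) + (w 1 x * w 0 x + w 1 x * w 0 x) * a2 x) / 2
      + (g' * (w 0 x * w 0 x) + (w 1 x * w 0 x + w 1 x * w 0 x) * g x)) (at x)"
    by (intro DERIV_add DERIV_diff DERIV_mult DERIV_cmult DERIV_cdivide da da1 da2 dg dw)
  moreover have "(\<lambda>x. eflux \<alpha> \<mu> m (\<lambda>k. u k x) (\<lambda>k. v k x)) =
      (\<lambda>x. 2 * (a x * (w 0 x * w 2 x)) - a x * (w 1 x * w 1 x) + a1 x * (w 0 x * w 1 x)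
      - a2 x * (w 0 x * w 0 x) / 2 + g x * (w 0 x * w 0 x))"
    unfolding eflux_def Let_def \<kappa>_def[symmetric] a_def a1_def a2_def g_def w_def by simp
  moreover have "2 * (a1 x * (w 0 x * w 2 x) + (w 1 x * w 2 x + w 3 x * w 0 x) * a x)
      - (a1 x * (w 1 x * w 1 x) + (w 2 x * w 1 x + w 2 x * w 1 x) * a x)
      + (a2 x * (w 0 x * w 1 x) + (w 1 x * w 1 x + w 2 x * w 0 x) * a1 x)
      - (a3 * (w 0 x * w 0 x) + (w 1 x * w 0 x + w 1 x * w 0 x) * a2 x) / 2
      + (g' * (w 0 x * w 0 x) + (w 1 x * w 0 x + w 1 x * w 0 x) * g x)
    = eres \<alpha> \<mu> m (\<lambda>k. u k x) (\<lambda>k. v k x) * (u 0 x - v 0 x) ^ 2 - edot \<alpha> \<mu> m (\<lambda>k. u k x) (\<lambda>k. v k x)"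
    (is "?L = ?R")
  proof -
    define l1 l1' l0 n where "l1 = lin1 \<alpha> \<mu> m (\<lambda>k. u k x) (\<lambda>k. v k x)" and "l1' = lin1' \<alpha> \<mu> m (\<lambda>k. u k x) (\<lambda>k. v k x)"
      and "l0 = lin0 \<alpha> \<mu> m (\<lambda>k. u k x) (\<lambda>k. v k x)" and "n = Nl \<alpha> \<mu> m (\<lambda>k. u k x)"
    \<comment> \<open>This substitution is what makes the terms with \<open>w 0 x * w 2 x\<close>
      cancel.\<close>
    have \<alpha>: "\<alpha> = 3 * \<kappa> / 2" by (simp add: \<kappa>_def)
    have L: "?L = 2 * a x * w 0 x * w 3 x + 3 * a1 x * w 0 x * w 2 x - a3 * w 0 x * w 0 x / 2
        + g' * w 0 x * w 0 x + 2 * g x * w 0 x * w 1 x"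
      by (simp add: field_simps)
    have e: "eres \<alpha> \<mu> m (\<lambda>k. u k x) (\<lambda>k. v k x) = - a3 / 2 + g' - 2 * (B * u 0 x * u 0 x * l0) - (\<kappa> - 1) * (B * u 0 x * n)"
      unfolding eres_def Let_def \<kappa>_def[symmetric] pw a3_def g'_def l0_def n_def B_def[symmetric] by simp
    have dd: "edot \<alpha> \<mu> m (\<lambda>k. u k x) (\<lambda>k. v k x) = - (\<kappa> - 1) * (B * u 0 x) * n * w 0 x * w 0 x
      - 2 * (B * u 0 x * u 0 x) * w 0 x * (u 0 x * w 3 x + \<alpha> * u 1 x * w 2 x + l1 * w 1 x + l0 * w 0 x)"
      unfolding edot_def Let_def \<kappa>_def[symmetric] pw Nl_diff n_def l1_def l0_def w_def by (simp add: power2_eq_square)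
    have g: "g x = B * u 0 x * u 0 x * l1" "a1 x = \<kappa> * (B * u 0 x * u 0 x) * u 1 x" "a x = B * u 0 x * u 0 x * u 0 x"
      by (simp_all add: g_def a1_def a_def pw l1_def)
    have ww: "(u 0 x - v 0 x) ^ 2 = w 0 x * w 0 x" by (simp add: w_def power2_eq_square)
    have "2 * a x * w 0 x * w 3 x + 3 * a1 x * w 0 x * w 2 x - a3 * w 0 x * w 0 x / 2
        + g' * w 0 x * w 0 x + 2 * g x * w 0 x * w 1 x = ?R"
      unfolding e dd g ww unfolding \<alpha> by (simp add: algebra_simps)
    then show ?thesis unfolding L .
  qed
  ultimately show ?thesis by simp
qed

section \<open>Evolution of the weighted energy in time\<close>

lemma classical_time_derivative:
  assumes c: "classical \<alpha> \<mu> m s M \<delta> U" and s: "s \<ge> 6" and t: "t \<in> {0..\<delta>}"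
  shows "((\<lambda>t. U 0 t x) has_real_derivative - Nl \<alpha> \<mu> m (\<lambda>k. U k t x)) (at t within {0..\<delta>})"
proof -
  have "((\<lambda>t. U 0 0 x - integral {0..t} (\<lambda>\<tau>. Nl \<alpha> \<mu> m (\<lambda>k. U k \<tau> x))) has_real_derivative 0 - Nl \<alpha> \<mu> m (\<lambda>k. U k t x)) (at t within {0..\<delta>})"
    by (intro DERIV_diff DERIV_const integral_has_real_derivative[OF classical_cont_t(1)[OF c s order_refl] t])
  then have "((\<lambda>t. U 0 0 x - integral {0..t} (\<lambda>\<tau>. Nl \<alpha> \<mu> m (\<lambda>k. U k \<tau> x))) has_real_derivative - Nl \<alpha> \<mu> m (\<lambda>k. U k t x)) (at t within {0..\<delta>})"
    by simp
  then show ?thesis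
  proof (rule has_field_derivative_transform_within[where d = 1])
    show "U 0 0 x - integral {0..t'} (\<lambda>\<tau>. Nl \<alpha> \<mu> m (\<lambda>k. U k \<tau> x)) = U 0 t' x" if "t' \<in> {0..\<delta>}" for t'
      using classicalD(5)[OF c, of t' x] that by auto
  qed (use t in auto)
qed

lemma edot_time_derivative:
  assumes cU: "classical \<alpha> \<mu> m s M \<delta> U" and cV: "classical \<alpha> \<mu> m s M \<delta> V" and s: "s \<ge> 6" and t: "t \<in> {0..\<delta>}"
    and pos: "U 0 t x > 0"
  shows "((\<lambda>t. U 0 t x powr (2 * \<alpha> / 3 - 1) * (U 0 t x - V 0 t x) ^ 2) has_real_derivative
     edot \<alpha> \<mu> m (\<lambda>k. U k t x) (\<lambda>k. V k t x)) (at t within {0..\<delta>})"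
proof -
  define \<kappa> where "\<kappa> = 2 * \<alpha> / 3"
  note dU = classical_time_derivative[OF cU s t, of x] and dV = classical_time_derivative[OF cV s t, of x]
  have "((\<lambda>t. U 0 t x powr (\<kappa> - 1) * ((U 0 t x - V 0 t x) * (U 0 t x - V 0 t x))) has_real_derivative
      ((\<kappa> - 1) * U 0 t x powr (\<kappa> - 1 - 1) * (- Nl \<alpha> \<mu> m (\<lambda>k. U k t x))) * ((U 0 t x - V 0 t x) * (U 0 t x - V 0 t x))
      + ((- Nl \<alpha> \<mu> m (\<lambda>k. U k t x) - - Nl \<alpha> \<mu> m (\<lambda>k. V k t x)) * (U 0 t x - V 0 t x)
          + (- Nl \<alpha> \<mu> m (\<lambda>k. U k t x) - - Nl \<alpha> \<mu> m (\<lambda>k. V k t x)) * (U 0 t x - V 0 t x)) * U 0 t x powr (\<kappa> - 1)) (at t within {0..\<delta>})"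
    by (intro DERIV_mult DERIV_powr_pos DERIV_diff dU dV pos)
  moreover have "\<kappa> - 1 - 1 = \<kappa> - 2" by simp
  ultimately show ?thesis
    unfolding edot_def Let_def \<kappa>_def[symmetric] power2_eq_square by (elim DERIV_cong) (simp add: algebra_simps)
qed

lemma dpi_bounds:
  assumes "0 < x" "x < pi"
  shows "0 < dpi x" "dpi x \<le> 4" "dpi x \<le> x"
  using assms pi_less_4 by (auto simp: dpi_def min_def)

lemma good_pair_jetset:
  assumes s: "s \<ge> 6" and cU: "classical \<alpha> \<mu> m s M t0 U" and cV: "classical \<alpha> \<mu> m s M t0 V"
    and good: "good_pair s A c K t0 U V" and t: "t \<in> {0..t0}" and x: "0 < x" "x < pi"
  shows "((\<lambda>k. U k t x), (\<lambda>k. V k t x), dpi x) \<in> jetset s M c K"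
proof -
  have x': "x \<in> {0..pi}" using x by simp
  note g = good[unfolded good_pair_def, rule_format, OF t x']
  show ?thesis
    unfolding jetset_def using g dpi_bounds[OF x] classicalD(2)[OF cU] classicalD(2)[OF cV] t s by auto
qed

lemma good_pair_pos:
  assumes good: "good_pair s A c K t0 U V" and c: "c > 0" and t: "t \<in> {0..t0}" and x: "0 < x" "x < pi"
  shows "0 < U 0 t x"
proof -
  have "x \<in> {0..pi}" using x by simp
  from good[unfolded good_pair_def, rule_format, OF t this] have "c * dpi x ^ 3 \<le> U 0 t x" by blast
  moreover have "0 < c * dpi x ^ 3" using c dpi_bounds[OF x] by simp
  ultimately show ?thesis by linarith
qed

text \<open>Cutting off at distance \<open>\<rho>\<close> from the zeros keeps the integrand
  continuous where the weight may be singular; the price is a boundary flux. \<open>\<rho>\<close>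
  is chosen separately for each packet, so estimates have to be uniform in it.\<close>

definition energy :: "real \<Rightarrow> (nat \<Rightarrow> real \<Rightarrow> real \<Rightarrow> real) \<Rightarrow> (nat \<Rightarrow> real \<Rightarrow> real \<Rightarrow> real) \<Rightarrow> real \<Rightarrow> real \<Rightarrow> real" where
  "energy \<alpha> U V \<rho> t = integral {\<rho>..pi - \<rho>} (\<lambda>x. U 0 t x powr (2 * \<alpha> / 3 - 1) * (U 0 t x - V 0 t x) ^ 2)"

text \<open>Integrating \<open>eflux_derivative\<close> over the cut-off interval leaves two
  boundary fluxes and a residual below a multiple of the energy. Gronwall's inequality then applies
  with a constant independent of \<open>\<rho>\<close> and of the pair.\<close>

lemma energy_estimate:
  assumes m: "m \<ge> 2" and s: "s \<ge> 6" and c: "c > 0" and t0: "t0 > 0"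
  obtains C where "C > 0" "\<And>U V \<rho> t. classical \<alpha> \<mu> m s M t0 U \<Longrightarrow> classical \<alpha> \<mu> m s M t0 V \<Longrightarrow>
      good_pair s A c K t0 U V \<Longrightarrow> 0 < \<rho> \<Longrightarrow> \<rho> < pi / 2 \<Longrightarrow> t \<in> {0..t0} \<Longrightarrow>
      energy \<alpha> U V \<rho> t \<le> C * (energy \<alpha> U V \<rho> 0 + \<rho> powr (2 * (real s + \<alpha> - 1)))"
proof -
  obtain C where C: "C > 0" "\<And>u v d. (u, v, d) \<in> jetset s M c K \<Longrightarrow>
      \<bar>eres \<alpha> \<mu> m u v\<bar> \<le> C * u 0 powr (2 * \<alpha> / 3 - 1) \<and> \<bar>eflux \<alpha> \<mu> m u v\<bar> \<le> C * d powr (2 * (real s + \<alpha> - 1))"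
    by (rule energy_bounds[OF m s c, of M K \<alpha> \<mu>]) blast
  show thesis
  \<comment> \<open>The exponential is the Gronwall factor; \<open>2 * C * t0\<close> collects the
    boundary fluxes at the two ends over the whole time interval.\<close>
  proof (rule that[of "exp (C * t0) * (1 + 2 * C * t0)"])
    show "exp (C * t0) * (1 + 2 * C * t0) > 0" using C(1) t0 by (simp add: add_pos_pos)
    fix U V \<rho> t
    assume cU: "classical \<alpha> \<mu> m s M t0 U" and cV: "classical \<alpha> \<mu> m s M t0 V"
      and good: "good_pair s A c K t0 U V" and \<rho>: "0 < \<rho>" "\<rho> < pi / 2" and t: "t \<in> {0..t0}"
    define I where "I = {\<rho>..pi - \<rho>}"
    define B where "B = \<rho> powr (2 * (real s + \<alpha> - 1))"
    define e where "e x t = U 0 t x powr (2 * \<alpha> / 3 - 1) * (U 0 t x - V 0 t x) ^ 2" for x t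
    define ed where "ed t x = edot \<alpha> \<mu> m (\<lambda>k. U k t x) (\<lambda>k. V k t x)" for t x
    have I: "0 < x \<and> x < pi" if "x \<in> I" for x using that \<rho> by (auto simp: I_def)
    have B0: "B \<ge> 0" by (simp add: B_def)
    have cu: "continuous_on ({0..t0} \<times> I) (\<lambda>q. U k (fst q) (snd q))"
      and cv: "continuous_on ({0..t0} \<times> I) (\<lambda>q. V k (fst q) (snd q))" if "k \<le> 3" for k
      by (rule continuous_on_subset[OF classicalD(1)[OF cU]] continuous_on_subset[OF classicalD(1)[OF cV]]; use that s in auto)+
    have pos: "0 < U 0 t x" if "t \<in> {0..t0}" "x \<in> I" for t x
      using good_pair_pos[OF good c that(1)] I[OF that(2)] by auto
    have cp: "continuous_on ({0..t0} \<times> I) (\<lambda>q. U 0 (fst q) (snd q) powr r)" for r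
    proof (intro continuous_on_powr continuous_on_const cu ballI)
      fix q assume "q \<in> {0..t0} \<times> I"
      then show "U 0 (fst q) (snd q) \<noteq> 0" using pos[of "fst q" "snd q"] by (auto simp: mem_Times_iff)
    qed simp
    have ced: "continuous_on ({0..t0} \<times> I) (\<lambda>q. ed (fst q) (snd q))"
      unfolding ed_def edot_def Let_def Nl_def
      by (intro continuous_on_add continuous_on_diff continuous_on_minus continuous_on_mult continuous_on_power continuous_on_const cp cu cv) auto
    have ce: "continuous_on ({0..t0} \<times> I) (\<lambda>q. e (snd q) (fst q))"
      unfolding e_def
      by (intro continuous_on_diff continuous_on_mult continuous_on_power continuous_on_const cp cu cv) auto
    have sl: "continuous_on I (\<lambda>x. f t x)" if "continuous_on ({0..t0} \<times> I) (\<lambda>q. f (fst q) (snd q))" "t \<in> {0..t0}"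
      for f :: "real \<Rightarrow> real \<Rightarrow> real" and t
    proof -
      have "continuous_on I (\<lambda>x. (t, x))" by (intro continuous_intros)
      from continuous_on_compose2[OF that(1) this] show ?thesis using that(2) by force
    qed
    have der: "((\<lambda>t. energy \<alpha> U V \<rho> t) has_real_derivative integral I (ed t)) (at t within {0..t0})" if t: "t \<in> {0..t0}" for t
    proof -
      have "((\<lambda>t. integral (cbox \<rho> (pi - \<rho>)) (\<lambda>x. e x t)) has_field_derivative integral (cbox \<rho> (pi - \<rho>)) (\<lambda>x. ed t x)) (at t within {0..t0})"
      proof (rule leibniz_rule_field_derivative)
        show "((\<lambda>t. e x t) has_field_derivative ed t x) (at t within {0..t0})"
          if "t \<in> {0..t0}" "x \<in> cbox \<rho> (pi - \<rho>)" for t x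
          unfolding e_def ed_def by (rule edot_time_derivative[OF cU cV s that(1)]) (use pos that in \<open>auto simp: I_def\<close>)
        show "(\<lambda>x. e x t) integrable_on cbox \<rho> (pi - \<rho>)" if "t \<in> {0..t0}" for t
          using sl[of "\<lambda>t x. e x t", OF ce that] by (simp add: integrable_continuous_interval I_def)
        show "continuous_on ({0..t0} \<times> cbox \<rho> (pi - \<rho>)) (\<lambda>(t, x). ed t x)"
          using ced by (simp add: split_def I_def)
      qed (use t in auto)
      then show ?thesis by (simp add: energy_def e_def I_def)
    qed
    have le: "integral I (ed t) \<le> C * energy \<alpha> U V \<rho> t + 2 * C * B" if t: "t \<in> {0..t0}" for t
    proof -
      define F where "F x = eflux \<alpha> \<mu> m (\<lambda>k. U k t x) (\<lambda>k. V k t x)" for x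
      define R where "R x = eres \<alpha> \<mu> m (\<lambda>k. U k t x) (\<lambda>k. V k t x)" for x
      have FTC: "((\<lambda>x. R x * (U 0 t x - V 0 t x) ^ 2 - ed t x) has_integral (F (pi - \<rho>) - F \<rho>)) I"
        unfolding I_def
      proof (rule fundamental_theorem_of_calculus)
        fix x assume x: "x \<in> {\<rho>..pi - \<rho>}"
        have "(F has_real_derivative R x * (U 0 t x - V 0 t x) ^ 2 - ed t x) (at x)"
          unfolding F_def R_def ed_def
        proof (rule eflux_derivative[where u = "\<lambda>k. U k t" and v = "\<lambda>k. V k t"])
          show "U 0 t x > 0" using pos[OF t] x by (simp add: I_def)
        qed (use classicalD(4)[OF cU] classicalD(4)[OF cV] t s m in auto)
        then show "(F has_vector_derivative R x * (U 0 t x - V 0 t x) ^ 2 - ed t x) (at x within {\<rho>..pi - \<rho>})"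
          by (simp add: has_real_derivative_iff_has_vector_derivative has_vector_derivative_at_within)
      qed (use \<rho> in auto)
      have edi: "(ed t has_integral integral I (ed t)) I"
        using sl[of ed, OF ced t] by (simp add: I_def integrable_continuous_interval integrable_integral)
      have ei: "((\<lambda>x. e x t) has_integral energy \<alpha> U V \<rho> t) I"
        using sl[of "\<lambda>t x. e x t", OF ce t] by (simp add: I_def energy_def e_def integrable_continuous_interval integrable_integral)
      have Ri: "((\<lambda>x. R x * (U 0 t x - V 0 t x) ^ 2) has_integral (F (pi - \<rho>) - F \<rho> + integral I (ed t))) I"
        using has_integral_add[OF FTC edi] by simp
      have "F (pi - \<rho>) - F \<rho> + integral I (ed t) \<le> C * energy \<alpha> U V \<rho> t"
      proof (rule has_integral_le[OF Ri has_integral_mult_right[OF ei]])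
        fix x assume x: "x \<in> I"
        have "\<bar>R x\<bar> \<le> C * U 0 t x powr (2 * \<alpha> / 3 - 1)"
          unfolding R_def using C(2)[OF good_pair_jetset[OF s cU cV good t]] I[OF x] by auto
        then have "R x * (U 0 t x - V 0 t x) ^ 2 \<le> (C * U 0 t x powr (2 * \<alpha> / 3 - 1)) * (U 0 t x - V 0 t x) ^ 2"
          by (intro mult_right_mono) auto
        then show "R x * (U 0 t x - V 0 t x) ^ 2 \<le> C * e x t" by (simp add: e_def mult_ac)
      qed
      moreover have "\<bar>F \<rho>\<bar> \<le> C * B" "\<bar>F (pi - \<rho>)\<bar> \<le> C * B"
      proof -
        have "dpi \<rho> = \<rho>" "dpi (pi - \<rho>) = \<rho>" using \<rho> by (auto simp: dpi_def)
        then show "\<bar>F \<rho>\<bar> \<le> C * B" "\<bar>F (pi - \<rho>)\<bar> \<le> C * B"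
          unfolding F_def B_def using C(2)[OF good_pair_jetset[OF s cU cV good t, of \<rho>]]
            C(2)[OF good_pair_jetset[OF s cU cV good t, of "pi - \<rho>"]] \<rho> by auto
      qed
      ultimately show ?thesis by linarith
    qed
    have E0: "0 \<le> energy \<alpha> U V \<rho> 0"
      unfolding energy_def
      by (rule integral_nonneg)
        (use sl[of "\<lambda>t x. e x t", OF ce, of 0] t0 in \<open>auto simp: I_def e_def integrable_continuous_interval\<close>)
    have "energy \<alpha> U V \<rho> t \<le> exp (C * t) * (energy \<alpha> U V \<rho> 0 + 2 * C * B * t)"
      by (rule gronwall_derivative[OF der le]) (use C(1) B0 t in auto)
    also have "\<dots> \<le> exp (C * t0) * (energy \<alpha> U V \<rho> 0 + 2 * C * B * t0)"
      using t C(1) B0 E0 by (intro mult_mono add_left_mono mult_left_mono) auto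
    also have "\<dots> \<le> exp (C * t0) * ((1 + 2 * C * t0) * (energy \<alpha> U V \<rho> 0 + B))"
    proof (rule mult_left_mono)
      have "0 \<le> 2 * C * t0 * energy \<alpha> U V \<rho> 0" using E0 C(1) t0 by simp
      then show "energy \<alpha> U V \<rho> 0 + 2 * C * B * t0 \<le> (1 + 2 * C * t0) * (energy \<alpha> U V \<rho> 0 + B)"
        using B0 by (simp add: algebra_simps)
    qed simp
    finally show "energy \<alpha> U V \<rho> t \<le> exp (C * t0) * (1 + 2 * C * t0) * (energy \<alpha> U V \<rho> 0 + \<rho> powr (2 * (real s + \<alpha> - 1)))"
      by (simp add: B_def mult_ac)
  qed
qed

section \<open>Testing against a wave packet\<close>

text \<open>This is (u f)_xxx - \<alpha> (u_x f)_xx + (lin1 f)_x - lin0 f, minus the formal adjoint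
  of the operator in \<open>Nl_diff\<close>. With this sign the pairing of f with u - v changes at
  the rate given by f_t + adj f tested against u - v, so a good test function makes that sum
  small.\<close>

definition adj :: "real \<Rightarrow> real \<Rightarrow> nat \<Rightarrow> (nat \<Rightarrow> real) \<Rightarrow> (nat \<Rightarrow> real) \<Rightarrow> (nat \<Rightarrow> real) \<Rightarrow> real" where
  "adj \<alpha> \<mu> m u v f = u 3 * f 0 + 3 * u 2 * f 1 + 3 * u 1 * f 2 + u 0 * f 3
     - \<alpha> * (u 3 * f 0 + 2 * u 2 * f 1 + u 1 * f 2)
     + lin1' \<alpha> \<mu> m u v * f 0 + lin1 \<alpha> \<mu> m u v * f 1 - lin0 \<alpha> \<mu> m u v * f 0"

definition tflux :: "real \<Rightarrow> real \<Rightarrow> nat \<Rightarrow> (nat \<Rightarrow> real) \<Rightarrow> (nat \<Rightarrow> real) \<Rightarrow> (nat \<Rightarrow> real) \<Rightarrow> real" where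
  "tflux \<alpha> \<mu> m u v f = (let w = \<lambda>k. u k - v k in
     u 0 * f 0 * w 2 - (u 1 * f 0 + u 0 * f 1) * w 1 + (u 2 * f 0 + 2 * (u 1 * f 1) + u 0 * f 2) * w 0
     + \<alpha> * (u 1 * f 0 * w 1 - (u 2 * f 0 + u 1 * f 1) * w 0) + lin1 \<alpha> \<mu> m u v * f 0 * w 0)"

text \<open>Lagrange's identity for the operator in \<open>Nl_diff\<close>. Every term of
  \<open>tflux\<close> contains some \<open>f k\<close>, so boundary terms vanish wherever the jet
  of the test function does.\<close>

lemma tflux_derivative:
  fixes u v f :: "nat \<Rightarrow> real \<Rightarrow> real"
  assumes du: "\<And>k. k \<le> 2 \<Longrightarrow> (u k has_real_derivative u (Suc k) x) (at x)"
    and dv: "\<And>k. k \<le> 2 \<Longrightarrow> (v k has_real_derivative v (Suc k) x) (at x)"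
    and df: "\<And>k. k \<le> 2 \<Longrightarrow> (f k has_real_derivative f (Suc k) x) (at x)"
  shows "((\<lambda>x. tflux \<alpha> \<mu> m (\<lambda>k. u k x) (\<lambda>k. v k x) (\<lambda>k. f k x)) has_real_derivative
     f 0 x * (Nl \<alpha> \<mu> m (\<lambda>k. u k x) - Nl \<alpha> \<mu> m (\<lambda>k. v k x))
     + adj \<alpha> \<mu> m (\<lambda>k. u k x) (\<lambda>k. v k x) (\<lambda>k. f k x) * (u 0 x - v 0 x)) (at x)"
proof -
  define w where "w k x = u k x - v k x" for k x
  define l where "l x = lin1 \<alpha> \<mu> m (\<lambda>k. u k x) (\<lambda>k. v k x)" for x
  define l' where "l' = lin1' \<alpha> \<mu> m (\<lambda>k. u k x) (\<lambda>k. v k x)"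
  have d: "(u 0 has_real_derivative u 1 x) (at x)" "(u 1 has_real_derivative u 2 x) (at x)" "(u 2 has_real_derivative u 3 x) (at x)"
    using du[of 0] du[of 1] du[of 2] by (simp_all add: eval_nat_numeral)
  have dvv: "(v 0 has_real_derivative v 1 x) (at x)" "(v 1 has_real_derivative v 2 x) (at x)" "(v 2 has_real_derivative v 3 x) (at x)"
    using dv[of 0] dv[of 1] dv[of 2] by (simp_all add: eval_nat_numeral)
  have f: "(f 0 has_real_derivative f 1 x) (at x)" "(f 1 has_real_derivative f 2 x) (at x)" "(f 2 has_real_derivative f 3 x) (at x)"
    using df[of 0] df[of 1] df[of 2] by (simp_all add: eval_nat_numeral)
  have dw: "(w 0 has_real_derivative w 1 x) (at x)" "(w 1 has_real_derivative w 2 x) (at x)" "(w 2 has_real_derivative w 3 x) (at x)"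
    unfolding w_def by (intro DERIV_diff d dvv)+
  have dl: "(l has_real_derivative l') (at x)"
    unfolding l_def l'_def by (rule lin1_derivative[OF d(1) dvv(3)])
  have "((\<lambda>x. u 0 x * f 0 x * w 2 x - (u 1 x * f 0 x + u 0 x * f 1 x) * w 1 x
      + (u 2 x * f 0 x + 2 * (u 1 x * f 1 x) + u 0 x * f 2 x) * w 0 x
      + \<alpha> * (u 1 x * f 0 x * w 1 x - (u 2 x * f 0 x + u 1 x * f 1 x) * w 0 x) + l x * f 0 x * w 0 x) has_real_derivative
      ((u 1 x * f 0 x + f 1 x * u 0 x) * w 2 x + w 3 x * (u 0 x * f 0 x))
      - (((u 2 x * f 0 x + f 1 x * u 1 x) + (u 1 x * f 1 x + f 2 x * u 0 x)) * w 1 x + w 2 x * (u 1 x * f 0 x + u 0 x * f 1 x))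
      + (((u 3 x * f 0 x + f 1 x * u 2 x) + 2 * (u 2 x * f 1 x + f 2 x * u 1 x) + (u 1 x * f 2 x + f 3 x * u 0 x)) * w 0 x
          + w 1 x * (u 2 x * f 0 x + 2 * (u 1 x * f 1 x) + u 0 x * f 2 x))
      + \<alpha> * (((u 2 x * f 0 x + f 1 x * u 1 x) * w 1 x + w 2 x * (u 1 x * f 0 x))
          - (((u 3 x * f 0 x + f 1 x * u 2 x) + (u 2 x * f 1 x + f 2 x * u 1 x)) * w 0 x + w 1 x * (u 2 x * f 0 x + u 1 x * f 1 x)))
      + ((l' * f 0 x + f 1 x * l x) * w 0 x + w 1 x * (l x * f 0 x))) (at x)"
    by (intro DERIV_add DERIV_diff DERIV_mult DERIV_cmult d f dw dl)
  then have "((\<lambda>x. tflux \<alpha> \<mu> m (\<lambda>k. u k x) (\<lambda>k. v k x) (\<lambda>k. f k x)) has_real_derivative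
      ((u 1 x * f 0 x + f 1 x * u 0 x) * w 2 x + w 3 x * (u 0 x * f 0 x))
      - (((u 2 x * f 0 x + f 1 x * u 1 x) + (u 1 x * f 1 x + f 2 x * u 0 x)) * w 1 x + w 2 x * (u 1 x * f 0 x + u 0 x * f 1 x))
      + (((u 3 x * f 0 x + f 1 x * u 2 x) + 2 * (u 2 x * f 1 x + f 2 x * u 1 x) + (u 1 x * f 2 x + f 3 x * u 0 x)) * w 0 x
          + w 1 x * (u 2 x * f 0 x + 2 * (u 1 x * f 1 x) + u 0 x * f 2 x))
      + \<alpha> * (((u 2 x * f 0 x + f 1 x * u 1 x) * w 1 x + w 2 x * (u 1 x * f 0 x))
          - (((u 3 x * f 0 x + f 1 x * u 2 x) + (u 2 x * f 1 x + f 2 x * u 1 x)) * w 0 x + w 1 x * (u 2 x * f 0 x + u 1 x * f 1 x)))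
      + ((l' * f 0 x + f 1 x * l x) * w 0 x + w 1 x * (l x * f 0 x))) (at x)"
    unfolding tflux_def Let_def w_def l_def .
  then show ?thesis
    by (rule DERIV_cong) (unfold Nl_diff adj_def l_def[symmetric] l'_def[symmetric] w_def, simp add: algebra_simps)
qed

text \<open>Phase and speed are chosen so that \<open>wpt G A N t z + A * wpk G A N 3 t z\<close> is \<open>O(N)\<close>: the terms of order \<open>N\<^sup>2\<close> and \<open>N\<^sup>3\<close> cancel.\<close>

definition wpk :: "(nat \<Rightarrow> real \<Rightarrow> real) \<Rightarrow> real \<Rightarrow> real \<Rightarrow> nat \<Rightarrow> real \<Rightarrow> real \<Rightarrow> real" where
  "wpk G A N j t z = (let a = z + 3 * A * N ^ 2 * t; \<theta> = N * z + A * N ^ 3 * t in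
     if j = 0 then G 0 a * cos \<theta>
     else if j = 1 then G 1 a * cos \<theta> - N * (G 0 a * sin \<theta>)
     else if j = 2 then G 2 a * cos \<theta> - 2 * N * (G 1 a * sin \<theta>) - N ^ 2 * (G 0 a * cos \<theta>)
     else G 3 a * cos \<theta> - 3 * N * (G 2 a * sin \<theta>) - 3 * N ^ 2 * (G 1 a * cos \<theta>) + N ^ 3 * (G 0 a * sin \<theta>))"

definition wpt :: "(nat \<Rightarrow> real \<Rightarrow> real) \<Rightarrow> real \<Rightarrow> real \<Rightarrow> real \<Rightarrow> real \<Rightarrow> real" where
  "wpt G A N t z = (let a = z + 3 * A * N ^ 2 * t; \<theta> = N * z + A * N ^ 3 * t in
     3 * A * N ^ 2 * (G 1 a * cos \<theta>) - A * N ^ 3 * (G 0 a * sin \<theta>))"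

definition bump_jet :: "(nat \<Rightarrow> real \<Rightarrow> real) \<Rightarrow> real \<Rightarrow> bool" where
  "bump_jet G B \<longleftrightarrow> (\<forall>k\<le>2. \<forall>z. (G k has_real_derivative G (Suc k) z) (at z)) \<and> continuous_on UNIV (G 3) \<and>
     (\<forall>k\<le>3. \<forall>z. \<bar>G k z\<bar> \<le> B \<and> (\<bar>z\<bar> \<ge> 1 \<longrightarrow> G k z = 0))"

lemma wpk_derivative:
  assumes G: "bump_jet G B"
  shows "j \<le> 2 \<Longrightarrow> (wpk G A N j t has_real_derivative wpk G A N (Suc j) t z) (at z)"
    and "((\<lambda>t. wpk G A N 0 t z) has_real_derivative wpt G A N t z) (at t)"
proof -
  define a where "a z t = z + 3 * A * N ^ 2 * t" for z t
  define \<theta> where "\<theta> z t = N * z + A * N ^ 3 * t" for z t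
  have g: "(G 0 has_real_derivative G 1 y) (at y)" "(G 1 has_real_derivative G 2 y) (at y)" "(G 2 has_real_derivative G 3 y) (at y)" for y
    using G by (auto simp: bump_jet_def numeral_2_eq_2 numeral_3_eq_3)
  have da: "((\<lambda>z. a z t) has_real_derivative 1) (at z)" and dt: "((\<lambda>t. a z t) has_real_derivative 3 * A * N ^ 2) (at t)"
    and d\<theta>: "((\<lambda>z. \<theta> z t) has_real_derivative N) (at z)" and dt\<theta>: "((\<lambda>t. \<theta> z t) has_real_derivative A * N ^ 3) (at t)"
    unfolding a_def \<theta>_def by (auto intro!: derivative_eq_intros)
  have C: "((\<lambda>z. f (a z t) * cos (\<theta> z t)) has_real_derivative f' (a z t) * cos (\<theta> z t) - N * (f (a z t) * sin (\<theta> z t))) (at z)"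
    and S: "((\<lambda>z. f (a z t) * sin (\<theta> z t)) has_real_derivative f' (a z t) * sin (\<theta> z t) + N * (f (a z t) * cos (\<theta> z t))) (at z)"
    and T: "((\<lambda>t. f (a z t) * cos (\<theta> z t)) has_real_derivative
      3 * A * N ^ 2 * (f' (a z t) * cos (\<theta> z t)) - A * N ^ 3 * (f (a z t) * sin (\<theta> z t))) (at t)"
    if f: "\<And>y. (f has_real_derivative f' y) (at y)" for f f'
  proof -
    note c1 = DERIV_chain2[OF f da] and c2 = DERIV_chain2[OF DERIV_cos d\<theta>] and c3 = DERIV_chain2[OF DERIV_sin d\<theta>]
    show "((\<lambda>z. f (a z t) * cos (\<theta> z t)) has_real_derivative f' (a z t) * cos (\<theta> z t) - N * (f (a z t) * sin (\<theta> z t))) (at z)"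
      using DERIV_mult[OF c1 c2] by (rule DERIV_cong) (simp add: algebra_simps)
    show "((\<lambda>z. f (a z t) * sin (\<theta> z t)) has_real_derivative f' (a z t) * sin (\<theta> z t) + N * (f (a z t) * cos (\<theta> z t))) (at z)"
      using DERIV_mult[OF c1 c3] by (rule DERIV_cong) (simp add: algebra_simps)
    show "((\<lambda>t. f (a z t) * cos (\<theta> z t)) has_real_derivative
      3 * A * N ^ 2 * (f' (a z t) * cos (\<theta> z t)) - A * N ^ 3 * (f (a z t) * sin (\<theta> z t))) (at t)"
      using DERIV_mult[OF DERIV_chain2[OF f dt] DERIV_chain2[OF DERIV_cos dt\<theta>]] by (rule DERIV_cong) (simp add: algebra_simps)
  qed
  have w: "wpk G A N 0 = (\<lambda>t z. G 0 (a z t) * cos (\<theta> z t))"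
    "wpk G A N (Suc 0) = (\<lambda>t z. G 1 (a z t) * cos (\<theta> z t) - N * (G 0 (a z t) * sin (\<theta> z t)))"
    "wpk G A N 2 = (\<lambda>t z. G 2 (a z t) * cos (\<theta> z t) - 2 * N * (G 1 (a z t) * sin (\<theta> z t)) - N ^ 2 * (G 0 (a z t) * cos (\<theta> z t)))"
    "wpk G A N 3 = (\<lambda>t z. G 3 (a z t) * cos (\<theta> z t) - 3 * N * (G 2 (a z t) * sin (\<theta> z t))
       - 3 * N ^ 2 * (G 1 (a z t) * cos (\<theta> z t)) + N ^ 3 * (G 0 (a z t) * sin (\<theta> z t)))"
    "wpt G A N = (\<lambda>t z. 3 * A * N ^ 2 * (G 1 (a z t) * cos (\<theta> z t)) - A * N ^ 3 * (G 0 (a z t) * sin (\<theta> z t)))"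
    by (auto simp: wpk_def wpt_def a_def \<theta>_def Let_def fun_eq_iff)
  have 0: "(wpk G A N 0 t has_real_derivative wpk G A N (Suc 0) t z) (at z)"
    unfolding w by (rule C[OF g(1)])
  have 1: "(wpk G A N (Suc 0) t has_real_derivative wpk G A N 2 t z) (at z)"
    unfolding w using DERIV_diff[OF C[OF g(2)] DERIV_cmult[OF S[OF g(1)], of N]]
    by (rule DERIV_cong) (simp add: algebra_simps power2_eq_square)
  have 2: "(wpk G A N 2 t has_real_derivative wpk G A N 3 t z) (at z)"
    unfolding w using DERIV_diff[OF DERIV_diff[OF C[OF g(3)] DERIV_cmult[OF S[OF g(2)], of "2 * N"]] DERIV_cmult[OF C[OF g(1)], of "N ^ 2"]]
    by (rule DERIV_cong) (simp add: algebra_simps power2_eq_square power3_eq_cube)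
  show "(wpk G A N j t has_real_derivative wpk G A N (Suc j) t z) (at z)" if j: "j \<le> 2"
  proof -
    consider "j = 0" | "j = 1" | "j = 2" using j by linarith
    then show ?thesis by cases (use 0 1 2 in \<open>auto simp: numeral_2_eq_2 numeral_3_eq_3\<close>)
  qed
  show "((\<lambda>t. wpk G A N 0 t z) has_real_derivative wpt G A N t z) (at t)"
    unfolding w by (rule T[OF g(1)])
qed

text \<open>The factor 8 is 1 + 3 + 3 + 1: for \<open>N \<ge> 1\<close> the Leibniz expansion of the
  j-th derivative is at most B (1 + N)^j, hence at most 8 B N^j. The factor \<open>1 + A\<close>
  lets one constant serve also for the combination with the time derivative, where only terms of
  order at most N survive.\<close>

lemma wpk_bounds:
  assumes G: "bump_jet G B" and N: "N \<ge> 1" and A: "A > 0"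
  shows "j \<le> 3 \<Longrightarrow> \<bar>wpk G A N j t z\<bar> \<le> 8 * B * (1 + A) * N ^ j"
    and "\<bar>wpt G A N t z + A * wpk G A N 3 t z\<bar> \<le> 8 * B * (1 + A) * N"
    and "\<bar>z + 3 * A * N ^ 2 * t\<bar> \<ge> 1 \<Longrightarrow> wpk G A N j t z = 0"
    and "\<bar>z + 3 * A * N ^ 2 * t\<bar> \<ge> 1 \<Longrightarrow> wpt G A N t z = 0"
    and "\<bar>wpk G A N 0 t z\<bar> \<le> B"
proof -
  define a where "a = z + 3 * A * N ^ 2 * t"
  define \<theta> where "\<theta> = N * z + A * N ^ 3 * t"
  have b: "\<bar>G k a\<bar> \<le> B" if "k \<le> 3" for k using G that by (auto simp: bump_jet_def)
  have B: "0 \<le> B" using b[of 0] by linarith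
  have bc: "\<bar>G k a * cos \<theta>\<bar> \<le> B" and bs: "\<bar>G k a * sin \<theta>\<bar> \<le> B" if "k \<le> 3" for k
    using mult_mono[OF b[OF that] abs_cos_le_one[of \<theta>] B abs_ge_zero] mult_mono[OF b[OF that] abs_sin_le_one[of \<theta>] B abs_ge_zero]
    by (simp_all add: abs_mult)
  have sc: "\<bar>c * x\<bar> \<le> c * B" if "\<bar>x\<bar> \<le> B" "c \<ge> 0" for c x
    using that by (simp add: abs_mult mult_left_mono)
  have N1: "1 \<le> N" "N \<le> N ^ 2" "N ^ 2 \<le> N ^ 3" "1 \<le> N ^ 2" "1 \<le> N ^ 3" "N \<le> N ^ 3"
    using N power_increasing[of 1 2 N] power_increasing[of 2 3 N] power_increasing[of 1 3 N] one_le_power[OF N] by auto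
  have AB: "8 * B * x \<le> 8 * B * (1 + A) * x" if "x \<ge> 0" for x
  proof -
    have "0 \<le> A * (8 * B * x)" using A B that by simp
    then show ?thesis by (simp add: algebra_simps)
  qed
  note defs = wpk_def wpt_def Let_def a_def[symmetric] \<theta>_def[symmetric]
  show 0: "\<bar>wpk G A N 0 t z\<bar> \<le> B" using bc[of 0] by (simp add: defs)
  have w1: "\<bar>wpk G A N 1 t z\<bar> \<le> 8 * B * N"
  proof -
    have "\<bar>wpk G A N 1 t z\<bar> \<le> B + N * B"
      using bc[of 1] sc[OF bs[of 0], of N] N1 by (simp add: defs)
    also have "\<dots> = (1 + N) * B" by (simp add: algebra_simps)
    also have "\<dots> \<le> (8 * N) * B" using N1 B by (intro mult_right_mono) auto
    finally show ?thesis by (simp add: mult_ac)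
  qed
  have w2: "\<bar>wpk G A N 2 t z\<bar> \<le> 8 * B * N ^ 2"
  proof -
    have "\<bar>wpk G A N 2 t z\<bar> \<le> B + 2 * N * B + N ^ 2 * B"
      using bc[of 2] sc[OF bs[of 1], of "2 * N"] sc[OF bc[of 0], of "N ^ 2"] N1 by (simp add: defs)
    also have "\<dots> = (1 + 2 * N + N ^ 2) * B" by (simp add: algebra_simps)
    also have "\<dots> \<le> (8 * N ^ 2) * B" using N1 B by (intro mult_right_mono) auto
    finally show ?thesis by (simp add: mult_ac)
  qed
  have w3: "\<bar>wpk G A N 3 t z\<bar> \<le> 8 * B * N ^ 3"
  proof -
    have "\<bar>wpk G A N 3 t z\<bar> \<le> B + 3 * N * B + 3 * N ^ 2 * B + N ^ 3 * B"
      using bc[of 3] sc[OF bs[of 2], of "3 * N"] sc[OF bc[of 1], of "3 * N ^ 2"] sc[OF bs[of 0], of "N ^ 3"] N1 by (simp add: defs)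
    also have "\<dots> = (1 + 3 * N + 3 * N ^ 2 + N ^ 3) * B" by (simp add: algebra_simps)
    also have "\<dots> \<le> (8 * N ^ 3) * B" using N1 B by (intro mult_right_mono) auto
    finally show ?thesis by (simp add: mult_ac)
  qed
  show "\<bar>wpk G A N j t z\<bar> \<le> 8 * B * (1 + A) * N ^ j" if j: "j \<le> 3"
  proof -
    consider "j = 0" | "j = 1" | "j = 2" | "j = 3" using j by linarith
    then show ?thesis
    proof cases
      case 1 then show ?thesis using 0 AB[of 1] B by simp
    next
      case 2 then show ?thesis using w1 AB[of N] N1 by simp
    next
      case 3 then show ?thesis using w2 AB[of "N ^ 2"] N1 by simp
    next
      case 4 then show ?thesis using w3 AB[of "N ^ 3"] N1 by simp
    qed
  qed
  have "wpt G A N t z + A * wpk G A N 3 t z = A * (G 3 a * cos \<theta> - 3 * N * (G 2 a * sin \<theta>))"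
    unfolding defs by (simp add: algebra_simps)
  moreover have "\<bar>G 3 a * cos \<theta> - 3 * N * (G 2 a * sin \<theta>)\<bar> \<le> 8 * B * N"
  proof -
    have "\<bar>G 3 a * cos \<theta> - 3 * N * (G 2 a * sin \<theta>)\<bar> \<le> B + 3 * N * B"
      using bc[of 3] sc[OF bs[of 2], of "3 * N"] N1 by simp
    also have "\<dots> = (1 + 3 * N) * B" by (simp add: algebra_simps)
    also have "\<dots> \<le> (8 * N) * B" using N1 B by (intro mult_right_mono) auto
    finally show ?thesis by (simp add: mult_ac)
  qed
  ultimately have "\<bar>wpt G A N t z + A * wpk G A N 3 t z\<bar> \<le> A * (8 * B * N)"
    using A by (simp add: abs_mult)
  also have "\<dots> \<le> 8 * B * (1 + A) * N" using A B N1 by (simp add: algebra_simps)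
  finally show "\<bar>wpt G A N t z + A * wpk G A N 3 t z\<bar> \<le> 8 * B * (1 + A) * N" .
  have z: "G k a = 0" if "\<bar>a\<bar> \<ge> 1" "k \<le> 3" for k using G that by (auto simp: bump_jet_def)
  show "wpk G A N j t z = 0" if "\<bar>z + 3 * A * N ^ 2 * t\<bar> \<ge> 1"
    using z that by (simp add: defs)
  show "wpt G A N t z = 0" if "\<bar>z + 3 * A * N ^ 2 * t\<bar> \<ge> 1"
    using z that by (simp add: defs)
qed

section \<open>Packets in the original space variable\<close>

definition wq :: "real \<Rightarrow> (nat \<Rightarrow> real) \<Rightarrow> nat \<Rightarrow> real" where
  "wq \<gamma> P k = (if k = 0 then P 0 else if k = 1 then \<gamma> * P 0 + P 1
     else if k = 2 then \<gamma> * (\<gamma> - 1) * P 0 + (2 * \<gamma> - 1) * P 1 + P 2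
     else \<gamma> * (\<gamma> - 1) * (\<gamma> - 2) * P 0 + ((\<gamma> - 2) * (2 * \<gamma> - 1) + \<gamma> * (\<gamma> - 1)) * P 1 + (3 * \<gamma> - 3) * P 2 + P 3)"

text \<open>The k-th x-derivative of x powr \<gamma> times a profile in ln x - ln l;
  \<open>wq\<close> converts derivatives in ln x into derivatives in x. The choice \<gamma> =
  \<alpha> - 2 made below has two effects. For u = A x^3 the adjoint of the packet has no second
  derivative in ln x, hence no term of order N^2. And x powr (2 \<gamma>) divided by the energy
  weight is of order 1 / x, so the size of a packet dual to the energy does not depend on its
  scale.\<close>

definition packet :: "real \<Rightarrow> real \<Rightarrow> (nat \<Rightarrow> real \<Rightarrow> real) \<Rightarrow> real \<Rightarrow> real \<Rightarrow> nat \<Rightarrow> real \<Rightarrow> real \<Rightarrow> real" where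
  "packet \<gamma> l G A N k t x = x powr (\<gamma> - real k) * wq \<gamma> (\<lambda>j. wpk G A N j t (ln x - ln l)) k"

lemma packet_derivative:
  assumes G: "bump_jet G B" and x: "x > 0" and k: "k \<le> 2"
  shows "(packet \<gamma> l G A N k t has_real_derivative packet \<gamma> l G A N (Suc k) t x) (at x)"
proof -
  define p where "p j x = wpk G A N j t (ln x - ln l)" for j x
  have dp: "(p j has_real_derivative p (Suc j) x * (1 / x)) (at x)" if "j \<le> 2" for j
  proof -
    have "((\<lambda>x. ln x - ln l) has_real_derivative 1 / x) (at x)" using x by (auto intro!: derivative_eq_intros)
    from DERIV_chain2[OF wpk_derivative(1)[OF G that] this] show ?thesis unfolding p_def .
  qed
  have dp': "(p 0 has_real_derivative p 1 x * (1 / x)) (at x)" "(p 1 has_real_derivative p 2 x * (1 / x)) (at x)"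
    "(p 2 has_real_derivative p 3 x * (1 / x)) (at x)"
    using dp[of 0] dp[of 1] dp[of 2] by (simp_all add: eval_nat_numeral)
  have gen: "((\<lambda>x. x powr r * q x) has_real_derivative x powr (r - 1) * (r * q x + q')) (at x)"
    if "(q has_real_derivative q' * (1 / x)) (at x)" for r q q'
  proof -
    have "((\<lambda>x. x powr r * q x) has_real_derivative r * x powr (r - 1) * 1 * q x + q' * (1 / x) * x powr r) (at x)"
      by (rule DERIV_mult[OF DERIV_powr_pos[OF DERIV_ident x] that])
    moreover have "x powr r = x powr (r - 1) * x" using x by (simp add: powr_diff)
    ultimately show ?thesis using x by (elim DERIV_cong) (simp add: algebra_simps)
  qed
  have 0: "(packet \<gamma> l G A N 0 t has_real_derivative packet \<gamma> l G A N 1 t x) (at x)"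
    using gen[OF dp'(1), of \<gamma>] by (simp add: packet_def[abs_def] wq_def p_def[abs_def])
  have "((\<lambda>x. \<gamma> * p 0 x + p 1 x) has_real_derivative (\<gamma> * p 1 x + p 2 x) * (1 / x)) (at x)"
    using DERIV_add[OF DERIV_cmult[OF dp'(1), of \<gamma>] dp'(2)] by (rule DERIV_cong) (use x in \<open>simp add: field_simps\<close>)
  from gen[OF this, of "\<gamma> - 1"]
  have 1: "(packet \<gamma> l G A N 1 t has_real_derivative packet \<gamma> l G A N 2 t x) (at x)"
    unfolding packet_def[abs_def] wq_def p_def[symmetric] by (simp, elim DERIV_cong) (simp add: algebra_simps)
  have "((\<lambda>x. \<gamma> * (\<gamma> - 1) * p 0 x + (2 * \<gamma> - 1) * p 1 x + p 2 x) has_real_derivative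
      (\<gamma> * (\<gamma> - 1) * p 1 x + (2 * \<gamma> - 1) * p 2 x + p 3 x) * (1 / x)) (at x)"
    using DERIV_add[OF DERIV_add[OF DERIV_cmult[OF dp'(1), of "\<gamma> * (\<gamma> - 1)"] DERIV_cmult[OF dp'(2), of "2 * \<gamma> - 1"]] dp'(3)]
    by (rule DERIV_cong) (use x in \<open>simp add: field_simps\<close>)
  from gen[OF this, of "\<gamma> - 2"]
  have 2: "(packet \<gamma> l G A N 2 t has_real_derivative packet \<gamma> l G A N 3 t x) (at x)"
    unfolding packet_def[abs_def] wq_def p_def[symmetric] by (simp, elim DERIV_cong) (simp add: algebra_simps)
  consider "k = 0" | "k = 1" | "k = 2" using k by linarith
  then show ?thesis by cases (use 0 1 2 in \<open>auto simp: numeral_2_eq_2 numeral_3_eq_3\<close>)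
qed

lemma dom_compose:
  assumes "dom S f g" "\<And>q. q \<in> S' \<Longrightarrow> h q \<in> S"
  shows "dom S' (\<lambda>q. f (h q)) (\<lambda>q. g (h q))"
  using assms unfolding dom_def by blast

text \<open>Freezing \<open>u 0\<close> at \<open>A * x ^ 3\<close> and \<open>u 1\<close> at
  \<open>3 * A * x ^ 2\<close> turns the adjoint equation into p_t + A p_zzz in z = ln x, plus terms
  with at most one derivative, which are O(N). Freezing costs a factor \<open>x + t\<close> on terms
  as large as N^3.\<close>

lemma adj_bound:
  fixes A K M :: real
  assumes m: "m \<ge> 2" and s: "s \<ge> 6" and c: "c > 0"
  obtains C where "C > 0" "\<And>u v x t N P Pt. (u, v, x) \<in> jetset s M c K \<Longrightarrow> x \<le> 1 \<Longrightarrow> 0 \<le> t \<Longrightarrow> 1 \<le> N \<Longrightarrow>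
     \<bar>u 0 - A * x ^ 3\<bar> \<le> K * (x + t) * x ^ 3 \<Longrightarrow> \<bar>u 1 - 3 * A * x ^ 2\<bar> \<le> K * (x + t) * x ^ 2 \<Longrightarrow>
     (\<And>j. j \<le> 3 \<Longrightarrow> \<bar>P j\<bar> \<le> C0 * N ^ j) \<Longrightarrow> \<bar>Pt + A * P 3\<bar> \<le> C0 * N \<Longrightarrow>
     \<bar>x powr (\<alpha> - 2) * Pt + adj \<alpha> \<mu> m u v (\<lambda>k. x powr (\<alpha> - 2 - real k) * wq (\<alpha> - 2) P k)\<bar>
       \<le> C * x powr (\<alpha> - 2) * (N + (x + t) * N ^ 3)"
proof -
  define S where "S = {q :: ((nat \<Rightarrow> real) \<times> (nat \<Rightarrow> real) \<times> real) \<times> (real \<times> real) \<times> (nat \<Rightarrow> real) \<times> real.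
    case q of ((u, v, x), (t, N), (P, Pt)) \<Rightarrow> (u, v, x) \<in> jetset s M c K \<and> x \<le> 1 \<and> 0 \<le> t \<and> 1 \<le> N \<and>
     \<bar>u 0 - A * x ^ 3\<bar> \<le> K * (x + t) * x ^ 3 \<and> \<bar>u 1 - 3 * A * x ^ 2\<bar> \<le> K * (x + t) * x ^ 2 \<and>
     (\<forall>j\<le>3. \<bar>P j\<bar> \<le> C0 * N ^ j) \<and> \<bar>Pt + A * P 3\<bar> \<le> C0 * N}"
  define u where "u k q = fst (fst q) k" for k and q :: "((nat \<Rightarrow> real) \<times> (nat \<Rightarrow> real) \<times> real) \<times> (real \<times> real) \<times> (nat \<Rightarrow> real) \<times> real"
  define v where "v q = fst (snd (fst q))" for q :: "((nat \<Rightarrow> real) \<times> (nat \<Rightarrow> real) \<times> real) \<times> (real \<times> real) \<times> (nat \<Rightarrow> real) \<times> real"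
  define x where "x q = snd (snd (fst q))" for q :: "((nat \<Rightarrow> real) \<times> (nat \<Rightarrow> real) \<times> real) \<times> (real \<times> real) \<times> (nat \<Rightarrow> real) \<times> real"
  define t where "t q = fst (fst (snd q))" for q :: "((nat \<Rightarrow> real) \<times> (nat \<Rightarrow> real) \<times> real) \<times> (real \<times> real) \<times> (nat \<Rightarrow> real) \<times> real"
  define N where "N q = snd (fst (snd q))" for q :: "((nat \<Rightarrow> real) \<times> (nat \<Rightarrow> real) \<times> real) \<times> (real \<times> real) \<times> (nat \<Rightarrow> real) \<times> real"
  define P where "P j q = fst (snd (snd q)) j" for j and q :: "((nat \<Rightarrow> real) \<times> (nat \<Rightarrow> real) \<times> real) \<times> (real \<times> real) \<times> (nat \<Rightarrow> real) \<times> real"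
  define Pt where "Pt q = snd (snd (snd q))" for q :: "((nat \<Rightarrow> real) \<times> (nat \<Rightarrow> real) \<times> real) \<times> (real \<times> real) \<times> (nat \<Rightarrow> real) \<times> real"
  define \<gamma> where "\<gamma> = \<alpha> - 2"
  have fstu: "fst (fst q) = (\<lambda>k. u k q)" for q by (simp add: u_def)
  have S: "fst q \<in> jetset s M c K" "0 < x q" "x q \<le> 1" "0 \<le> t q" "1 \<le> N q"
    "\<bar>u 0 q - A * x q ^ 3\<bar> \<le> K * (x q + t q) * x q ^ 3" "\<bar>u 1 q - 3 * A * x q ^ 2\<bar> \<le> K * (x q + t q) * x q ^ 2"
    "\<And>j. j \<le> 3 \<Longrightarrow> \<bar>P j q\<bar> \<le> C0 * N q ^ j" "\<bar>Pt q + A * P 3 q\<bar> \<le> C0 * N q" if "q \<in> S" for q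
    using that by (auto simp: S_def u_def x_def t_def N_def P_def Pt_def jetset_def)
  note jb = jetset_bounds[OF m s c, where M = M and K = K]
  define g where "g q = N q + (x q + t q) * N q ^ 3" for q
  have NN: "N q ^ i \<le> N q ^ k" if "q \<in> S" "i \<le> k" for i k q
    using S(5)[OF that(1)] that(2) by (rule power_increasing[rotated])
  have gN: "dom S N g"
  proof (rule domI[where C = 1])
    fix q assume q: "q \<in> S"
    have "0 \<le> (x q + t q) * N q ^ 3" using S(2,4,5)[OF q] by simp
    then show "\<bar>N q\<bar> \<le> 1 * \<bar>g q\<bar>" using S(5)[OF q] by (simp add: g_def)
  qed
  have g3: "dom S (\<lambda>q. (x q + t q) * N q ^ 3) g"
  proof (rule domI[where C = 1])
    fix q assume q: "q \<in> S"
    have "0 \<le> (x q + t q) * N q ^ 3" using S(2,4,5)[OF q] by simp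
    then show "\<bar>(x q + t q) * N q ^ 3\<bar> \<le> 1 * \<bar>g q\<bar>" using S(5)[OF q] by (simp add: g_def)
  qed
  have bP: "dom S (P j) (\<lambda>q. N q ^ k)" if "j \<le> k" "j \<le> 3" for j k
  proof (rule domI[where C = "\<bar>C0\<bar>"])
    fix q assume q: "q \<in> S"
    have "\<bar>P j q\<bar> \<le> C0 * N q ^ j" using S(8)[OF q] that by blast
    also have "\<dots> \<le> \<bar>C0\<bar> * N q ^ k" using NN[OF q that(1)] S(5)[OF q] by (intro mult_mono) auto
    finally show "\<bar>P j q\<bar> \<le> \<bar>C0\<bar> * \<bar>N q ^ k\<bar>" using S(5)[OF q] by simp
  qed
  define Q where "Q k q = wq \<gamma> (\<lambda>j. P j q) k" for k q
  have bQ: "dom S (Q k) (\<lambda>q. N q ^ i)" if k: "k \<le> i" "k \<le> 3" for k i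
  proof -
    consider "k = 0" | "k = 1" | "k = 2" | "k = 3" using k by linarith
    then show ?thesis
      by cases (use k in \<open>auto simp: Q_def[abs_def] wq_def intro!: dom_add dom_cmult bP\<close>)
  qed
  \<comment> \<open>\<open>y0\<close> and \<open>y1\<close> are the freezing errors relative to
    \<open>x ^ 3\<close> and \<open>x ^ 2\<close>; \<open>y2\<close> and \<open>y3\<close> are the
    bounded coefficients of the lower derivatives after division by the matching power of
    \<open>x\<close>.\<close>
  define y0 where "y0 q = u 0 q / x q ^ 3 - A" for q
  define y1 where "y1 q = u 1 q / x q ^ 2 - 3 * A" for q
  define y2 where "y2 q = ((3 - 2 * \<alpha>) * u 2 q + lin1 \<alpha> \<mu> m (fst (fst q)) (v q)) / x q" for q
  define y3 where "y3 q = (1 - \<alpha>) * u 3 q + lin1' \<alpha> \<mu> m (fst (fst q)) (v q) - lin0 \<alpha> \<mu> m (fst (fst q)) (v q)" for q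
  have by0: "dom S y0 (\<lambda>q. x q + t q)"
  proof (rule domI[where C = K])
    fix q assume q: "q \<in> S"
    have "y0 q = (u 0 q - A * x q ^ 3) / x q ^ 3" using S(2)[OF q] by (simp add: y0_def field_simps)
    then have "\<bar>y0 q\<bar> = \<bar>u 0 q - A * x q ^ 3\<bar> / x q ^ 3" using S(2)[OF q] by simp
    also have "\<dots> \<le> K * (x q + t q)" using S(2)[OF q] S(6)[OF q] by (simp add: pos_divide_le_eq)
    finally show "\<bar>y0 q\<bar> \<le> K * \<bar>x q + t q\<bar>" using S(2,4)[OF q] by simp
  qed
  have by1: "dom S y1 (\<lambda>q. x q + t q)"
  proof (rule domI[where C = K])
    fix q assume q: "q \<in> S"
    have "y1 q = (u 1 q - 3 * A * x q ^ 2) / x q ^ 2" using S(2)[OF q] by (simp add: y1_def field_simps)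
    then have "\<bar>y1 q\<bar> = \<bar>u 1 q - 3 * A * x q ^ 2\<bar> / x q ^ 2" using S(2)[OF q] by simp
    also have "\<dots> \<le> K * (x q + t q)" using S(2)[OF q] S(7)[OF q] by (simp add: pos_divide_le_eq)
    finally show "\<bar>y1 q\<bar> \<le> K * \<bar>x q + t q\<bar>" using S(2,4)[OF q] by simp
  qed
  have bu2: "dom S (u 2) (\<lambda>q. x q powr 1)"
    using dom_compose[OF jb(1)[of 2], where h = fst and S' = S] S(1) by (simp add: u_def[abs_def] x_def[abs_def])
  have bl1: "dom S (\<lambda>q. lin1 \<alpha> \<mu> m (fst (fst q)) (v q)) (\<lambda>q. x q powr 1)"
    using dom_compose[OF jb(8), where h = fst and S' = S] S(1) by (simp add: v_def x_def[abs_def])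
  have "dom S (\<lambda>q. ((3 - 2 * \<alpha>) * u 2 q + lin1 \<alpha> \<mu> m (fst (fst q)) (v q)) * inverse (x q)) (\<lambda>q. x q powr 1 * inverse (x q))"
    by (intro dom_mult dom_add dom_cmult bu2 bl1 dom_refl)
  moreover have "dom S (\<lambda>q. x q powr 1 * inverse (x q)) (\<lambda>_. 1)"
    by (rule domI[where C = 1]) (use S(2) in \<open>auto dest!: S(2)\<close>)
  ultimately have by2: "dom S y2 (\<lambda>_. 1)"
    unfolding y2_def[abs_def] divide_inverse by (rule dom_trans)
  have by3: "dom S y3 (\<lambda>_. 1)"
  proof -
    have "dom S (u 3) (\<lambda>_. 1)"
      using dom_compose[OF jb(4)[of 3], where h = fst and S' = S] S(1) by (simp add: u_def[abs_def])
    moreover have "dom S (\<lambda>q. lin1' \<alpha> \<mu> m (fst (fst q)) (v q)) (\<lambda>_. 1)"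
      using dom_compose[OF jb(9), where h = fst and S' = S] S(1) by (simp add: v_def)
    moreover have "dom S (\<lambda>q. lin0 \<alpha> \<mu> m (fst (fst q)) (v q)) (\<lambda>_. 1)"
      using dom_compose[OF jb(10), where h = fst and S' = S] S(1) by (simp add: v_def)
    ultimately show ?thesis unfolding y3_def[abs_def] by (intro dom_add dom_diff dom_cmult)
  qed
  define k0 where "k0 = \<gamma> * (\<gamma> - 1) * (\<gamma> - 2) + 3 * (3 - \<alpha>) * (\<gamma> * (\<gamma> - 1))"
  define k1 where "k1 = (\<gamma> - 2) * (2 * \<gamma> - 1) + \<gamma> * (\<gamma> - 1) + 3 * (3 - \<alpha>) * (2 * \<gamma> - 1)"
  define br where "br q = (Pt q + A * P 3 q) + y0 q * Q 3 q + (3 - \<alpha>) * (y1 q * Q 2 q) + y2 q * Q 1 q + y3 q * Q 0 q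
      + A * (k0 * P 0 q + k1 * P 1 q)" for q
  have "dom S br g"
  proof -
    have 1: "dom S (\<lambda>q. Pt q + A * P 3 q) g"
    proof (rule dom_trans[OF _ gN], rule domI[where C = C0])
      fix q assume q: "q \<in> S"
      show "\<bar>Pt q + A * P 3 q\<bar> \<le> C0 * \<bar>N q\<bar>" using S(9)[OF q] S(5)[OF q] by simp
    qed
    have Q33: "dom S (Q 3) (\<lambda>q. N q ^ 3)" and Q23: "dom S (Q 2) (\<lambda>q. N q ^ 3)"
      by (rule bQ; simp)+
    have 2: "dom S (\<lambda>q. y0 q * Q 3 q) g" "dom S (\<lambda>q. y1 q * Q 2 q) g"
      by (rule dom_trans[OF dom_mult[OF by0 Q33] g3], rule dom_trans[OF dom_mult[OF by1 Q23] g3])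
    have 3: "dom S (\<lambda>q. y2 q * Q 1 q) g" "dom S (\<lambda>q. y3 q * Q 0 q) g" "dom S (P 0) g" "dom S (P 1) g"
      using dom_mult_bdd[OF by2 dom_trans[OF bQ[of 1 1, simplified] gN]] dom_mult_bdd[OF by3 dom_trans[OF bQ[of 0 1, simplified] gN]]
        dom_trans[OF bP[of 0 1, simplified] gN] dom_trans[OF bP[of 1 1, simplified] gN] by auto
    show ?thesis unfolding br_def[abs_def] by (intro dom_add dom_cmult 1 2 3)
  qed
  then obtain C where C: "C > 0" "\<And>q. q \<in> S \<Longrightarrow> \<bar>br q\<bar> \<le> C * \<bar>g q\<bar>" by (rule domE) blast
  have eq: "x q powr \<gamma> * Pt q + adj \<alpha> \<mu> m (fst (fst q)) (v q) (\<lambda>k. x q powr (\<gamma> - real k) * Q k q) = x q powr \<gamma> * br q"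
    if q: "q \<in> S" for q
  proof -
    define X where "X = x q powr \<gamma>"
    have p: "x q powr (\<gamma> - real k) = X / x q ^ k" for k
      using S(2)[OF q] by (simp add: powr_diff powr_realpow X_def)
    have p': "x q powr (\<gamma> - real 0) = X" "x q powr (\<gamma> - real 1) = X / x q" "x q powr (\<gamma> - real 2) = X / x q ^ 2" "x q powr (\<gamma> - real 3) = X / x q ^ 3"
      using p[of 0] p[of 1] p[of 2] p[of 3] by simp_all
    \<comment> \<open>The value \<gamma> = \<alpha> - 2 is used here: the coefficient 3 \<gamma> - 3
      of \<open>P 2\<close> in \<open>Q 3\<close> equals - 3 (3 - \<alpha>), so trading
      \<open>Q 3\<close> for \<open>P 3\<close> and \<open>Q 2\<close> leaves no
      \<open>P 2\<close>.\<close>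
    have Qr: "Q 3 q = P 3 q + k0 * P 0 q + k1 * P 1 q - 3 * (3 - \<alpha>) * Q 2 q"
      unfolding Q_def wq_def k0_def k1_def by (simp add: \<gamma>_def algebra_simps)
    have x0: "x q \<noteq> 0" using S(2)[OF q] by simp
    define l1 l1' l0 where "l1 = lin1 \<alpha> \<mu> m (fst (fst q)) (v q)" and "l1' = lin1' \<alpha> \<mu> m (fst (fst q)) (v q)" and "l0 = lin0 \<alpha> \<mu> m (fst (fst q)) (v q)"
    have a: "adj \<alpha> \<mu> m (fst (fst q)) (v q) (\<lambda>k. x q powr (\<gamma> - real k) * Q k q) =
       X * (u 0 q / x q ^ 3 * Q 3 q + (3 - \<alpha>) * (u 1 q / x q ^ 2 * Q 2 q)
        + ((3 - 2 * \<alpha>) * u 2 q + l1) / x q * Q 1 q + ((1 - \<alpha>) * u 3 q + l1' - l0) * Q 0 q)"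
      unfolding adj_def p' fstu l1_def l1'_def l0_def using x0 by (simp add: field_simps)
    have "A * Q 3 q + (3 - \<alpha>) * (3 * A * Q 2 q) = A * P 3 q + A * (k0 * P 0 q + k1 * P 1 q)"
      unfolding Qr by (simp add: algebra_simps)
    then have h: "u 0 q / x q ^ 3 * Q 3 q + (3 - \<alpha>) * (u 1 q / x q ^ 2 * Q 2 q)
      = y0 q * Q 3 q + (3 - \<alpha>) * (y1 q * Q 2 q) + (A * P 3 q + A * (k0 * P 0 q + k1 * P 1 q))"
      unfolding y0_def y1_def by (simp add: algebra_simps)
    show ?thesis
      unfolding a h X_def[symmetric] br_def y2_def y3_def l1_def l1'_def l0_def by (simp add: algebra_simps)
  qed
  show thesis
  proof (rule that[OF C(1)])
    fix u' v' x' t' N' P' Pt'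
    assume "(u', v', x') \<in> jetset s M c K" "x' \<le> 1" "0 \<le> t'" "1 \<le> N'"
     "\<bar>u' 0 - A * x' ^ 3\<bar> \<le> K * (x' + t') * x' ^ 3" "\<bar>u' 1 - 3 * A * x' ^ 2\<bar> \<le> K * (x' + t') * x' ^ 2"
     "\<And>j. j \<le> 3 \<Longrightarrow> \<bar>P' j\<bar> \<le> C0 * N' ^ j" "\<bar>Pt' + A * P' 3\<bar> \<le> C0 * N'"
    then have q: "((u', v', x'), (t', N'), (P', Pt')) \<in> S" (is "?q \<in> S") by (simp add: S_def)
    have e: "v ?q = v'" "x ?q = x'" "t ?q = t'" "N ?q = N'" "Pt ?q = Pt'" "\<And>k. Q k ?q = wq \<gamma> P' k"
      by (simp_all add: v_def x_def t_def N_def Pt_def Q_def P_def)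
    have "\<bar>x' powr \<gamma> * Pt' + adj \<alpha> \<mu> m u' v' (\<lambda>k. x' powr (\<gamma> - real k) * wq \<gamma> P' k)\<bar> = x' powr \<gamma> * \<bar>br ?q\<bar>"
      using eq[OF q] unfolding e by (simp add: abs_mult)
    also have "\<dots> \<le> x' powr \<gamma> * (C * \<bar>g ?q\<bar>)"
      by (intro mult_left_mono C(2)[OF q]) auto
    also have "\<bar>g ?q\<bar> = N' + (x' + t') * N' ^ 3"
    proof -
      have "0 \<le> (x' + t') * N' ^ 3" "0 \<le> N'" using S(2,4,5)[OF q] unfolding e by simp_all
      then show ?thesis unfolding g_def e by simp
    qed
    finally show "\<bar>x' powr (\<alpha> - 2) * Pt' + adj \<alpha> \<mu> m u' v' (\<lambda>k. x' powr (\<alpha> - 2 - real k) * wq (\<alpha> - 2) P' k)\<bar>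
       \<le> C * x' powr (\<alpha> - 2) * (N' + (x' + t') * N' ^ 3)"
      by (simp add: \<gamma>_def mult_ac)
  qed
qed

section \<open>The duality estimate\<close>

lemma integral_abs_le_supported:
  fixes f h :: "real \<Rightarrow> real"
  assumes f: "f integrable_on {a..b}" and h: "h integrable_on {a..b}"
    and le: "\<And>x. x \<in> {a..b} \<Longrightarrow> \<bar>f x\<bar> \<le> h x + (if x \<in> {l..r} then B else 0)"
    and B: "B \<ge> 0" and lr: "l \<le> r"
  shows "\<bar>integral {a..b} f\<bar> \<le> integral {a..b} h + B * (r - l)"
proof -
  define g where "g x = (if x \<in> {l..r} then B else 0)" for x
  have gU: "(g has_integral B * (r - l)) UNIV"
    unfolding g_def has_integral_restrict_UNIV using has_integral_const_real[of B l r] lr by (simp add: mult.commute)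
  have gi: "g integrable_on {a..b}"
    by (rule integrable_on_subinterval[of g UNIV]) (use gU in auto)
  have "integral {a..b} g \<le> integral UNIV g"
    by (rule integral_subset_le) (use gi gU B in \<open>auto simp: g_def\<close>)
  also have "\<dots> = B * (r - l)" using gU by (rule integral_unique)
  finally have gB: "integral {a..b} g \<le> B * (r - l)" .
  have "norm (integral {a..b} f) \<le> integral {a..b} (\<lambda>x. h x + g x)"
    by (rule integral_norm_bound_integral[OF f integrable_add[OF h gi]]) (use le in \<open>auto simp: g_def\<close>)
  also have "\<dots> = integral {a..b} h + integral {a..b} g" by (rule integral_add[OF h gi])
  finally show ?thesis using gB by simp
qed

lemma powr_le_near:
  fixes x L r :: real
  assumes "0 < L" "L * exp (- 1) \<le> x" "x \<le> L * exp 1"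
  shows "x powr r \<le> exp \<bar>r\<bar> * L powr r"
proof -
  have "0 < L * exp (- 1)" using assms by simp
  then have x: "0 < x" using assms by linarith
  have "L * exp (- 1) = exp (ln L - 1)" "L * exp 1 = exp (ln L + 1)" using assms(1) by (simp_all add: exp_diff exp_add exp_minus divide_inverse)
  then have "ln L - 1 \<le> ln x" "ln x \<le> ln L + 1"
    using assms(2,3) x by (metis exp_le_cancel_iff exp_ln)+
  then have "\<bar>ln x - ln L\<bar> \<le> 1" by linarith
  then have "\<bar>r\<bar> * \<bar>ln x - ln L\<bar> \<le> \<bar>r\<bar>" by (metis abs_ge_zero mult.right_neutral mult_left_mono)
  then have "r * (ln x - ln L) \<le> \<bar>r\<bar>" by (metis abs_le_D1 abs_mult)
  then have "r * ln x \<le> \<bar>r\<bar> + r * ln L" by (simp add: algebra_simps)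
  then show ?thesis using x assms(1) by (simp add: powr_def flip: exp_add)
qed

definition packet_t :: "real \<Rightarrow> real \<Rightarrow> (nat \<Rightarrow> real \<Rightarrow> real) \<Rightarrow> real \<Rightarrow> real \<Rightarrow> real \<Rightarrow> real \<Rightarrow> real" where
  "packet_t \<gamma> l G A N t x = x powr \<gamma> * wpt G A N t (ln x - ln l)"

definition pairing :: "real \<Rightarrow> real \<Rightarrow> (nat \<Rightarrow> real \<Rightarrow> real) \<Rightarrow> real \<Rightarrow> real \<Rightarrow>
    (nat \<Rightarrow> real \<Rightarrow> real \<Rightarrow> real) \<Rightarrow> (nat \<Rightarrow> real \<Rightarrow> real \<Rightarrow> real) \<Rightarrow> real \<Rightarrow> real \<Rightarrow> real" where
  "pairing \<gamma> l G A N U V \<rho> t = integral {\<rho>..pi - \<rho>} (\<lambda>x. packet \<gamma> l G A N 0 t x * (U 0 t x - V 0 t x))"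

text \<open>In ln x the packet keeps its width and moves left with speed
  \<open>3 * A * N ^ 2\<close>; in x it lives within a factor e of a centre that shrinks
  exponentially in time.\<close>

lemma packet_support:
  assumes G: "bump_jet G B" and N: "N \<ge> 1" and A: "A > 0" and l: "l > 0" and x: "x > 0"
    and out: "x \<notin> {l * exp (- (3 * A * N ^ 2 * t)) * exp (- 1)<..<l * exp (- (3 * A * N ^ 2 * t)) * exp 1}"
  shows "packet \<gamma> l G A N k t x = 0" and "packet_t \<gamma> l G A N t x = 0"
proof -
  define L where "L = l * exp (- (3 * A * N ^ 2 * t))"
  have L: "L > 0" using l by (simp add: L_def)
  have lnL: "ln L = ln l - 3 * A * N ^ 2 * t" using l by (simp add: L_def ln_mult)
  have "\<bar>(ln x - ln l) + 3 * A * N ^ 2 * t\<bar> \<ge> 1"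
  proof (rule ccontr)
    assume "\<not> ?thesis"
    then have "ln L - 1 < ln x" "ln x < ln L + 1" using lnL by linarith+
    then have "exp (ln L - 1) < x" "x < exp (ln L + 1)" using x by (metis exp_less_cancel_iff exp_ln)+
    moreover have "exp (ln L - 1) = L * exp (- 1)" "exp (ln L + 1) = L * exp 1"
      using L by (simp_all add: exp_diff exp_add exp_minus divide_inverse)
    ultimately show False using out unfolding L_def[symmetric] by simp
  qed
  note z = wpk_bounds(3)[OF G N A this] wpk_bounds(4)[OF G N A this]
  have "wq \<gamma> (\<lambda>j. wpk G A N j t (ln x - ln l)) k = 0" by (simp add: wq_def z)
  then show "packet \<gamma> l G A N k t x = 0" by (simp add: packet_def)
  show "packet_t \<gamma> l G A N t x = 0" by (simp add: packet_t_def z)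
qed

lemma packet_continuous:
  assumes G: "bump_jet G B" and X: "\<And>q. q \<in> X \<Longrightarrow> 0 < snd q"
  shows "continuous_on X (\<lambda>q. packet \<gamma> l G A N 0 (fst q) (snd q))"
    and "continuous_on X (\<lambda>q. packet_t \<gamma> l G A N (fst q) (snd q))"
proof -
  have cG: "continuous_on UNIV (G k)" if "k \<le> 2" for k
    using G that by (auto simp: bump_jet_def intro!: continuous_at_imp_continuous_on DERIV_isCont)
  have cf: "continuous_on X (\<lambda>q. G k (f q))" if "k \<le> 2" "continuous_on X f" for k f
    using continuous_on_compose2[OF cG[OF that(1)] that(2)] by auto
  have cln: "continuous_on X (\<lambda>q. ln (snd q))"
    by (intro continuous_on_ln continuous_on_snd continuous_on_id) (use X in force)
  have cpw: "continuous_on X (\<lambda>q. snd q powr r)" for r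
    by (intro continuous_on_powr continuous_on_snd continuous_on_id continuous_on_const) (use X in force)
  show "continuous_on X (\<lambda>q. packet \<gamma> l G A N 0 (fst q) (snd q))"
    unfolding packet_def wq_def wpk_def Let_def
    by (simp, intro continuous_on_mult cpw cf continuous_on_cos continuous_on_add continuous_on_diff cln
        continuous_on_const continuous_on_fst continuous_on_id) auto
  show "continuous_on X (\<lambda>q. packet_t \<gamma> l G A N (fst q) (snd q))"
    unfolding packet_t_def wpt_def Let_def
    by (intro continuous_on_mult cpw cf continuous_on_cos continuous_on_sin continuous_on_add continuous_on_diff cln
        continuous_on_const continuous_on_fst continuous_on_id) auto
qed

text \<open>The pairing changes slowly: the adjoint error is at most a multiple of x powr \<gamma>
  times \<open>N + (3 * l + T) * N ^ 3\<close>, and weighing it against the energy gives a rate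
  proportional to \<open>sqrt Y\<close>. At time \<open>T\<close> the packet has arrived so close to
  0 that the flatness K x^s of the difference bounds the pairing by a power \<gamma> + s + 1 = s +
  \<alpha> - 1 of its position.\<close>

lemma testing_estimate:
  assumes m: "m \<ge> 2" and s: "s \<ge> 6" and c: "c > 0" and t0: "t0 > 0" and A: "A > 0" and K: "K \<ge> 0" and G: "bump_jet G B"
  obtains C where "C > 0" "\<And>U V \<rho> l N T Y. classical \<alpha> \<mu> m s M t0 U \<Longrightarrow> classical \<alpha> \<mu> m s M t0 V \<Longrightarrow>
      good_pair s A c K t0 U V \<Longrightarrow> 0 < \<rho> \<Longrightarrow> \<rho> < pi / 2 \<Longrightarrow> 1 \<le> N \<Longrightarrow> 0 < l \<Longrightarrow> 3 * l \<le> 1 \<Longrightarrow> 0 \<le> T \<Longrightarrow> T \<le> t0 \<Longrightarrow>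
      \<rho> \<le> l * exp (- (3 * A * N ^ 2 * T)) * exp (- 1) \<Longrightarrow> 0 < Y \<Longrightarrow>
      energy \<alpha> U V \<rho> 0 + \<rho> powr (2 * (real s + \<alpha> - 1)) \<le> Y \<Longrightarrow>
      \<bar>pairing (\<alpha> - 2) l G A N U V \<rho> 0\<bar> \<le> C * (l * exp (- (3 * A * N ^ 2 * T))) powr (real s + \<alpha> - 1)
        + C * T * (N + (3 * l + T) * N ^ 3) * sqrt Y"
proof -
  have B0: "0 \<le> B" using G abs_ge_zero[of "G 0 0"] unfolding bump_jet_def by (meson order_trans le0)
  define C0 where "C0 = 8 * B * (1 + A)"
  define \<gamma> where "\<gamma> = \<alpha> - 2"
  obtain CE where CE: "CE > 0" "\<And>U V \<rho> t. classical \<alpha> \<mu> m s M t0 U \<Longrightarrow> classical \<alpha> \<mu> m s M t0 V \<Longrightarrow>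
      good_pair s A c K t0 U V \<Longrightarrow> 0 < \<rho> \<Longrightarrow> \<rho> < pi / 2 \<Longrightarrow> t \<in> {0..t0} \<Longrightarrow>
      energy \<alpha> U V \<rho> t \<le> CE * (energy \<alpha> U V \<rho> 0 + \<rho> powr (2 * (real s + \<alpha> - 1)))"
    by (rule energy_estimate[OF m s c t0, of \<alpha> \<mu> M A K]) blast
  obtain C1 where C1: "C1 > 0" "\<And>u v x t N P Pt. (u, v, x) \<in> jetset s M c K \<Longrightarrow> x \<le> 1 \<Longrightarrow> 0 \<le> t \<Longrightarrow> 1 \<le> N \<Longrightarrow>
     \<bar>u 0 - A * x ^ 3\<bar> \<le> K * (x + t) * x ^ 3 \<Longrightarrow> \<bar>u 1 - 3 * A * x ^ 2\<bar> \<le> K * (x + t) * x ^ 2 \<Longrightarrow>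
     (\<And>j. j \<le> 3 \<Longrightarrow> \<bar>P j\<bar> \<le> C0 * N ^ j) \<Longrightarrow> \<bar>Pt + A * P 3\<bar> \<le> C0 * N \<Longrightarrow>
     \<bar>x powr \<gamma> * Pt + adj \<alpha> \<mu> m u v (\<lambda>k. x powr (\<gamma> - real k) * wq \<gamma> P k)\<bar>
       \<le> C1 * x powr \<gamma> * (N + (x + t) * N ^ 3)"
    unfolding \<gamma>_def by (rule adj_bound[OF m s c, where ?C0.0 = C0 and A = A and K = K and M = M and \<alpha> = \<alpha> and \<mu> = \<mu>]) blast
  obtain C2 where C2: "C2 > 0" "\<And>q. q \<in> jetset s M c K \<Longrightarrow> \<bar>fst q 0 powr (1 - 2 * \<alpha> / 3)\<bar> \<le> C2 * \<bar>snd (snd q) powr (3 * (1 - 2 * \<alpha> / 3))\<bar>"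
    using jetset_bounds(6)[OF m s c, where M = M and K = K and r = "1 - 2 * \<alpha> / 3"] by (rule domE) blast
  \<comment> \<open>\<open>B\<close> bounds the profile and \<open>K\<close> the flatness, the
    exponential is the variation of a power across the support, and 3, an upper bound for e, is its
    length relative to the position.\<close>
  define C3 where "C3 = B * K * exp \<bar>\<gamma> + real s\<bar> * 3"
  \<comment> \<open>\<open>CE\<close> belongs to the energy term. The 9 bounds e^2, the ratio of the
    two ends of the support.\<close>
  define C4 where "C4 = CE + 9 * (C1 ^ 2 * C2)"
  show thesis
  proof (rule that[of "C3 + C4"])
    have C3: "0 \<le> C3" using B0 K by (simp add: C3_def)
    have C4: "0 < C4" using CE(1) C1(1) C2(1) by (simp add: C4_def add_pos_pos)
    show "0 < C3 + C4" using C3 C4 by simp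
    fix U V \<rho> l N T Y
    assume cU: "classical \<alpha> \<mu> m s M t0 U" and cV: "classical \<alpha> \<mu> m s M t0 V"
      and good: "good_pair s A c K t0 U V" and \<rho>: "0 < \<rho>" "\<rho> < pi / 2" and N: "1 \<le> N" and l: "0 < l" "3 * l \<le> 1"
      and T: "0 \<le> T" "T \<le> t0" and \<rho>l: "\<rho> \<le> l * exp (- (3 * A * N ^ 2 * T)) * exp (- 1)" and Y: "0 < Y"
      and EY: "energy \<alpha> U V \<rho> 0 + \<rho> powr (2 * (real s + \<alpha> - 1)) \<le> Y"
    define L where "L t = l * exp (- (3 * A * N ^ 2 * t))" for t
    define I where "I = {\<rho>..pi - \<rho>}"
    \<comment> \<open>The size of the adjoint error relative to x powr \<gamma>: at all times up to
      \<open>T\<close> the support lies in \<open>x \<le> 3 * l\<close>.\<close>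
    define R where "R = N + (3 * l + T) * N ^ 3"
    have R: "R > 0" using N l T by (auto simp: R_def intro!: add_pos_nonneg)
    have L: "0 < L t" "L t \<le> l" if "0 \<le> t" for t using l A that by (auto simp: L_def mult_le_cancel_left1)
    have e3: "exp 1 \<le> (3::real)" by (rule exp_le)
    have Lle: "L t * exp 1 \<le> 3 * l" if "0 \<le> t" for t
      using mult_mono[OF L(2)[OF that] e3] l by (simp add: mult.commute)
    have LT: "L T \<le> L t" if "t \<le> T" for t using that A l by (auto simp: L_def intro!: mult_left_mono)
    have h_pi: "1 \<le> pi / 2" using pi_gt3 by simp
    have I: "0 < x" "x < pi" if "x \<in> I" for x using that \<rho> by (auto simp: I_def)
    define f where "f k t x = packet \<gamma> l G A N k t x" for k t x
    define ft where "ft t x = packet_t \<gamma> l G A N t x" for t x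
    define W where "W t x = U 0 t x - V 0 t x" for t x
    have supp: "f k t x = 0" "ft t x = 0" if "0 < x" "x \<notin> {L t * exp (- 1)<..<L t * exp 1}" for k t x
      using packet_support[OF G N A l(1) that(1)] that(2) unfolding f_def ft_def L_def by blast+
    have cf: "continuous_on ({0..t0} \<times> I) (\<lambda>q. f 0 (fst q) (snd q))" "continuous_on ({0..t0} \<times> I) (\<lambda>q. ft (fst q) (snd q))"
      unfolding f_def ft_def by (rule packet_continuous[OF G]; use I in force)+
    have cu: "continuous_on ({0..t0} \<times> I) (\<lambda>q. U k (fst q) (snd q))"
      and cv: "continuous_on ({0..t0} \<times> I) (\<lambda>q. V k (fst q) (snd q))" if "k \<le> 3" for k
      by (rule continuous_on_subset[OF classicalD(1)[OF cU]] continuous_on_subset[OF classicalD(1)[OF cV]]; use that s in auto)+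
    have pos: "0 < U 0 t x" if "t \<in> {0..t0}" "x \<in> I" for t x
      using good_pair_pos[OF good c that(1)] I[OF that(2)] by auto
    have cp: "continuous_on ({0..t0} \<times> I) (\<lambda>q. U 0 (fst q) (snd q) powr r)" for r
    proof (intro continuous_on_powr continuous_on_const cu ballI)
      fix q assume "q \<in> {0..t0} \<times> I"
      then show "U 0 (fst q) (snd q) \<noteq> 0" using pos[of "fst q" "snd q"] by (auto simp: mem_Times_iff)
    qed simp
    define Jd where "Jd t x = ft t x * W t x + f 0 t x * (Nl \<alpha> \<mu> m (\<lambda>k. V k t x) - Nl \<alpha> \<mu> m (\<lambda>k. U k t x))" for t x
    have cJ: "continuous_on ({0..t0} \<times> I) (\<lambda>q. f 0 (fst q) (snd q) * W (fst q) (snd q))"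
      "continuous_on ({0..t0} \<times> I) (\<lambda>q. Jd (fst q) (snd q))"
      unfolding Jd_def W_def Nl_def
      by (intro continuous_on_add continuous_on_diff continuous_on_mult continuous_on_power continuous_on_const cf cu cv; simp)+
    have ce: "continuous_on ({0..t0} \<times> I) (\<lambda>q. U 0 (fst q) (snd q) powr (2 * \<alpha> / 3 - 1) * W (fst q) (snd q) ^ 2)"
      unfolding W_def by (intro continuous_on_diff continuous_on_mult continuous_on_power cp cu cv) auto
    have sl: "g t integrable_on I" if "continuous_on ({0..t0} \<times> I) (\<lambda>q. g (fst q) (snd q))" "t \<in> {0..t0}"
      for g :: "real \<Rightarrow> real \<Rightarrow> real" and t
    proof -
      have "continuous_on I (\<lambda>x. (t, x))" by (intro continuous_intros)
      from continuous_on_compose2[OF that(1) this] have "continuous_on I (g t)" using that(2) by force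
      then show ?thesis unfolding I_def by (rule integrable_continuous_interval)
    qed
    define J where "J t = integral I (\<lambda>x. f 0 t x * W t x)" for t
    have der: "(J has_real_derivative integral I (Jd t)) (at t within {0..t0})" if t: "t \<in> {0..t0}" for t
    proof -
      have "((\<lambda>t. integral (cbox \<rho> (pi - \<rho>)) (\<lambda>x. f 0 t x * W t x)) has_field_derivative integral (cbox \<rho> (pi - \<rho>)) (\<lambda>x. Jd t x)) (at t within {0..t0})"
      proof (rule leibniz_rule_field_derivative)
        show "((\<lambda>t. f 0 t x * W t x) has_field_derivative Jd t x) (at t within {0..t0})"
          if "t \<in> {0..t0}" "x \<in> cbox \<rho> (pi - \<rho>)" for t x
        proof -
          have "((\<lambda>t. f 0 t x) has_real_derivative ft t x) (at t)"
            unfolding f_def ft_def packet_def packet_t_def wq_def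
            using DERIV_cmult[OF wpk_derivative(2)[OF G], of "x powr \<gamma>"] by simp
          then have 1: "((\<lambda>t. f 0 t x) has_real_derivative ft t x) (at t within {0..t0})"
            by (rule has_field_derivative_at_within)
          have 2: "((\<lambda>t. W t x) has_real_derivative - Nl \<alpha> \<mu> m (\<lambda>k. U k t x) - - Nl \<alpha> \<mu> m (\<lambda>k. V k t x)) (at t within {0..t0})"
            unfolding W_def by (intro DERIV_diff classical_time_derivative[OF cU s that(1)] classical_time_derivative[OF cV s that(1)])
          show ?thesis using DERIV_mult[OF 1 2] by (rule DERIV_cong) (simp add: Jd_def algebra_simps)
        qed
        show "(\<lambda>x. f 0 t x * W t x) integrable_on cbox \<rho> (pi - \<rho>)" if "t \<in> {0..t0}" for t
          using sl[of "\<lambda>t x. f 0 t x * W t x", OF cJ(1) that] by (simp add: I_def)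
        show "continuous_on ({0..t0} \<times> cbox \<rho> (pi - \<rho>)) (\<lambda>(t, x). Jd t x)"
          using cJ(2) by (simp add: split_def I_def)
      qed (use t in auto)
      then show ?thesis by (simp add: J_def[abs_def] I_def)
    qed
    have bound: "\<bar>integral I (Jd t)\<bar> \<le> C4 * R * sqrt Y" if t: "0 \<le> t" "t \<le> T" for t
    proof -
      have t': "t \<in> {0..t0}" using t T by auto
      define e where "e x = ft t x + adj \<alpha> \<mu> m (\<lambda>k. U k t x) (\<lambda>k. V k t x) (\<lambda>k. f k t x)" for x
      define TF where "TF x = tflux \<alpha> \<mu> m (\<lambda>k. U k t x) (\<lambda>k. V k t x) (\<lambda>k. f k t x)" for x
      have "((\<lambda>x. e x * W t x - Jd t x) has_integral (TF (pi - \<rho>) - TF \<rho>)) I"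
        unfolding I_def
      proof (rule fundamental_theorem_of_calculus)
        fix x assume x: "x \<in> {\<rho>..pi - \<rho>}"
        have "(TF has_real_derivative
           f 0 t x * (Nl \<alpha> \<mu> m (\<lambda>k. U k t x) - Nl \<alpha> \<mu> m (\<lambda>k. V k t x))
           + adj \<alpha> \<mu> m (\<lambda>k. U k t x) (\<lambda>k. V k t x) (\<lambda>k. f k t x) * (U 0 t x - V 0 t x)) (at x)"
          unfolding TF_def
        proof (rule tflux_derivative[where u = "\<lambda>k. U k t" and v = "\<lambda>k. V k t" and f = "\<lambda>k. f k t"])
          show "(f k t has_real_derivative f (Suc k) t x) (at x)" if "k \<le> 2" for k
            unfolding f_def[abs_def] by (rule packet_derivative[OF G _ that]) (use x \<rho> in auto)
        qed (use classicalD(4)[OF cU] classicalD(4)[OF cV] t' s in auto)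
        then have "(TF has_real_derivative e x * W t x - Jd t x) (at x)"
          by (rule DERIV_cong) (simp add: e_def Jd_def W_def algebra_simps)
        then show "(TF has_vector_derivative e x * W t x - Jd t x) (at x within {\<rho>..pi - \<rho>})"
          by (simp add: has_real_derivative_iff_has_vector_derivative has_vector_derivative_at_within)
      qed (use \<rho> in auto)
      \<comment> \<open>Up to time \<open>T\<close> the support stays to the right of
        \<open>\<rho>\<close> and to the left of \<open>pi - \<rho>\<close>, so integration by parts
        produces no boundary terms.\<close>
      moreover have "TF \<rho> = 0"
      proof -
        have "\<rho> \<le> L t * exp (- 1)" using \<rho>l LT[OF t(2)] unfolding L_def[symmetric] by (smt (verit) exp_gt_zero mult_right_mono)
        then have "f k t \<rho> = 0" for k using supp(1)[OF \<rho>(1)] by simp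
        then show ?thesis by (simp add: TF_def tflux_def)
      qed
      moreover have "TF (pi - \<rho>) = 0"
      proof -
        have "L t * exp 1 \<le> pi - \<rho>" using Lle[OF t(1)] l \<rho> h_pi by linarith
        then have "f k t (pi - \<rho>) = 0" for k using supp(1)[of "pi - \<rho>" t k] \<rho> by simp
        then show ?thesis by (simp add: TF_def tflux_def)
      qed
      ultimately have 0: "((\<lambda>x. e x * W t x - Jd t x) has_integral 0) I" by simp
      have eW: "((\<lambda>x. e x * W t x) has_integral integral I (Jd t)) I"
        using has_integral_add[OF 0 integrable_integral[OF sl[OF cJ(2) t']]] by simp
      \<comment> \<open>Balances the two parts of Young's inequality: \<open>\<eta>\<close> times
        the energy and \<open>R ^ 2 / \<eta>\<close> both become multiples of
        \<open>R * sqrt Y\<close>.\<close>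
      define \<eta> where "\<eta> = R / sqrt Y"
      have \<eta>: "\<eta> > 0" using R Y by (simp add: \<eta>_def)
      \<comment> \<open>A pointwise bound for the error part of Young's inequality, with 1 / x
        replaced by its value at the left end of the support. Multiplied by the length of the
        support it no longer depends on \<open>L t\<close>.\<close>
      define D where "D = C1 ^ 2 * C2 * R ^ 2 / (\<eta> * (L t * exp (- 1)))"
      have D0: "0 \<le> D" using C1(1) C2(1) \<eta> L(1)[OF t(1)] by (simp add: D_def)
      have pw: "\<bar>e x * W t x\<bar> \<le> \<eta> * (U 0 t x powr (2 * \<alpha> / 3 - 1) * W t x ^ 2)
          + (if x \<in> {L t * exp (- 1)..L t * exp 1} then D else 0)" if x: "x \<in> I" for x
      proof (cases "x \<in> {L t * exp (- 1)<..<L t * exp 1}")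
        case False
        then have "e x = 0" using supp[OF I(1)[OF x] False] by (simp add: e_def adj_def)
        then show ?thesis using \<eta> D0 by simp
      next
        case True
        define p where "p = U 0 t x powr (2 * \<alpha> / 3 - 1)"
        have U0: "U 0 t x > 0" by (rule pos[OF t' x])
        have p: "p > 0" using U0 by (simp add: p_def)
        have x0: "0 < x" "x < pi" using I[OF x] by auto
        have x3: "x \<le> 3 * l" using True Lle[OF t(1)] by auto
        have x1: "x \<le> 1" using x3 l by simp
        have dx: "dpi x = x" using x1 h_pi by (simp add: dpi_def min_def)
        note js = good_pair_jetset[OF s cU cV good t' x0, unfolded dx]
        have xpi: "x \<in> {0..pi}" using x0 by simp
        note gp = good[unfolded good_pair_def, rule_format, OF t' xpi]
        have "\<bar>x powr \<gamma> * wpt G A N t (ln x - ln l) + adj \<alpha> \<mu> m (\<lambda>k. U k t x) (\<lambda>k. V k t x)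
            (\<lambda>k. x powr (\<gamma> - real k) * wq \<gamma> (\<lambda>j. wpk G A N j t (ln x - ln l)) k)\<bar>
           \<le> C1 * x powr \<gamma> * (N + (x + t) * N ^ 3)"
          by (rule C1(2)[OF js x1 t(1) N]) (use gp x1 wpk_bounds(1,2)[OF G N A] in \<open>auto simp: C0_def\<close>)
        then have "\<bar>e x\<bar> \<le> C1 * x powr \<gamma> * (N + (x + t) * N ^ 3)"
          unfolding e_def ft_def f_def packet_def packet_t_def .
        also have "\<dots> \<le> C1 * x powr \<gamma> * R"
          unfolding R_def using x3 t N C1(1) by (intro mult_left_mono add_left_mono mult_right_mono) auto
        finally have eb: "\<bar>e x\<bar> \<le> C1 * x powr \<gamma> * R" .
        have "e x ^ 2 \<le> (C1 * x powr \<gamma> * R) ^ 2"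
          using eb by (metis abs_ge_zero power2_abs power_mono)
        also have "\<dots> = C1 ^ 2 * R ^ 2 * x powr (2 * \<gamma>)"
        proof -
          have "(x powr \<gamma>) ^ 2 = x powr (2 * \<gamma>)" unfolding power2_eq_square mult_2 powr_add ..
          then show ?thesis by (simp add: power_mult_distrib mult_ac)
        qed
        finally have e2: "e x ^ 2 \<le> C1 ^ 2 * R ^ 2 * x powr (2 * \<gamma>)" .
        have ip: "1 / p \<le> C2 * x powr (3 * (1 - 2 * \<alpha> / 3))"
        proof -
          have "1 / p = U 0 t x powr (1 - 2 * \<alpha> / 3)"
            by (simp add: p_def powr_minus_divide[symmetric])
          then show ?thesis using C2(2)[OF js] by simp
        qed
        have "e x ^ 2 / p = e x ^ 2 * (1 / p)" by simp
        also have "\<dots> \<le> (C1 ^ 2 * R ^ 2 * x powr (2 * \<gamma>)) * (C2 * x powr (3 * (1 - 2 * \<alpha> / 3)))"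
          by (rule mult_mono[OF e2 ip]) (use p in simp_all)
        also have "\<dots> = C1 ^ 2 * C2 * R ^ 2 * x powr (2 * \<gamma> + 3 * (1 - 2 * \<alpha> / 3))"
          by (simp add: powr_add mult_ac)
        also have "2 * \<gamma> + 3 * (1 - 2 * \<alpha> / 3) = - 1" by (simp add: \<gamma>_def algebra_simps)
        also have "C1 ^ 2 * C2 * R ^ 2 * x powr - 1 \<le> C1 ^ 2 * C2 * R ^ 2 * (1 / (L t * exp (- 1)))"
        proof (rule mult_left_mono)
          show "x powr - 1 \<le> 1 / (L t * exp (- 1))"
            using True L(1)[OF t(1)] x0 by (simp add: powr_minus_divide frac_le)
        qed (use C2(1) in auto)
        finally have ep: "e x ^ 2 / p \<le> C1 ^ 2 * C2 * R ^ 2 / (L t * exp (- 1))" by simp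
        have "e x ^ 2 / (\<eta> * p) = (e x ^ 2 / p) / \<eta>" by simp
        also have "\<dots> \<le> (C1 ^ 2 * C2 * R ^ 2 / (L t * exp (- 1))) / \<eta>" using ep \<eta> by (intro divide_right_mono) auto
        also have "\<dots> = D" by (simp add: D_def)
        finally have eD: "e x ^ 2 / (\<eta> * p) \<le> D" .
        \<comment> \<open>Young's inequality, from the square of
          \<open>\<bar>e x\<bar> / r - r * \<bar>W t x\<bar>\<close>. The factor 2 is then given
          away.\<close>
        have "2 * \<bar>e x * W t x\<bar> \<le> e x ^ 2 / (\<eta> * p) + \<eta> * p * W t x ^ 2"
        proof -
          define r where "r = sqrt (\<eta> * p)"
          have r: "r > 0" "r ^ 2 = \<eta> * p" using \<eta> p by (auto simp: r_def)
          have "0 \<le> (\<bar>e x\<bar> / r - r * \<bar>W t x\<bar>) ^ 2" by simp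
          also have "\<dots> = e x ^ 2 / r ^ 2 + r ^ 2 * W t x ^ 2 - 2 * \<bar>e x * W t x\<bar>"
            using r(1) by (simp add: power2_diff power_divide power_mult_distrib abs_mult)
          finally show ?thesis by (simp add: r(2))
        qed
        moreover have "0 \<le> \<eta> * p * W t x ^ 2" "0 \<le> e x ^ 2 / (\<eta> * p)" using \<eta> p by auto
        ultimately have "\<bar>e x * W t x\<bar> \<le> \<eta> * p * W t x ^ 2 + e x ^ 2 / (\<eta> * p)" by linarith
        then show ?thesis using eD True by (auto simp: p_def mult_ac)
      qed
      have "\<bar>integral I (\<lambda>x. e x * W t x)\<bar> \<le> integral I (\<lambda>x. \<eta> * (U 0 t x powr (2 * \<alpha> / 3 - 1) * W t x ^ 2)) + D * (L t * exp 1 - L t * exp (- 1))"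
        unfolding I_def
      proof (rule integral_abs_le_supported)
        show "(\<lambda>x. e x * W t x) integrable_on {\<rho>..pi - \<rho>}" using eW by (auto simp: I_def)
        show "(\<lambda>x. \<eta> * (U 0 t x powr (2 * \<alpha> / 3 - 1) * W t x ^ 2)) integrable_on {\<rho>..pi - \<rho>}"
          using integrable_on_mult_right[OF sl[of "\<lambda>t x. U 0 t x powr (2 * \<alpha> / 3 - 1) * W t x ^ 2", OF ce t']] by (simp add: I_def)
        show "L t * exp (- 1) \<le> L t * exp 1" using L(1)[OF t(1)] by simp
      qed (use pw D0 in \<open>auto simp: I_def\<close>)
      also have "integral I (\<lambda>x. \<eta> * (U 0 t x powr (2 * \<alpha> / 3 - 1) * W t x ^ 2)) = \<eta> * energy \<alpha> U V \<rho> t"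
        by (simp add: energy_def I_def W_def)
      also have "integral I (\<lambda>x. e x * W t x) = integral I (Jd t)" using eW by (rule integral_unique)
      also have "\<eta> * energy \<alpha> U V \<rho> t + D * (L t * exp 1 - L t * exp (- 1)) \<le> C4 * R * sqrt Y"
      proof -
        have "energy \<alpha> U V \<rho> t \<le> CE * Y"
          using CE(2)[OF cU cV good \<rho> t'] mult_left_mono[OF EY, of CE] CE(1) by linarith
        then have "\<eta> * energy \<alpha> U V \<rho> t \<le> \<eta> * (CE * Y)" using \<eta> by (intro mult_left_mono) auto
        also have "\<dots> = CE * R * sqrt Y" using Y by (simp add: \<eta>_def real_div_sqrt field_simps)
        finally have 1: "\<eta> * energy \<alpha> U V \<rho> t \<le> CE * R * sqrt Y" .
        have "L t * exp 1 - L t * exp (- 1) \<le> 9 * (L t * exp (- 1))"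
        proof -
          have "exp 1 * exp 1 \<le> 3 * (3::real)" using e3 by (intro mult_mono) auto
          then have "exp 1 \<le> 9 * exp (- 1 :: real)" by (simp add: exp_minus field_simps)
          then have "L t * exp 1 \<le> L t * (9 * exp (- 1))" using L(1)[OF t(1)] by (intro mult_left_mono) auto
          moreover have "0 \<le> L t * exp (- 1)" using L(1)[OF t(1)] by simp
          ultimately show ?thesis by linarith
        qed
        then have "D * (L t * exp 1 - L t * exp (- 1)) \<le> D * (9 * (L t * exp (- 1)))"
          using D0 by (intro mult_left_mono) auto
        also have "\<dots> = 9 * (C1 ^ 2 * C2) * R ^ 2 / \<eta>" using L(1)[OF t(1)] by (simp add: D_def)
        also have "\<dots> = 9 * (C1 ^ 2 * C2) * R * sqrt Y" using R Y by (simp add: \<eta>_def power2_eq_square)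
        finally show ?thesis using 1 by (simp add: C4_def algebra_simps)
      qed
      finally show ?thesis by simp
    qed
    have "norm (J 0 - J T) \<le> (C4 * R * sqrt Y) * norm (0 - T)"
    proof (rule field_differentiable_bound[of "{0..T}" J "\<lambda>t. integral I (Jd t)"])
      show "(J has_field_derivative integral I (Jd t)) (at t within {0..T})" if "t \<in> {0..T}" for t
        by (rule has_field_derivative_subset[OF der]) (use that T in auto)
    qed (use bound T in auto)
    then have dJ: "\<bar>J 0\<bar> \<le> \<bar>J T\<bar> + C4 * T * R * sqrt Y" using T by (simp add: mult_ac)
    define \<sigma> where "\<sigma> = real s + \<alpha> - 1"
    have JT: "\<bar>J T\<bar> \<le> C3 * L T powr \<sigma>"
    proof -
      have T': "T \<in> {0..t0}" using T by auto
      define D where "D = B * K * (exp \<bar>\<gamma> + real s\<bar> * L T powr (\<gamma> + real s))"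
      have D0: "0 \<le> D" using B0 K by (simp add: D_def)
      have "\<bar>integral I (\<lambda>x. f 0 T x * W T x)\<bar> \<le> integral I (\<lambda>x. 0) + D * (L T * exp 1 - L T * exp (- 1))"
        unfolding I_def
      proof (rule integral_abs_le_supported)
        show "(\<lambda>x. f 0 T x * W T x) integrable_on {\<rho>..pi - \<rho>}"
          using sl[of "\<lambda>t x. f 0 t x * W t x", OF cJ(1) T'] by (simp add: I_def)
        show "L T * exp (- 1) \<le> L T * exp 1" using L(1)[OF T(1)] by simp
        fix x assume "x \<in> {\<rho>..pi - \<rho>}"
        then have x: "x \<in> I" by (simp add: I_def)
        show "\<bar>f 0 T x * W T x\<bar> \<le> 0 + (if x \<in> {L T * exp (- 1)..L T * exp 1} then D else 0)"
        proof (cases "x \<in> {L T * exp (- 1)<..<L T * exp 1}")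
          case False
          then show ?thesis using supp(1)[OF I(1)[OF x] False, of 0] D0 by simp
        next
          case True
          have x0: "0 < x" "x < pi" using I[OF x] by auto
          have x1: "x \<le> 1" using True Lle[OF T(1)] l by auto
          have dx: "dpi x = x" using x1 h_pi by (simp add: dpi_def min_def)
          have xpi: "x \<in> {0..pi}" using x0 by simp
          have "\<bar>W T x\<bar> \<le> K * x ^ s"
            using good[unfolded good_pair_def, rule_format, OF T' xpi] unfolding W_def dx by (metis diff_zero le0)
          then have Wb: "\<bar>W T x\<bar> \<le> K * x powr real s" using x0 by (simp add: powr_realpow)
          have "\<bar>f 0 T x\<bar> \<le> B * x powr \<gamma>"
            using mult_right_mono[OF wpk_bounds(5)[OF G N A, of T "ln x - ln l"], of "x powr \<gamma>"]
            by (simp add: f_def packet_def wq_def abs_mult mult.commute)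
          then have "\<bar>f 0 T x * W T x\<bar> \<le> (B * x powr \<gamma>) * (K * x powr real s)"
            unfolding abs_mult using Wb B0 by (intro mult_mono) auto
          also have "\<dots> = B * K * x powr (\<gamma> + real s)" by (simp add: powr_add mult_ac)
          also have "\<dots> \<le> D" unfolding D_def
            using True L(1)[OF T(1)] B0 K by (intro mult_left_mono powr_le_near) auto
          finally show ?thesis using True by auto
        qed
      qed (use D0 in auto)
      also have "\<dots> \<le> D * (3 * L T)"
      proof -
        have "L T * exp 1 \<le> L T * 3" using e3 L(1)[OF T(1)] by (intro mult_left_mono) auto
        moreover have "0 \<le> L T * exp (- 1)" using L(1)[OF T(1)] by simp
        ultimately have "L T * exp 1 - L T * exp (- 1) \<le> 3 * L T" by linarith
        then show ?thesis using D0 by (simp add: mult_left_mono)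
      qed
      also have "\<dots> = C3 * (L T powr (\<gamma> + real s) * L T)" by (simp add: D_def C3_def mult_ac)
      also have "L T powr (\<gamma> + real s) * L T = L T powr (\<gamma> + real s + 1)"
        using L(1)[OF T(1)] by (simp add: powr_add)
      also have "\<gamma> + real s + 1 = \<sigma>" by (simp add: \<gamma>_def \<sigma>_def)
      finally show ?thesis by (simp add: J_def)
    qed
    have "\<bar>J 0\<bar> \<le> C3 * L T powr \<sigma> + C4 * T * R * sqrt Y" using dJ JT by linarith
    also have "\<dots> \<le> (C3 + C4) * L T powr \<sigma> + (C3 + C4) * T * R * sqrt Y"
      using C3 C4 T R Y by (intro add_mono mult_right_mono) auto
    finally show "\<bar>pairing (\<alpha> - 2) l G A N U V \<rho> 0\<bar> \<le> (C3 + C4) * (l * exp (- (3 * A * N ^ 2 * T))) powr (real s + \<alpha> - 1)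
        + (C3 + C4) * T * (N + (3 * l + T) * N ^ 3) * sqrt Y"
      by (simp add: J_def pairing_def I_def f_def W_def \<gamma>_def L_def \<sigma>_def R_def)
  qed
qed

section \<open>Smooth packets on a logarithmic scale\<close>

text \<open>The extra index makes the family closed under differentiation up to linear combinations,
  so smoothness at 0 reduces to a single limit, treated for all \<open>n\<close> at once.\<close>

definition flat :: "nat \<Rightarrow> real \<Rightarrow> real" where
  "flat n x = (if x > 0 then exp (- (1 / x)) / x ^ n else 0)"

lemma flat_derivative:
  "(flat n has_real_derivative flat (n + 2) x - real n * flat (n + 1) x) (at x)"
proof -
  consider "x > 0" | "x < 0" | "x = 0" by linarith
  then show ?thesis
  proof cases
    case 1
    have "((\<lambda>x. exp (- (1 / x)) / x ^ n) has_real_derivative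
        (exp (- (1 / x)) * (1 / x ^ 2) * x ^ n - exp (- (1 / x)) * (real n * x ^ (n - Suc 0))) / (x ^ n * x ^ n)) (at x)"
      using 1 by (auto intro!: derivative_eq_intros simp: power2_eq_square)
    moreover have "(exp (- (1 / x)) * (1 / x ^ 2) * x ^ n - exp (- (1 / x)) * (real n * x ^ (n - Suc 0))) / (x ^ n * x ^ n)
        = flat (n + 2) x - real n * flat (n + 1) x"
      using 1 by (cases n) (simp_all add: flat_def field_simps power_add power2_eq_square)
    ultimately have "((\<lambda>x. exp (- (1 / x)) / x ^ n) has_real_derivative flat (n + 2) x - real n * flat (n + 1) x) (at x)"
      by simp
    then show ?thesis
      by (rule has_field_derivative_transform_within_open[where S = "{0<..}"]) (use 1 in \<open>auto simp: flat_def\<close>)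
  next
    case 2
    have "((\<lambda>x. 0) has_real_derivative flat (n + 2) x - real n * flat (n + 1) x) (at x)"
      using 2 by (simp add: flat_def)
    then show ?thesis
      by (rule has_field_derivative_transform_within_open[where S = "{..<0}"]) (use 2 in \<open>auto simp: flat_def\<close>)
  next
    case 3
    have "((\<lambda>x. flat n x / x) \<longlongrightarrow> 0) (at_right 0)"
    proof -
      have "((\<lambda>x::real. exp (- (1 / x)) / x ^ n / x) \<longlongrightarrow> 0) (at_right 0)" by real_asymp
      then show ?thesis
        by (rule filterlim_cong[THEN iffD1, rotated -1, OF _ refl refl])
          (auto simp: flat_def eventually_at_right_less eventually_at_filter)
    qed
    moreover have "((\<lambda>x. flat n x / x) \<longlongrightarrow> 0) (at_left 0)"
      by (rule tendsto_eventually) (auto simp: flat_def eventually_at_filter)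
    ultimately have "((\<lambda>x. flat n x / x) \<longlongrightarrow> 0) (at 0)" by (rule filterlim_split_at[rotated])
    then show ?thesis using 3 by (simp add: has_field_derivative_iff flat_def)
  qed
qed

text \<open>A class closed under differentiation: membership yields the support in the unit interval
  around 0, boundedness and all derivatives without computing any of them.\<close>

inductive bumpf :: "(real \<Rightarrow> real) \<Rightarrow> bool" where
  base: "bumpf (\<lambda>z. flat n (1 - z) * flat k (1 + z))"
| add: "bumpf f \<Longrightarrow> bumpf g \<Longrightarrow> bumpf (\<lambda>z. f z + g z)"
| cmult: "bumpf f \<Longrightarrow> bumpf (\<lambda>z. c * f z)"

lemma bumpf_support: "bumpf f \<Longrightarrow> \<bar>z\<bar> \<ge> 1 \<Longrightarrow> f z = 0"
  by (induction rule: bumpf.induct) (auto simp: flat_def)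

lemma bumpf_derivative: "bumpf f \<Longrightarrow> \<exists>f'. bumpf f' \<and> (\<forall>z. (f has_real_derivative f' z) (at z))"
proof (induction rule: bumpf.induct)
  case (base n k)
  define f' where "f' z = ((- 1) * (flat (n + 2) (1 - z) * flat k (1 + z)) + real n * (flat (n + 1) (1 - z) * flat k (1 + z)))
     + (flat n (1 - z) * flat (k + 2) (1 + z) + (- real k) * (flat n (1 - z) * flat (k + 1) (1 + z)))" for z
  have "bumpf f'" unfolding f'_def by (intro bumpf.intros)
  moreover have "((\<lambda>z. flat n (1 - z) * flat k (1 + z)) has_real_derivative f' z) (at z)" for z
  proof -
    have "((\<lambda>z. 1 - z) has_real_derivative - 1) (at z)" "((\<lambda>z. 1 + z) has_real_derivative 1) (at z)"
      by (auto intro!: derivative_eq_intros)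
    from DERIV_mult[OF DERIV_chain2[OF flat_derivative[of n] this(1)] DERIV_chain2[OF flat_derivative[of k] this(2)]]
    show ?thesis by (rule DERIV_cong) (simp add: f'_def algebra_simps)
  qed
  ultimately show ?case by blast
next
  case (add f g)
  then obtain f' g' where "bumpf f'" "\<forall>z. (f has_real_derivative f' z) (at z)" "bumpf g'" "\<forall>z. (g has_real_derivative g' z) (at z)"
    by blast
  then have "bumpf (\<lambda>z. f' z + g' z)" "\<forall>z. ((\<lambda>z. f z + g z) has_real_derivative f' z + g' z) (at z)"
    by (auto intro: bumpf.add DERIV_add)
  then show ?case by blast
next
  case (cmult f c)
  then obtain f' where "bumpf f'" "\<forall>z. (f has_real_derivative f' z) (at z)" by blast
  then have "bumpf (\<lambda>z. c * f' z)" "\<forall>z. ((\<lambda>z. c * f z) has_real_derivative c * f' z) (at z)"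
    by (auto intro: bumpf.cmult DERIV_cmult)
  then show ?case by blast
qed

lemma bumpf_bounded:
  assumes "bumpf f"
  obtains B where "B > 0" "\<And>z. \<bar>f z\<bar> \<le> B"
proof -
  obtain f' where "\<forall>z. (f has_real_derivative f' z) (at z)" using bumpf_derivative[OF assms] by blast
  then have c: "continuous_on {-1..1} f" by (blast intro: continuous_at_imp_continuous_on DERIV_isCont)
  have "bounded (f ` {-1..1})"
    by (rule compact_imp_bounded[OF compact_continuous_image[OF c]]) simp
  then obtain B where B: "B > 0" "\<And>z. z \<in> {-1..1} \<Longrightarrow> \<bar>f z\<bar> \<le> B"
    unfolding bounded_pos by auto
  have "\<bar>f z\<bar> \<le> B" for z
  proof (cases "\<bar>z\<bar> \<ge> 1")
    case True
    then show ?thesis using B(1) bumpf_support[OF assms, of z] by simp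
  next
    case False
    then have "z \<in> {-1..1}" by auto
    then show ?thesis by (rule B(2))
  qed
  then show thesis using that B(1) by blast
qed

definition bump :: "real \<Rightarrow> real" where "bump z = flat 0 (1 - z) * flat 0 (1 + z)"

lemma bumpf_deriv_bump: "bumpf ((deriv ^^ k) bump)"
proof (induction k)
  case 0
  have "bump = (\<lambda>z. flat 0 (1 - z) * flat 0 (1 + z))" by (auto simp: bump_def)
  then show ?case using bumpf.base[of 0 0] by simp
next
  case (Suc k)
  then obtain f' where f': "bumpf f'" "\<forall>z. ((deriv ^^ k) bump has_real_derivative f' z) (at z)"
    using bumpf_derivative by blast
  then have "(deriv ^^ Suc k) bump = f'" by (auto intro!: ext DERIV_imp_deriv)
  then show ?case using f' by simp
qed

lemma bump_jet_bump: obtains B where "B > 0" "bump_jet (\<lambda>k. (deriv ^^ k) bump) B"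
proof -
  have d: "((deriv ^^ k) bump has_real_derivative (deriv ^^ Suc k) bump z) (at z)" for k z
  proof -
    obtain f' where "\<forall>z. ((deriv ^^ k) bump has_real_derivative f' z) (at z)"
      using bumpf_derivative[OF bumpf_deriv_bump[of k]] by blast
    then have *: "((deriv ^^ k) bump has_real_derivative f' z) (at z)" by blast
    then show ?thesis using DERIV_imp_deriv[OF *] by simp
  qed
  have "\<forall>k. \<exists>B>0. \<forall>z. \<bar>(deriv ^^ k) bump z\<bar> \<le> B"
    using bumpf_bounded[OF bumpf_deriv_bump] by metis
  then obtain b where b: "\<And>k. b k > 0" "\<And>k z. \<bar>(deriv ^^ k) bump z\<bar> \<le> b k" by metis
  define B where "B = b 0 + b 1 + b 2 + b 3"
  have "b k \<le> B" if "k \<le> 3" for k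
  proof -
    consider "k = 0" | "k = 1" | "k = 2" | "k = 3" using \<open>k \<le> 3\<close> by linarith
    then show ?thesis using b(1)[of 0] b(1)[of 1] b(1)[of 2] b(1)[of 3] by cases (auto simp: B_def)
  qed
  then have bB: "\<bar>(deriv ^^ k) bump z\<bar> \<le> B" if "k \<le> 3" for k z using b(2)[of k z] that by (meson order_trans)
  have c3: "continuous_on UNIV ((deriv ^^ 3) bump)"
    by (intro continuous_at_imp_continuous_on ballI DERIV_isCont[OF d])
  have "bump_jet (\<lambda>k. (deriv ^^ k) bump) B"
    unfolding bump_jet_def using d bB c3 bumpf_support[OF bumpf_deriv_bump] by blast
  moreover have "B > 0" using b(1)[of 0] b(1)[of 1] b(1)[of 2] b(1)[of 3] by (simp add: B_def)
  ultimately show thesis using that by blast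
qed

text \<open>Quantitative positivity on the inner half, where both \<open>1 - z\<close> and
  \<open>1 + z\<close> are at least 1 / 2. It feeds the lower bound of the initial pairing.\<close>

lemma bump_lower: "\<bar>z\<bar> \<le> 1 / 2 \<Longrightarrow> exp (- 4) \<le> bump z"
proof -
  assume z: "\<bar>z\<bar> \<le> 1 / 2"
  have f: "exp (- 2) \<le> flat 0 y" if "1 / 2 \<le> y" for y :: real
  proof -
    have "1 / y \<le> 2" using that by (simp add: divide_le_eq)
    then show ?thesis using that by (simp add: flat_def)
  qed
  have "exp (- 2) * exp (- 2) \<le> flat 0 (1 - z) * flat 0 (1 + z)"
    using z by (intro mult_mono f) (auto simp: flat_def)
  then show ?thesis by (simp add: bump_def flip: exp_add)
qed

text \<open>Oscillating profiles with the frequency kept as a variable; \<open>q\<close> bounds the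
  degree in N. A derivative in z raises the degree by one, and \<open>weaken\<close> brings summands
  of different degrees to a common one. Constants obtained by induction over this class are
  therefore uniform in N.\<close>

inductive fam :: "nat \<Rightarrow> (real \<Rightarrow> real \<Rightarrow> real) \<Rightarrow> bool" where
  cos: "bumpf g \<Longrightarrow> fam 0 (\<lambda>N z. g z * cos (N * z))"
| sin: "bumpf g \<Longrightarrow> fam 0 (\<lambda>N z. g z * sin (N * z))"
| add: "fam q F \<Longrightarrow> fam q F' \<Longrightarrow> fam q (\<lambda>N z. F N z + F' N z)"
| cmult: "fam q F \<Longrightarrow> fam q (\<lambda>N z. c * F N z)"
| freq: "fam q F \<Longrightarrow> fam (Suc q) (\<lambda>N z. N * F N z)"
| weaken: "fam q F \<Longrightarrow> fam (Suc q) F"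

lemma fam_support: "fam q F \<Longrightarrow> \<bar>z\<bar> \<ge> 1 \<Longrightarrow> F N z = 0"
  by (induction rule: fam.induct) (auto simp: bumpf_support)

lemma fam_bound: "fam q F \<Longrightarrow> \<exists>C\<ge>0. \<forall>N\<ge>1. \<forall>z. \<bar>F N z\<bar> \<le> C * N ^ q"
proof (induction rule: fam.induct)
  case (cos g)
  obtain B where "B > 0" "\<And>z. \<bar>g z\<bar> \<le> B" using bumpf_bounded[OF cos] by blast
  then have "\<bar>g z * cos (N * z)\<bar> \<le> B * 1" for N z unfolding abs_mult by (intro mult_mono) auto
  then show ?case using \<open>B > 0\<close> by (intro exI[of _ B]) auto
next
  case (sin g)
  obtain B where "B > 0" "\<And>z. \<bar>g z\<bar> \<le> B" using bumpf_bounded[OF sin] by blast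
  then have "\<bar>g z * sin (N * z)\<bar> \<le> B * 1" for N z unfolding abs_mult by (intro mult_mono) auto
  then show ?case using \<open>B > 0\<close> by (intro exI[of _ B]) auto
next
  case (add q F F')
  then obtain C C' where C: "C \<ge> 0" "\<And>N z. N \<ge> 1 \<Longrightarrow> \<bar>F N z\<bar> \<le> C * N ^ q"
    and C': "C' \<ge> 0" "\<And>N z. N \<ge> 1 \<Longrightarrow> \<bar>F' N z\<bar> \<le> C' * N ^ q"
    by blast
  have "\<bar>F N z + F' N z\<bar> \<le> (C + C') * N ^ q" if "N \<ge> 1" for N z
    unfolding distrib_right using C(2)[OF that, of z] C'(2)[OF that, of z] by linarith
  then show ?case using \<open>C \<ge> 0\<close> \<open>C' \<ge> 0\<close> by (intro exI[of _ "C + C'"]) auto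
next
  case (cmult q F c)
  then obtain C where "C \<ge> 0" "\<And>N z. N \<ge> 1 \<Longrightarrow> \<bar>F N z\<bar> \<le> C * N ^ q" by blast
  then have "\<bar>c * F N z\<bar> \<le> (\<bar>c\<bar> * C) * N ^ q" if "N \<ge> 1" for N z
    using that by (simp add: abs_mult mult.assoc mult_left_mono)
  then show ?case using \<open>C \<ge> 0\<close> by (intro exI[of _ "\<bar>c\<bar> * C"]) auto
next
  case (freq q F)
  then obtain C where "C \<ge> 0" "\<And>N z. N \<ge> 1 \<Longrightarrow> \<bar>F N z\<bar> \<le> C * N ^ q" by blast
  then have "\<bar>N * F N z\<bar> \<le> C * N ^ Suc q" if "N \<ge> 1" for N z
    using mult_left_mono[of "\<bar>F N z\<bar>" "C * N ^ q" N] that by (simp add: abs_mult mult_ac)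
  then show ?case using \<open>C \<ge> 0\<close> by blast
next
  case (weaken q F)
  then obtain C where C: "C \<ge> 0" "\<And>N z. N \<ge> 1 \<Longrightarrow> \<bar>F N z\<bar> \<le> C * N ^ q" by blast
  have "\<bar>F N z\<bar> \<le> C * N ^ Suc q" if "N \<ge> 1" for N z
  proof -
    have "C * N ^ q \<le> C * N ^ Suc q" using C(1) that by (intro mult_left_mono power_increasing) auto
    then show ?thesis using C(2)[OF that] by (meson order_trans)
  qed
  then show ?case using C(1) by blast
qed

lemma fam_derivative: "fam q F \<Longrightarrow> \<exists>F'. fam (Suc q) F' \<and> (\<forall>N z. (F N has_real_derivative F' N z) (at z))"
proof (induction rule: fam.induct)
  case (cos g)
  obtain g' where g': "bumpf g'" "\<And>z. (g has_real_derivative g' z) (at z)" using bumpf_derivative[OF cos] by blast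
  define F' where "F' N z = g' z * cos (N * z) + (- 1) * (N * (g z * sin (N * z)))" for N z
  have "fam (Suc 0) F'" unfolding F'_def
    by (intro fam.add fam.weaken[OF fam.cos] fam.cmult fam.freq fam.sin g' cos)
  moreover have "((\<lambda>z. g z * cos (N * z)) has_real_derivative F' N z) (at z)" for N z
    by (auto intro!: derivative_eq_intros g'(2) simp: F'_def)
  ultimately show ?case by blast
next
  case (sin g)
  obtain g' where g': "bumpf g'" "\<And>z. (g has_real_derivative g' z) (at z)" using bumpf_derivative[OF sin] by blast
  define F' where "F' N z = g' z * sin (N * z) + N * (g z * cos (N * z))" for N z
  have "fam (Suc 0) F'" unfolding F'_def
    by (intro fam.add fam.weaken[OF fam.sin] fam.freq fam.cos g' sin)
  moreover have "((\<lambda>z. g z * sin (N * z)) has_real_derivative F' N z) (at z)" for N z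
    by (auto intro!: derivative_eq_intros g'(2) simp: F'_def)
  ultimately show ?case by blast
next
  case (add q F G)
  then obtain F' G' where "fam (Suc q) F'" "fam (Suc q) G'" "\<And>N z. (F N has_real_derivative F' N z) (at z)"
    "\<And>N z. (G N has_real_derivative G' N z) (at z)" by blast
  then have "fam (Suc q) (\<lambda>N z. F' N z + G' N z)" "\<forall>N z. ((\<lambda>z. F N z + G N z) has_real_derivative F' N z + G' N z) (at z)"
    by (auto intro: fam.add DERIV_add)
  then show ?case by blast
next
  case (cmult q F c)
  then obtain F' where "fam (Suc q) F'" "\<And>N z. (F N has_real_derivative F' N z) (at z)" by blast
  then have "fam (Suc q) (\<lambda>N z. c * F' N z)" "\<forall>N z. ((\<lambda>z. c * F N z) has_real_derivative c * F' N z) (at z)"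
    by (auto intro: fam.cmult DERIV_cmult)
  then show ?case by blast
next
  case (freq q F)
  then obtain F' where "fam (Suc q) F'" "\<And>N z. (F N has_real_derivative F' N z) (at z)" by blast
  then have "fam (Suc (Suc q)) (\<lambda>N z. N * F' N z)" "\<forall>N z. ((\<lambda>z. N * F N z) has_real_derivative N * F' N z) (at z)"
    by (auto intro: fam.freq DERIV_cmult)
  then show ?case by blast
next
  case (weaken q F)
  then show ?case using fam.weaken by blast
qed

text \<open>The shape of a k-th derivative of a profile in ln x: each differentiation contributes a
  factor 1 / x. The extension by 0 is smooth because the profiles vanish for large negative
  arguments.\<close>

definition logscale :: "(real \<Rightarrow> real \<Rightarrow> real) \<Rightarrow> nat \<Rightarrow> real \<Rightarrow> real \<Rightarrow> real \<Rightarrow> real" where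
  "logscale F k N l x = (if x > 0 then F N (ln x - ln l) / x ^ k else 0)"

lemma logscale_support:
  assumes "fam q F" "l > 0" "x \<le> l * exp (- 1) \<or> l * exp 1 \<le> x"
  shows "logscale F k N l x = 0"
proof (cases "x > 0")
  case True
  have "ln x \<le> ln l - 1 \<or> ln l + 1 \<le> ln x"
  proof -
    have e: "l * exp (- 1) = exp (ln l - 1)" "l * exp 1 = exp (ln l + 1)"
      using assms(2) by (simp_all add: exp_diff exp_add exp_minus divide_inverse)
    show ?thesis using assms(3) True unfolding e by (metis exp_le_cancel_iff exp_ln)
  qed
  then have "\<bar>ln x - ln l\<bar> \<ge> 1" by linarith
  then show ?thesis using fam_support[OF assms(1)] by (simp add: logscale_def)
qed (simp add: logscale_def)

lemma logscale_derivative: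
  assumes F: "fam q F" and F': "\<And>N z. (F N has_real_derivative F' N z) (at z)" "fam (Suc q) F'" and l: "l > 0"
  shows "(logscale F k N l has_real_derivative logscale (\<lambda>N z. F' N z + (- real k) * F N z) (Suc k) N l x) (at x)"
proof -
  let ?F = "\<lambda>N z. F' N z + (- real k) * F N z"
  show ?thesis
  proof (cases "x > 0")
    case True
    have "((\<lambda>x. ln x - ln l) has_real_derivative 1 / x) (at x)" using True by (auto intro!: derivative_eq_intros)
    from DERIV_divide[OF DERIV_chain2[OF F'(1) this] DERIV_pow, of k]
    have "((\<lambda>x. F N (ln x - ln l) / x ^ k) has_real_derivative
        (F' N (ln x - ln l) * (1 / x) * x ^ k - F N (ln x - ln l) * (real k * x ^ (k - Suc 0))) / (x ^ k * x ^ k)) (at x)"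
      using True by simp
    moreover have "(F' N (ln x - ln l) * (1 / x) * x ^ k - F N (ln x - ln l) * (real k * x ^ (k - Suc 0))) / (x ^ k * x ^ k)
        = logscale ?F (Suc k) N l x"
      using True by (cases k) (simp_all add: logscale_def field_simps)
    ultimately have "((\<lambda>x. F N (ln x - ln l) / x ^ k) has_real_derivative logscale ?F (Suc k) N l x) (at x)" by simp
    then show ?thesis
      by (rule has_field_derivative_transform_within_open[where S = "{0<..}"]) (use True in \<open>auto simp: logscale_def\<close>)
  next
    case False
    have le: "0 < l * exp (- 1)" using l by simp
    have "logscale ?F (Suc k) N l x = 0" using False by (simp add: logscale_def)
    then have "((\<lambda>x. 0) has_real_derivative logscale ?F (Suc k) N l x) (at x)" by simp
    then show ?thesis
      by (rule has_field_derivative_transform_within_open[where S = "{..<l * exp (- 1)}"])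
        (use False le logscale_support[OF F l] in auto)
  qed
qed

text \<open>On the support x exceeds l / e, so dividing by x^k costs at most e^k / l^k. The constant
  depends neither on N nor on l.\<close>

lemma logscale_bound:
  assumes F: "fam q F"
  obtains C where "C \<ge> 0" "\<And>N l x. N \<ge> 1 \<Longrightarrow> l > 0 \<Longrightarrow> \<bar>logscale F k N l x\<bar> \<le> C * N ^ q / l ^ k"
proof -
  obtain C where C: "C \<ge> 0" "\<And>N z. N \<ge> 1 \<Longrightarrow> \<bar>F N z\<bar> \<le> C * N ^ q" using fam_bound[OF F] by blast
  show thesis
  proof (rule that[of "C * exp 1 ^ k"])
    fix N l x :: real assume N: "N \<ge> 1" and l: "l > 0"
    show "\<bar>logscale F k N l x\<bar> \<le> C * exp 1 ^ k * N ^ q / l ^ k"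
    proof (cases "l * exp (- 1) < x")
      case True
      have "0 < l * exp (- 1)" using l by simp
      then have x: "0 < x" using True by linarith
      have "\<bar>logscale F k N l x\<bar> = \<bar>F N (ln x - ln l)\<bar> / x ^ k" using x by (simp add: logscale_def)
      also have "\<dots> \<le> C * N ^ q / (l * exp (- 1)) ^ k"
        using True l C N x by (intro frac_le power_mono) auto
      also have "\<dots> = C * exp 1 ^ k * N ^ q / l ^ k" by (simp add: power_mult_distrib exp_minus field_simps)
      finally show ?thesis .
    next
      case False
      then have "logscale F k N l x = 0" using logscale_support[OF F l] by simp
      then show ?thesis using C(1) N l by simp
    qed
  qed (use C in auto)
qed

section \<open>Periodisation and lower bounds for the sine\<close>

definition per :: "(real \<Rightarrow> real) \<Rightarrow> real \<Rightarrow> real" where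
  "per f x = f (x - 2 * pi * of_int \<lfloor>x / (2 * pi)\<rfloor>)"

lemma per_periodic: "per f (x + 2 * pi) = per f x"
proof -
  have "(x + 2 * pi) / (2 * pi) = x / (2 * pi) + 1" by (simp add: field_simps)
  then show ?thesis by (simp add: per_def algebra_simps)
qed

lemma per_eq: "0 \<le> x \<Longrightarrow> x < 2 * pi \<Longrightarrow> per f x = f x"
proof -
  assume x: "0 \<le> x" "x < 2 * pi"
  then have "\<lfloor>x / (2 * pi)\<rfloor> = 0" by (simp add: floor_eq_iff)
  then show ?thesis by (simp add: per_def)
qed

lemma per_derivative:
  assumes f: "\<And>x. (f has_real_derivative f' x) (at x)" and ab: "0 < a" "b < 2 * pi"
    and z: "\<And>x. x \<le> a \<or> b \<le> x \<Longrightarrow> f x = 0"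
  shows "(per f has_real_derivative per f' x) (at x)"
proof -
  define n where "n = \<lfloor>x / (2 * pi)\<rfloor>"
  define c where "c = 2 * pi * of_int n"
  \<comment> \<open>\<open>r\<close> is at most the gap on either side of the support, so a point
    near \<open>x\<close> that falls into an adjacent period meets zeros both of
    \<open>per f\<close> and of the translate used at \<open>x\<close>.\<close>
  define r where "r = min (min a (2 * pi - b)) pi"
  have r: "r > 0" using ab by (auto simp: r_def)
  have "of_int n \<le> x / (2 * pi)" "x / (2 * pi) < of_int n + 1" unfolding n_def by linarith+
  then have xc: "0 \<le> x - c" "x - c < 2 * pi" by (auto simp: c_def field_simps)
  have eq: "f (y - c) = per f y" if "\<bar>y - x\<bar> < r" for y
  proof -
    have y: "- r < y - c" "y - c < 2 * pi + r" using xc that by linarith+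
    have rr: "r \<le> a" "r \<le> 2 * pi - b" "r \<le> pi" by (auto simp: r_def)
    have q: "y / (2 * pi) = of_int n + (y - c) / (2 * pi)" by (simp add: c_def field_simps)
    consider "y - c < 0" | "0 \<le> y - c" "y - c < 2 * pi" | "2 * pi \<le> y - c" by linarith
    then show ?thesis
    proof cases
      case 1
      have "\<lfloor>y / (2 * pi)\<rfloor> = n - 1"
        unfolding q floor_eq_iff using 1 y rr by (simp add: field_simps)
      then have "per f y = f (y - 2 * pi * of_int (n - 1))" by (simp only: per_def)
      also have "y - 2 * pi * of_int (n - 1) = y - c + 2 * pi" by (simp add: c_def algebra_simps)
      finally have "per f y = f (y - c + 2 * pi)" .
      moreover have "f (y - c + 2 * pi) = 0" by (rule z) (use y rr in linarith)
      moreover have "f (y - c) = 0" by (rule z) (use 1 ab in linarith)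
      ultimately show ?thesis by simp
    next
      case 2
      have "\<lfloor>y / (2 * pi)\<rfloor> = n"
        unfolding q floor_eq_iff using 2 by (simp add: field_simps)
      then show ?thesis by (simp add: per_def c_def)
    next
      case 3
      have "\<lfloor>y / (2 * pi)\<rfloor> = n + 1"
        unfolding q floor_eq_iff using 3 y rr by (simp add: field_simps)
      then have "per f y = f (y - 2 * pi * of_int (n + 1))" by (simp only: per_def)
      also have "y - 2 * pi * of_int (n + 1) = y - c - 2 * pi" by (simp add: c_def algebra_simps)
      finally have "per f y = f (y - c - 2 * pi)" .
      moreover have "f (y - c - 2 * pi) = 0" by (rule z) (use y rr in linarith)
      moreover have "f (y - c) = 0" by (rule z) (use 3 ab in linarith)
      ultimately show ?thesis by simp
    qed
  qed
  have "((\<lambda>y. y - c) has_real_derivative 1) (at x)" by (auto intro!: derivative_eq_intros)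
  from DERIV_chain2[OF f this] have "((\<lambda>y. f (y - c)) has_real_derivative f' (x - c)) (at x)" by simp
  then have "(per f has_real_derivative f' (x - c)) (at x)"
    by (rule has_field_derivative_transform_within_open[where S = "ball x r"])
      (use r eq in \<open>auto simp: dist_real_def abs_minus_commute\<close>)
  then show ?thesis by (simp add: per_def c_def n_def)
qed

lemma sin_ge_quarter:
  assumes "0 \<le> x" "x \<le> pi / 2"
  shows "x / 4 \<le> sin x" and "x \<le> 1 \<Longrightarrow> x / 2 \<le> sin x"
proof -
  have pi3: "1 \<le> pi / 3" using pi_gt3 by simp
  have *: "y / 2 \<le> sin y" if "0 \<le> y" "y \<le> 1" for y :: real
  proof (cases "y = 0")
    case False
    then obtain z where z: "0 < z" "z < y" "sin y - sin 0 = (y - 0) * cos z"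
      using MVT2[of 0 y sin cos] \<open>0 \<le> y\<close> by (auto intro: derivative_intros)
    have "cos (pi / 3) \<le> cos z" using z that pi3 pi_gt3 by (intro cos_monotone_0_pi_le) auto
    then have "1 / 2 \<le> cos z" by (simp add: cos_60)
    then have "y * (1 / 2) \<le> y * cos z" using that by (intro mult_left_mono) auto
    then show ?thesis using z(3) by simp
  qed simp
  show "x \<le> 1 \<Longrightarrow> x / 2 \<le> sin x" using * assms by blast
  show "x / 4 \<le> sin x"
  proof (cases "x \<le> 1")
    case True then show ?thesis using *[of x] assms by simp
  next
    case False
    have "sin 1 \<le> sin x" using False assms pi_gt3 by (intro sin_monotone_2pi_le) auto
    moreover have "1 / 2 \<le> sin (1::real)" using *[of 1] by simp
    ultimately show ?thesis using assms pi_less_4 by linarith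
  qed
qed

lemma sin_ge_dpi:
  assumes "x \<in> {0..pi}"
  shows "dpi x / 4 \<le> sin x"
proof (cases "x \<le> pi / 2")
  case True
  then show ?thesis using sin_ge_quarter(1)[of x] assms by (simp add: dpi_def min_def)
next
  case False
  then have "(pi - x) / 4 \<le> sin (pi - x)" using assms by (intro sin_ge_quarter(1)) auto
  then show ?thesis using False by (simp add: dpi_def min_def)
qed

text \<open>One sequence describes the derivatives of the packets for all frequencies and all
  positions simultaneously, so its bounds do not depend on the packet. Dependent choice is used
  since \<open>fam_derivative\<close> only asserts existence.\<close>

lemma fam_sequence:
  obtains FF where "FF 0 = (\<lambda>N z. bump z * cos (N * z))" "\<And>k. fam k (FF k)"
    "\<And>k N l x. l > 0 \<Longrightarrow> (logscale (FF k) k N l has_real_derivative logscale (FF (Suc k)) (Suc k) N l x) (at x)"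
proof -
  define P where "P k F \<longleftrightarrow> fam k F \<and> (k = 0 \<longrightarrow> F = (\<lambda>N z. bump z * cos (N * z)))" for k F
  define Q where "Q k F F' \<longleftrightarrow> (\<forall>N l x. l > 0 \<longrightarrow> (logscale F k N l has_real_derivative logscale F' (Suc k) N l x) (at x))" for k F F'
  have "\<exists>f. \<forall>k. P k (f k) \<and> Q k (f k) (f (Suc k))"
  proof (rule dependent_nat_choice)
    have "bumpf bump" using bumpf_deriv_bump[of 0] by simp
    then show "\<exists>F. P 0 F" unfolding P_def using fam.cos by blast
  next
    fix F k assume "P k F"
    then have F: "fam k F" by (simp add: P_def)
    obtain F' where F': "fam (Suc k) F'" "\<And>N z. (F N has_real_derivative F' N z) (at z)"
      using fam_derivative[OF F] by blast
    have "P (Suc k) (\<lambda>N z. F' N z + (- real k) * F N z)"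
      unfolding P_def using fam.add[OF F'(1) fam.cmult[OF fam.weaken[OF F], of "- real k"]] by simp
    moreover have "Q k F (\<lambda>N z. F' N z + (- real k) * F N z)"
      unfolding Q_def using logscale_derivative[OF F F'(2,1)] by blast
    ultimately show "\<exists>G. P (Suc k) G \<and> Q k F G" by blast
  qed
  then obtain f where "\<And>k. P k (f k)" "\<And>k. Q k (f k) (f (Suc k))" by blast
  then show thesis using that[of f] unfolding P_def Q_def by blast
qed

section \<open>Superposition of infinitely many packets\<close>

locale packet_data =
  fixes FF :: "nat \<Rightarrow> real \<Rightarrow> real \<Rightarrow> real" and n1 :: nat and B :: real
  assumes FF0: "FF 0 = (\<lambda>N z. bump z * cos (N * z))" and fam: "\<And>k. fam k (FF k)"
    and der: "\<And>k N l x. l > 0 \<Longrightarrow> (logscale (FF k) k N l has_real_derivative logscale (FF (Suc k)) (Suc k) N l x) (at x)"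
    and n1: "n1 \<ge> 1" and B: "\<And>z. \<bar>bump z\<bar> \<le> B"
begin

definition jj :: "nat \<Rightarrow> real" where "jj n = 2 ^ (n + n1)"
text \<open>With j for \<open>jj n\<close>, the exponents 8 and 16 go with the travelling time T = 1
  / (3 e j^14) used later. In that time the packet moves by 3 e N^2 T = j^2 in ln x, while the error
  terms T N, T l N^3 and T^2 N^3 are of orders j^-6, j^-6 and j^-4.\<close>

definition NN :: "nat \<Rightarrow> real" where "NN n = jj n ^ 8"
definition ll :: "nat \<Rightarrow> real" where "ll n = 1 / jj n ^ 16"
text \<open>Small enough to beat (N / l)^k = j^(24 k), the cost of k derivatives, so that the sum is
  smooth; yet far above the power of exp(-j^2) that bounds the pairing on arrival. All packet sizes
  and their derivatives are measured by \<open>\<theta>\<close>, this amplitude times a power of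
  j.\<close>

definition dd :: "nat \<Rightarrow> real" where "dd n = exp (- jj n)"
definition \<theta> :: "real \<Rightarrow> nat \<Rightarrow> real" where "\<theta> r n = exp (- jj n) * jj n powr r"
definition T :: "nat \<Rightarrow> nat \<Rightarrow> real \<Rightarrow> real" where
  "T n k x = dd n * per (logscale (FF k) k (NN n) (ll n)) x"
definition S :: "(nat \<Rightarrow> bool) \<Rightarrow> nat \<Rightarrow> real \<Rightarrow> real" where
  "S c k x = (\<Sum>n. of_bool (c n) * T n k x)"

lemma B0: "0 \<le> B" using B[of 0] by linarith

lemma jj: "jj n \<ge> 2" "jj (Suc n) = 2 * jj n" "real n \<le> jj n"
proof -
  have "(2::real) ^ 1 \<le> 2 ^ (n + n1)" using n1 by (intro power_increasing) auto
  then show "jj n \<ge> 2" by (simp add: jj_def)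
  show "jj (Suc n) = 2 * jj n" by (simp add: jj_def)
  have "real n \<le> 2 ^ n" using less_exp[of n] by (metis less_imp_le of_nat_le_iff of_nat_numeral of_nat_power)
  also have "\<dots> \<le> 2 ^ (n + n1)" by (intro power_increasing) auto
  finally show "real n \<le> jj n" by (simp add: jj_def)
qed

lemma scales: "NN n \<ge> 1" "ll n > 0" "ll n * exp 1 \<le> 1" "3 * ll n \<le> 1" "ll (Suc n) = ll n / 2 ^ 16" "ll n \<le> 1"
proof -
  have j1: "1 \<le> jj n" using jj(1)[of n] by linarith
  show "NN n \<ge> 1" using j1 by (simp add: NN_def one_le_power)
  show l0: "ll n > 0" using j1 by (simp add: ll_def)
  have "(2::real) ^ 16 \<le> jj n ^ 16" using jj(1)[of n] by (intro power_mono) auto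
  then have "65536 \<le> jj n ^ 16" by simp
  then have l: "ll n \<le> 1 / 65536" unfolding ll_def by (intro divide_left_mono) auto
  then show "3 * ll n \<le> 1" "ll n \<le> 1" by auto
  have "ll n * exp 1 \<le> ll n * 3" using l0 exp_le by (intro mult_left_mono) auto
  then show "ll n * exp 1 \<le> 1" using l by linarith
  show "ll (Suc n) = ll n / 2 ^ 16" by (simp add: ll_def jj power_mult_distrib)
qed

lemma theta_pos: "\<theta> r n > 0" using jj(1)[of n] by (simp add: \<theta>_def)

text \<open>Passing to the next index doubles \<open>jj n\<close>, which multiplies the value by 2
  powr r * exp (- jj n). This is at most 1 / 2 as soon as exp (jj n) exceeds 2 powr (r + 1).\<close>

lemma theta_step: "jj n \<ge> \<bar>r\<bar> + 1 \<Longrightarrow> \<theta> r (Suc n) \<le> \<theta> r n / 2"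
proof -
  assume j: "jj n \<ge> \<bar>r\<bar> + 1"
  have j0: "jj n > 0" using jj(1)[of n] by linarith
  have e: "2 powr r * 2 = 2 powr (r + 1)" by (simp add: powr_add)
  have 3: "2 powr r * 2 \<le> exp (jj n)"
  proof (cases "0 \<le> r + 1")
    case True
    have "2 powr (r + 1) \<le> exp 1 powr (r + 1)"
      using True exp_ge_add_one_self[of 1] by (intro powr_mono2) auto
    also have "\<dots> = exp (r + 1)" by (simp add: powr_def)
    also have "\<dots> \<le> exp (jj n)" using j by simp
    finally show ?thesis unfolding e .
  next
    case False
    have "2 powr (r + 1) \<le> 2 powr 0" using False by (intro powr_mono) auto
    also have "\<dots> \<le> exp (jj n)" using j0 by simp
    finally show ?thesis unfolding e .
  qed
  have "\<theta> r (Suc n) = exp (- jj n) * jj n powr r * (exp (- jj n) * 2 powr r)"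
    using j0 exp_add[of "- jj n" "- jj n"] by (simp add: \<theta>_def jj powr_mult)
  also have "\<dots> \<le> exp (- jj n) * jj n powr r * (1 / 2)"
    using 3 by (intro mult_left_mono) (auto simp: exp_minus field_simps)
  finally show ?thesis by (simp add: \<theta>_def)
qed

text \<open>By the geometric decay a whole tail is comparable with its first term. This lets the
  first packet in which two sequences differ control all later ones.\<close>

lemma theta_tail:
  assumes "jj n \<ge> \<bar>r\<bar> + 1"
  shows "summable (\<lambda>i. \<theta> r (i + n))" and "(\<Sum>i. \<theta> r (i + n)) \<le> 2 * \<theta> r n"
proof -
  have le: "\<theta> r (i + n) \<le> \<theta> r n * (1 / 2) ^ i" for i
  proof (induction i)
    case (Suc i)
    have "jj n \<le> jj (i + n)" unfolding jj_def by (intro power_increasing) auto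
    then have "\<theta> r (Suc (i + n)) \<le> \<theta> r (i + n) / 2" using assms by (intro theta_step) linarith
    then show ?case using Suc by simp
  qed simp
  have g: "summable (\<lambda>i. \<theta> r n * (1 / 2 :: real) ^ i)" by (intro summable_mult summable_geometric) auto
  show s: "summable (\<lambda>i. \<theta> r (i + n))"
    by (rule summable_comparison_test'[OF g, of 0]) (use le theta_pos in \<open>auto simp: less_imp_le\<close>)
  have "(\<Sum>i. \<theta> r (i + n)) \<le> (\<Sum>i. \<theta> r n * (1 / 2) ^ i)" by (rule suminf_le[OF le s g])
  also have "\<dots> = 2 * \<theta> r n" by (subst suminf_mult) (auto simp: suminf_geometric)
  finally show "(\<Sum>i. \<theta> r (i + n)) \<le> 2 * \<theta> r n" .
qed

lemma theta_summable: "summable (\<theta> r)"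
proof -
  obtain n :: nat where "\<bar>r\<bar> + 1 \<le> real n" using real_arch_simple by blast
  then have "jj n \<ge> \<bar>r\<bar> + 1" using jj(3)[of n] by linarith
  then have "summable (\<lambda>i. \<theta> r (i + n))" by (rule theta_tail)
  then show ?thesis by (simp add: summable_iff_shift)
qed

lemma theta_ll: "dd n * ll n powr \<beta> = \<theta> (- 16 * \<beta>) n"
proof -
  have j0: "jj n > 0" using jj(1)[of n] by linarith
  have "ll n = jj n powr (- 16)" using j0 powr_realpow[of "jj n" 16] by (simp add: ll_def powr_minus_divide)
  then have "ll n powr \<beta> = jj n powr (- 16 * \<beta>)" by (simp add: powr_powr)
  then show ?thesis by (simp add: dd_def \<theta>_def)
qed

text \<open>One derivative costs N / l = j^(8 + 16), hence the factor 24.\<close>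

lemma T_bound:
  obtains C where "C \<ge> 0" "\<And>n x. \<bar>T n k x\<bar> \<le> C * \<theta> (24 * real k) n"
proof -
  obtain C where C: "C \<ge> 0" "\<And>N l x. N \<ge> 1 \<Longrightarrow> l > 0 \<Longrightarrow> \<bar>logscale (FF k) k N l x\<bar> \<le> C * N ^ k / l ^ k"
    using logscale_bound[OF fam[of k], of k] by blast
  have "\<bar>T n k x\<bar> \<le> C * \<theta> (24 * real k) n" for n x
  proof -
    have j0: "jj n > 0" using jj(1)[of n] by linarith
    have "\<bar>T n k x\<bar> \<le> dd n * (C * NN n ^ k / ll n ^ k)"
      unfolding T_def per_def abs_mult using C(2)[OF scales(1,2)] by (intro mult_mono) (auto simp: dd_def)
    also have "NN n ^ k / ll n ^ k = jj n powr (24 * real k)"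
    proof -
      have "NN n ^ k / ll n ^ k = jj n ^ (8 * k) * jj n ^ (16 * k)"
        using j0 by (simp add: NN_def ll_def power_mult power_divide)
      also have "\<dots> = jj n ^ (24 * k)" by (simp flip: power_add)
      also have "\<dots> = jj n powr (24 * real k)" using j0 powr_realpow[of "jj n" "24 * k"] by simp
      finally show ?thesis .
    qed
    then have "dd n * (C * NN n ^ k / ll n ^ k) = C * \<theta> (24 * real k) n"
      unfolding times_divide_eq_right[symmetric] by (simp add: \<theta>_def dd_def)
    finally show ?thesis .
  qed
  then show thesis using that C(1) by blast
qed

lemma T_supp:
  assumes "0 \<le> x" "x < 2 * pi" "x \<le> ll n * exp (- 1) \<or> ll n * exp 1 \<le> x"
  shows "T n k x = 0"
  using logscale_support[OF fam scales(2) assms(3)] per_eq[OF assms(1,2)] by (simp add: T_def)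

lemma T_eq:
  assumes "0 < x" "x < 2 * pi"
  shows "T n 0 x = dd n * (bump (ln x - ln (ll n)) * cos (NN n * (ln x - ln (ll n))))"
  using assms by (simp add: T_def per_eq logscale_def FF0)

lemma T_derivative: "(T n k has_real_derivative T n (Suc k) x) (at x)"
  unfolding T_def[abs_def]
proof (intro DERIV_cmult per_derivative)
  show "(logscale (FF k) k (NN n) (ll n) has_real_derivative logscale (FF (Suc k)) (Suc k) (NN n) (ll n) x) (at x)" for x
    by (rule der[OF scales(2)])
  show "0 < ll n * exp (- 1)" using scales(2) by simp
  show "ll n * exp 1 < 2 * pi" using scales(3)[of n] pi_gt3 by linarith
  show "logscale (FF k) k (NN n) (ll n) x = 0" if "x \<le> ll n * exp (- 1) \<or> ll n * exp 1 \<le> x" for x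
    by (rule logscale_support[OF fam scales(2) that])
qed

lemma S_bound:
  obtains C where "C \<ge> 0" "\<And>c x. \<bar>S c k x\<bar> \<le> C"
proof -
  obtain C where C: "C \<ge> 0" "\<And>n x. \<bar>T n k x\<bar> \<le> C * \<theta> (24 * real k) n" using T_bound by blast
  have s: "summable (\<lambda>n. C * \<theta> (24 * real k) n)" by (intro summable_mult theta_summable)
  have "\<bar>S c k x\<bar> \<le> (\<Sum>n. C * \<theta> (24 * real k) n)" for c x
  proof -
    have le: "norm (of_bool (c n) * T n k x) \<le> C * \<theta> (24 * real k) n" for n
      using C(2)[of n x] C(1) theta_pos[of "24 * real k" n] by (cases "c n") (auto simp: less_imp_le)
    have sn: "summable (\<lambda>n. norm (of_bool (c n) * T n k x))"
      by (rule summable_comparison_test'[OF s, of 0]) (use le in auto)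
    have "norm (S c k x) \<le> (\<Sum>n. norm (of_bool (c n) * T n k x))"
      unfolding S_def by (rule summable_norm[OF sn])
    also have "\<dots> \<le> (\<Sum>n. C * \<theta> (24 * real k) n)" by (rule suminf_le[OF le sn s])
    finally show ?thesis by simp
  qed
  moreover have "0 \<le> (\<Sum>n. C * \<theta> (24 * real k) n)"
    by (rule suminf_nonneg[OF s]) (use C(1) theta_pos in \<open>auto simp: less_imp_le\<close>)
  ultimately show thesis using that by blast
qed

text \<open>The majorants from \<open>T_bound\<close> are summable for every order, so the series is
  differentiated term by term. Convergence at one point is free because all packets vanish at
  0.\<close>

lemma S_derivative: "(S c k has_real_derivative S c (Suc k) x) (at x)"
proof -
  obtain C where C: "C \<ge> 0" "\<And>n x. \<bar>T n (Suc k) x\<bar> \<le> C * \<theta> (24 * real (Suc k)) n" using T_bound by blast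
  have le: "norm (of_bool (c n) * T n (Suc k) x) \<le> C * \<theta> (24 * real (Suc k)) n" for n x
    using C(2)[of n x] C(1) theta_pos[of "24 * real (Suc k)" n] by (cases "c n") (auto simp: less_imp_le)
  have "uniform_limit UNIV (\<lambda>n x. \<Sum>i<n. of_bool (c i) * T i (Suc k) x) (\<lambda>x. \<Sum>i. of_bool (c i) * T i (Suc k) x) sequentially"
    by (rule Weierstrass_m_test[OF le]) (intro summable_mult theta_summable)
  then have u: "uniformly_convergent_on UNIV (\<lambda>n x. \<Sum>i<n. of_bool (c i) * T i (Suc k) x)"
    by (rule uniformly_convergentI)
  have "((\<lambda>x. \<Sum>n. of_bool (c n) * T n k x) has_field_derivative (\<Sum>n. of_bool (c n) * T n (Suc k) x)) (at x)"
  proof (rule has_field_derivative_series'(2)[OF convex_UNIV _ u])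
    show "((\<lambda>x. of_bool (c n) * T n k x) has_field_derivative of_bool (c n) * T n (Suc k) x) (at x within UNIV)" for n x
      by (intro DERIV_cmult T_derivative)
    show "summable (\<lambda>n. of_bool (c n) * T n k 0)"
      using T_supp[of 0 _ k] scales(2) by (simp add: less_imp_le)
  qed auto
  then show ?thesis unfolding S_def[abs_def] .
qed

lemma S_periodic: "S c k (x + 2 * pi) = S c k x"
  by (simp add: S_def T_def per_periodic)

lemma S_zero:
  assumes "x = 0 \<or> (1 \<le> x \<and> x < 2 * pi)"
  shows "S c k x = 0"
proof -
  have "T n k x = 0" for n
    by (rule T_supp) (use assms scales(2)[of n] scales(3)[of n] in \<open>auto simp: less_imp_le intro: order_trans\<close>)
  then show ?thesis by (simp add: S_def)
qed

text \<open>Later packets sit closer to 0. Hence for sequences that agree before \<open>n\<close>,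
  the difference vanishes to the right of packet \<open>n\<close>, is that packet alone down to its
  left end, and in a weighted norm is bounded by a tail. The weight exponent is - s for flatness at
  0, \<alpha> - 3 / 2 for the energy and - 3 for smallness against the cube of the sine.\<close>

lemma S_diff:
  assumes "\<And>i. i < n \<Longrightarrow> c i = c' i" and x: "0 < x" "x < 2 * pi"
  shows "\<bar>S c 0 x - S c' 0 x\<bar> * x powr \<beta> \<le> B * exp \<bar>\<beta>\<bar> * (\<Sum>i. \<theta> (- 16 * \<beta>) (i + n))"
    and "ll n * exp 1 \<le> x \<Longrightarrow> S c 0 x = S c' 0 x"
    and "ll n * exp (- 1) \<le> x \<Longrightarrow> S c 0 x - S c' 0 x = (of_bool (c n) - of_bool (c' n)) * T n 0 x"
proof -
  define a :: "nat \<Rightarrow> real" where "a i = of_bool (c i) - of_bool (c' i)" for i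
  have a: "\<bar>a i\<bar> \<le> 1" for i by (auto simp: a_def)
  have a0: "a i = 0" if "i < n" for i using assms(1)[OF that] by (simp add: a_def)
  obtain C where C: "C \<ge> 0" "\<And>n x. \<bar>T n 0 x\<bar> \<le> C * \<theta> (24 * real 0) n" using T_bound[of 0] by blast
  have sc: "summable (\<lambda>n. of_bool (c n) * T n 0 x)" for c
  proof (rule summable_comparison_test')
    show "summable (\<lambda>n. C * \<theta> (24 * real 0) n)" by (intro summable_mult theta_summable)
    show "norm (of_bool (c n) * T n 0 x) \<le> C * \<theta> (24 * real 0) n" if "0 \<le> n" for n
      using C(2)[of n x] C(1) theta_pos[of "24 * real 0" n] by (cases "c n") (auto simp: less_imp_le)
  qed
  have eq: "S c 0 x - S c' 0 x = (\<Sum>i. a i * T i 0 x)"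
    unfolding S_def using suminf_diff[OF sc[of c] sc[of c']] by (simp add: a_def left_diff_distrib)
  have sa: "summable (\<lambda>i. a i * T i 0 x)"
    using summable_diff[OF sc[of c] sc[of c']] by (simp add: a_def left_diff_distrib)
  have Tb: "\<bar>a i * T i 0 x\<bar> * x powr \<beta> \<le> B * exp \<bar>\<beta>\<bar> * \<theta> (- 16 * \<beta>) i" for i
  proof (cases "ll i * exp (- 1) < x \<and> x < ll i * exp 1")
    case True
    have "\<bar>a i * T i 0 x\<bar> \<le> 1 * (dd i * (B * 1))"
      unfolding T_eq[OF x] abs_mult using a[of i] B[of "ln x - ln (ll i)"] B0
      by (intro mult_mono) (auto simp: dd_def)
    then have "\<bar>a i * T i 0 x\<bar> * x powr \<beta> \<le> (dd i * B) * (exp \<bar>\<beta>\<bar> * ll i powr \<beta>)"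
      using powr_le_near[of "ll i" x \<beta>] True scales(2)[of i] B0 by (intro mult_mono) (auto simp: dd_def)
    also have "\<dots> = B * exp \<bar>\<beta>\<bar> * (dd i * ll i powr \<beta>)" by (simp add: mult_ac)
    finally show ?thesis unfolding theta_ll .
  next
    case False
    then have "T i 0 x = 0" using x by (intro T_supp) auto
    then show ?thesis using B0 theta_pos[of "- 16 * \<beta>" i] by (simp add: less_imp_le)
  qed
  have sT: "summable (\<lambda>i. \<theta> (- 16 * \<beta>) (i + n))" using theta_summable by (simp add: summable_iff_shift)
  have shift: "(\<Sum>i. a i * T i 0 x) = (\<Sum>i. a (i + n) * T (i + n) 0 x)"
    using suminf_split_initial_segment[OF sa, of n] a0 by simp
  show "\<bar>S c 0 x - S c' 0 x\<bar> * x powr \<beta> \<le> B * exp \<bar>\<beta>\<bar> * (\<Sum>i. \<theta> (- 16 * \<beta>) (i + n))"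
  proof -
    have le: "norm (a (i + n) * T (i + n) 0 x * x powr \<beta>) \<le> B * exp \<bar>\<beta>\<bar> * \<theta> (- 16 * \<beta>) (i + n)" for i
      using Tb[of "i + n"] by (simp add: abs_mult)
    have s2: "summable (\<lambda>i. B * exp \<bar>\<beta>\<bar> * \<theta> (- 16 * \<beta>) (i + n))" by (intro summable_mult sT)
    have sn: "summable (\<lambda>i. norm (a (i + n) * T (i + n) 0 x * x powr \<beta>))"
      by (rule summable_comparison_test'[OF s2, of 0]) (use le in auto)
    have "(S c 0 x - S c' 0 x) * x powr \<beta> = (\<Sum>i. a (i + n) * T (i + n) 0 x * x powr \<beta>)"
      unfolding eq shift by (rule suminf_mult2) (use sa in \<open>simp add: summable_iff_shift[of "\<lambda>i. a i * T i 0 x"]\<close>)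
    then have "\<bar>S c 0 x - S c' 0 x\<bar> * x powr \<beta> = norm (\<Sum>i. a (i + n) * T (i + n) 0 x * x powr \<beta>)"
      by (metis abs_mult abs_of_nonneg powr_ge_zero real_norm_def)
    also have "\<dots> \<le> (\<Sum>i. norm (a (i + n) * T (i + n) 0 x * x powr \<beta>))" by (rule summable_norm[OF sn])
    also have "\<dots> \<le> (\<Sum>i. B * exp \<bar>\<beta>\<bar> * \<theta> (- 16 * \<beta>) (i + n))" by (rule suminf_le[OF le sn s2])
    also have "\<dots> = B * exp \<bar>\<beta>\<bar> * (\<Sum>i. \<theta> (- 16 * \<beta>) (i + n))" by (rule suminf_mult[OF sT])
    finally show ?thesis .
  qed
  have mono: "ll i \<le> ll n" if "n \<le> i" for i
  proof -
    have "jj n \<le> jj i" unfolding jj_def using that by (intro power_increasing) auto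
    then show ?thesis unfolding ll_def using jj(1)[of n] by (intro divide_left_mono power_mono) auto
  qed
  show "S c 0 x = S c' 0 x" if "ll n * exp 1 \<le> x"
  proof -
    have "a i * T i 0 x = 0" for i
    proof (cases "i < n")
      case False
      then have "ll i * exp 1 \<le> ll n * exp 1" using mono by (intro mult_right_mono) auto
      then have "ll i * exp 1 \<le> x" using that by linarith
      then have "T i 0 x = 0" using x by (intro T_supp) auto
      then show ?thesis by simp
    qed (simp add: a0)
    then have "(\<Sum>i. a i * T i 0 x) = 0" by (simp only: suminf_zero)
    then show ?thesis using eq by simp
  qed
  show "S c 0 x - S c' 0 x = (of_bool (c n) - of_bool (c' n)) * T n 0 x" if "ll n * exp (- 1) \<le> x"
  proof -
    have "a i * T i 0 x = 0" if i: "i \<noteq> n" for i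
    proof (cases "i < n")
      case False
      then have "Suc n \<le> i" using i by simp
      then have "jj (Suc n) \<le> jj i" unfolding jj_def by (intro power_increasing) auto
      then have "ll i \<le> ll (Suc n)" unfolding ll_def using jj(1)[of "Suc n"] by (intro divide_left_mono power_mono) auto
      \<comment> \<open>Consecutive positions differ by the factor 2^16, which is more than e^2, so
        every later packet ends before packet \<open>n\<close> begins.\<close>
      then have "ll i * exp 1 \<le> (ll n / 2 ^ 16) * 3" using scales(5)[of n] scales(2)[of i] exp_le by (intro mult_mono) auto
      also have "\<dots> \<le> ll n * (1 / 3)" using scales(2)[of n] by simp
      also have "\<dots> \<le> ll n * exp (- 1)"
        using scales(2)[of n] exp_le by (intro mult_left_mono) (auto simp: exp_minus field_simps)
      finally have "ll i * exp 1 \<le> x" using \<open>ll n * exp (- 1) \<le> x\<close> by linarith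
      then have "T i 0 x = 0" using x by (intro T_supp) auto
      then show ?thesis by simp
    qed (simp add: a0)
    then have "(\<Sum>i. a i * T i 0 x) = (\<Sum>i\<in>{n}. a i * T i 0 x)" by (intro suminf_finite) auto
    then show ?thesis unfolding eq by (simp add: a_def)
  qed
qed

end

section \<open>Conclusion\<close>

lemma deriv_chain:
  assumes "\<And>k x. (Q k has_real_derivative Q (Suc k) x) (at x)"
  shows "(deriv ^^ k) (Q 0) = Q k"
proof (induction k)
  case (Suc k)
  then show ?case using assms by (auto intro!: ext DERIV_imp_deriv)
qed simp

lemma smooth_fun_chain:
  assumes "\<And>k x. (Q k has_real_derivative Q (Suc k) x) (at x)"
  shows "smooth_fun (Q 0)"
  unfolding smooth_fun_def Ck_def deriv_chain[of Q, OF assms]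
  by (intro allI conjI impI assms continuous_at_imp_continuous_on ballI DERIV_isCont[OF assms])

lemma classical_mono:
  assumes "classical \<alpha> \<mu> m s M \<delta> U" "M \<le> M'" "\<delta>' \<le> \<delta>"
  shows "classical \<alpha> \<mu> m s M' \<delta>' U"
proof -
  note c = classicalD[OF assms(1)]
  have "continuous_on ({0..\<delta>'} \<times> UNIV) (\<lambda>(t, x). U k t x)" if "k < s" for k
    unfolding split_def by (rule continuous_on_subset[OF c(1)[OF that]]) (use assms(3) in auto)
  moreover have "\<bar>U k t x\<bar> \<le> M'" if "k < s" "t \<in> {0..\<delta>'}" for k t x
    using c(2)[of k t x] that assms by auto
  moreover have "\<bar>U k t x - U k t y\<bar> \<le> M' * \<bar>x - y\<bar>" if "k < s" "t \<in> {0..\<delta>'}" for k t x y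
  proof -
    have "\<bar>U k t x - U k t y\<bar> \<le> M * \<bar>x - y\<bar>" using c(3)[of k t x y] that assms by auto
    also have "\<dots> \<le> M' * \<bar>x - y\<bar>" using assms(2) by (intro mult_right_mono) auto
    finally show ?thesis .
  qed
  moreover have "(U k t has_real_derivative U (Suc k) t x) (at x)" if "Suc k < s" "t \<in> {0..\<delta>'}" for k t x
    using c(4)[of k t x] that assms by auto
  moreover have "U 0 t x = U 0 0 x - integral {0..t} (\<lambda>\<tau>. Nl \<alpha> \<mu> m (\<lambda>k. U k \<tau> x))" if "t \<in> {0..\<delta>'}" for t x
    by (rule c(5)) (use that assms in auto)
  ultimately show ?thesis unfolding classical_def by blast
qed

lemma classical_initial_jets:
  assumes c: "classical \<alpha> \<mu> m s M \<delta> U" and "\<delta> \<ge> 0"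
    and Q: "\<And>k x. (Q k has_real_derivative Q (Suc k) x) (at x)" and 0: "\<And>x. U 0 0 x = Q 0 x"
  shows "k < s \<Longrightarrow> U k 0 x = Q k x"
proof (induction k arbitrary: x)
  case (Suc k)
  then have "U k 0 = Q k" by auto
  moreover have "(U k 0 has_real_derivative U (Suc k) 0 x) (at x)"
    using classicalD(4)[OF c, of k 0 x] Suc.prems \<open>\<delta> \<ge> 0\<close> by auto
  ultimately show ?case using Q[of k x] DERIV_unique by metis
qed (rule 0)

text \<open>In z = ln x - ln l this is the integral of cos^2 (N z) from - 1 / 2 to 1 / 2, equal to 1
  / 2 + sin N / (2 N).\<close>

lemma integral_cos_sq:
  fixes l N :: real
  assumes l: "l > 0" and N: "N \<ge> 2"
  obtains I where "((\<lambda>x. cos (N * (ln x - ln l)) ^ 2 / x) has_integral I) {l * exp (- (1 / 2))..l * exp (1 / 2)}" "I \<ge> 1 / 4"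
proof -
  define a b where "a = l * exp (- (1 / 2))" and "b = l * exp (1 / 2)"
  define F where "F x = (ln x - ln l) / 2 + sin (2 * (N * (ln x - ln l))) / (4 * N)" for x
  have ab: "0 < a" "a \<le> b" using l by (auto simp: a_def b_def)
  have "((\<lambda>x. cos (N * (ln x - ln l)) ^ 2 / x) has_integral (F b - F a)) {a..b}"
  proof (rule fundamental_theorem_of_calculus[OF ab(2)])
    fix x assume "x \<in> {a..b}"
    then have x: "0 < x" using ab by auto
    have "(F has_real_derivative (1 / x) / 2 + (cos (2 * (N * (ln x - ln l))) * (2 * (N * (1 / x)))) / (4 * N)) (at x)"
      unfolding F_def using x by (auto intro!: derivative_eq_intros)
    moreover have "(1 / x) / 2 + (cos (2 * (N * (ln x - ln l))) * (2 * (N * (1 / x)))) / (4 * N) = cos (N * (ln x - ln l)) ^ 2 / x"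
      unfolding cos_double_cos using x N by (simp add: field_simps)
    ultimately have "(F has_real_derivative cos (N * (ln x - ln l)) ^ 2 / x) (at x)" by simp
    then show "(F has_vector_derivative cos (N * (ln x - ln l)) ^ 2 / x) (at x within {a..b})"
      by (simp add: has_real_derivative_iff_has_vector_derivative has_vector_derivative_at_within)
  qed
  moreover have "F b - F a \<ge> 1 / 4"
  proof -
    have z: "ln b - ln l = 1 / 2" "ln a - ln l = - (1 / 2)" using l by (simp_all add: a_def b_def ln_mult)
    have "F b - F a = 1 / 2 + sin N / (2 * N)" unfolding F_def z using N by (simp add: field_simps)
    moreover have "- (1 / 4) \<le> sin N / (2 * N)"
    proof -
      have "- 1 \<le> sin N" by simp
      then have "- 1 / (2 * N) \<le> sin N / (2 * N)" using N by (intro divide_right_mono) auto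
      moreover have "1 / (2 * N) \<le> 1 / 4" using N by (intro divide_left_mono) auto
      ultimately show ?thesis by simp
    qed
    ultimately show ?thesis by linarith
  qed
  ultimately show thesis using that unfolding a_def b_def by blast
qed

lemma tendsto_zero_eventually_le:
  fixes f :: "'a \<Rightarrow> real"
  assumes "(f \<longlongrightarrow> 0) F" "0 < c"
  shows "\<forall>\<^sub>F x in F. f x \<le> c"
  using order_tendstoD(2)[OF assms] by (rule eventually_mono) simp

section \<open>Initial data and the comparison of two sequences\<close>

context packet_data
begin

text \<open>The cube of the sine is written as (3 sin x - sin (3 x)) / 4, so that the k-th
  derivative is a phase shift by k pi / 2 and one formula covers the derivatives of all
  orders.\<close>

definition Qd :: "real \<Rightarrow> (nat \<Rightarrow> bool) \<Rightarrow> nat \<Rightarrow> real \<Rightarrow> real" where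
  "Qd e c k x = e * ((3 * sin (x + real k * pi / 2) - 3 ^ k * sin (3 * x + real k * pi / 2)) / 4 + S c k x)"

lemma Qd_derivative: "(Qd e c k has_real_derivative Qd e c (Suc k) x) (at x)"
proof -
  have sh: "cos (y + real k * pi / 2) = sin (y + real (Suc k) * pi / 2)" for y
  proof -
    have "y + real (Suc k) * pi / 2 = (y + real k * pi / 2) + pi / 2" by (simp add: field_simps)
    then show ?thesis by (simp only: sin_add) simp
  qed
  have "((\<lambda>x. e * ((3 * sin (x + real k * pi / 2) - 3 ^ k * sin (3 * x + real k * pi / 2)) / 4 + S c k x)) has_real_derivative
      e * ((3 * cos (x + real k * pi / 2) - 3 ^ k * (cos (3 * x + real k * pi / 2) * 3)) / 4 + S c (Suc k) x)) (at x)"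
    by (intro DERIV_cmult DERIV_add S_derivative DERIV_cdivide DERIV_diff) (auto intro!: derivative_eq_intros)
  then show ?thesis unfolding Qd_def[abs_def] sh by (simp add: mult_ac)
qed

lemma Qd_0: "Qd e c 0 x = e * (sin x ^ 3 + S c 0 x)"
proof -
  have "sin (3 * x) = 3 * sin x - 4 * sin x ^ 3"
  proof -
    have "sin (3 * x) = sin (2 * x + x)" by simp
    also have "\<dots> = 2 * sin x * cos x ^ 2 + (1 - 2 * sin x ^ 2) * sin x"
      unfolding sin_add sin_double cos_double_sin by (simp add: power2_eq_square)
    also have "\<dots> = 3 * sin x - 4 * sin x ^ 3"
      unfolding cos_squared_eq by (simp add: algebra_simps power2_eq_square power3_eq_cube)
    finally show ?thesis .
  qed
  then show ?thesis by (simp add: Qd_def)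
qed

lemma Qd_zeros:
  assumes "z \<in> {0, pi}" "k \<le> 2"
  shows "Qd e c k z = 0"
proof -
  have S: "S c k z = 0" for k using S_zero[of z] assms(1) pi_gt3 by auto
  have s: "sin (3 * pi) = 0" "cos (3 * pi) = - 1" by (simp_all add: sin_times_pi_eq_0 cos_npi_numeral)
  consider "k = 0" | "k = 1" | "k = 2" using assms(2) by linarith
  then show ?thesis
  proof cases
    case 1 then show ?thesis using assms(1) S s by (auto simp: Qd_def)
  next
    case 2 then show ?thesis using assms(1) S s by (auto simp: Qd_def sin_add)
  next
    case 3 then show ?thesis using assms(1) S s by (auto simp: Qd_def sin_add)
  qed
qed

lemma Qd_third: "Qd e c 3 0 = 6 * e"
proof -
  have "sin (3 * pi / 2) = - (1::real)"
  proof -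
    have "3 * pi / 2 = pi + pi / 2" by simp
    then show ?thesis by (simp only: sin_add) simp
  qed
  then show ?thesis using S_zero[of 0 c 3] by (simp add: Qd_def)
qed

lemma Qd_torus: "torus_fun (Qd e c 0)"
  using S_periodic by (simp add: torus_fun_def Qd_0)

lemma Qd_smooth: "smooth_fun (Qd e c 0)"
  by (rule smooth_fun_chain) (rule Qd_derivative)

lemma Qd_Cnorm:
  obtains D where "D \<ge> 0" "\<And>e c. e > 0 \<Longrightarrow> Cnorm s0 (Qd e c 0) \<le> e * D"
proof -
  have "\<forall>k. \<exists>C\<ge>0. \<forall>c x. \<bar>S c k x\<bar> \<le> C" using S_bound by metis
  then obtain C where C: "\<And>k. C k \<ge> 0" "\<And>k c x. \<bar>S c k x\<bar> \<le> C k" by metis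
  define D where "D = (\<Sum>k\<le>s0. (3 + 3 ^ k) / 4 + C k)"
  have "Cnorm s0 (Qd e c 0) \<le> e * D" if e: "e > 0" for e c
  proof -
    have b: "\<bar>Qd e c k x\<bar> \<le> e * ((3 + 3 ^ k) / 4 + C k)" for k x
    proof -
      have lin: "\<bar>(a - b) / 4 + s\<bar> \<le> (3 + p) / 4 + r" if "\<bar>a\<bar> \<le> 3 * 1" "\<bar>b\<bar> \<le> p * 1" "\<bar>s\<bar> \<le> r" for a b s p r :: real
      proof -
        have "- 3 \<le> a" "a \<le> 3" "- p \<le> b" "b \<le> p" "- r \<le> s" "s \<le> r" using that by (simp_all add: abs_le_iff)
        then show ?thesis by (simp add: abs_le_iff field_simps)
      qed
      have "\<bar>3 ^ k * sin (3 * x + real k * pi / 2)\<bar> \<le> 3 ^ k * 1"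
        unfolding abs_mult by (intro mult_mono) auto
      moreover have "\<bar>3 * sin (x + real k * pi / 2)\<bar> \<le> 3 * 1"
        unfolding abs_mult by (intro mult_mono) auto
      ultimately have "\<bar>(3 * sin (x + real k * pi / 2) - 3 ^ k * sin (3 * x + real k * pi / 2)) / 4 + S c k x\<bar> \<le> (3 + 3 ^ k) / 4 + C k"
        using lin C(2)[of c k x] by blast
      then show ?thesis unfolding Qd_def abs_mult using e by (simp add: mult_left_mono)
    qed
    have "Cnorm s0 (Qd e c 0) \<le> (\<Sum>k\<le>s0. e * ((3 + 3 ^ k) / 4 + C k))"
      unfolding Cnorm_def deriv_chain[of "Qd e c", OF Qd_derivative] by (intro sum_mono cSUP_least b) auto
    then show ?thesis by (simp add: D_def sum_distrib_left)
  qed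
  moreover have "D \<ge> 0" unfolding D_def using C(1) by (intro sum_nonneg add_nonneg_nonneg) auto
  ultimately show thesis using that by blast
qed

text \<open>Exactly one of the two data contains packet \<open>n\<close>, so testing with a copy of
  it gives an initial pairing of size at least \<open>c2 * Qn\<close>. For large \<open>n\<close>
  the estimate along the travelling packet allows only half of that. How large \<open>n\<close> must
  be depends on the bound and the lifespan, not on the sequences or the solutions.\<close>

lemma first_difference_bound:
  assumes m: "m \<ge> 2" and s: "s \<ge> 6" and \<sigma>: "real s + \<alpha> - 1 > 0" and e: "e > 0"
    and small: "\<And>c x. 0 < x \<Longrightarrow> x \<le> 1 \<Longrightarrow> \<bar>S c 0 x\<bar> \<le> x ^ 3 / 16"
    and M: "M \<ge> 0" and \<delta>: "\<delta> > 0"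
  obtains n0 where "\<And>c c' U V n. classical \<alpha> \<mu> m s M \<delta> U \<Longrightarrow> classical \<alpha> \<mu> m s M \<delta> V \<Longrightarrow>
      (\<And>x. U 0 0 x = Qd e c 0 x) \<Longrightarrow> (\<And>x. V 0 0 x = Qd e c' 0 x) \<Longrightarrow>
      (\<And>i. i < n \<Longrightarrow> c i = c' i) \<Longrightarrow> c n \<noteq> c' n \<Longrightarrow> n < n0"
proof -
  \<comment> \<open>The cube of \<open>dpi x / 4 \<le> sin x\<close> gives 1 / 64 where no packets
    live; near 0 the cube of \<open>x / 2\<close> minus the packets leaves x^3 / 16, which is even
    more.\<close>
  have c0: "e / 64 > 0" using e by simp
  obtain t0 K where t0: "t0 > 0" "t0 \<le> \<delta>" and K: "K > 0" and good:
    "\<And>U V C. classical \<alpha> \<mu> m s M \<delta> U \<Longrightarrow> classical \<alpha> \<mu> m s M \<delta> V \<Longrightarrow>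
       (\<And>z k. z \<in> {0, pi} \<Longrightarrow> k \<le> 2 \<Longrightarrow> U k 0 z = 0 \<and> V k 0 z = 0) \<Longrightarrow> U 3 0 0 = 6 * e \<Longrightarrow>
       (\<And>x. x \<in> {0..pi} \<Longrightarrow> e / 64 * dpi x ^ 3 \<le> U 0 0 x) \<Longrightarrow>
       (\<And>x. x \<in> {0..pi} \<Longrightarrow> \<bar>U 0 0 x - V 0 0 x\<bar> \<le> C * dpi x ^ s) \<Longrightarrow>
       good_pair s e (e / 64 / 2) K t0 U V"
    by (rule short_time[OF s m M \<delta> c0, of \<alpha> \<mu> e]) blast
  obtain BG where BG: "BG > 0" "bump_jet (\<lambda>k. (deriv ^^ k) bump) BG" by (rule bump_jet_bump)
  define G where "G k = (deriv ^^ k) bump" for k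
  have c1: "e / 64 / 2 > 0" and K0: "K \<ge> 0" using e K by auto
  obtain C where C: "C > 0" and test:
    "\<And>U V \<rho> l N T Y. classical \<alpha> \<mu> m s M t0 U \<Longrightarrow> classical \<alpha> \<mu> m s M t0 V \<Longrightarrow>
      good_pair s e (e / 64 / 2) K t0 U V \<Longrightarrow> 0 < \<rho> \<Longrightarrow> \<rho> < pi / 2 \<Longrightarrow> 1 \<le> N \<Longrightarrow> 0 < l \<Longrightarrow> 3 * l \<le> 1 \<Longrightarrow> 0 \<le> T \<Longrightarrow> T \<le> t0 \<Longrightarrow>
      \<rho> \<le> l * exp (- (3 * e * N ^ 2 * T)) * exp (- 1) \<Longrightarrow> 0 < Y \<Longrightarrow>
      energy \<alpha> U V \<rho> 0 + \<rho> powr (2 * (real s + \<alpha> - 1)) \<le> Y \<Longrightarrow>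
      \<bar>pairing (\<alpha> - 2) l G e N U V \<rho> 0\<bar> \<le> C * (l * exp (- (3 * e * N ^ 2 * T))) powr (real s + \<alpha> - 1)
        + C * T * (N + (3 * l + T) * N ^ 3) * sqrt Y"
    by (rule testing_estimate[OF m s c1 t0(1) e K0 BG(2)[folded G_def], of \<alpha> \<mu> M]) blast
  obtain C2 where C2: "C2 > 0" "\<And>q. q \<in> jetset s M (e / 64 / 2) K \<Longrightarrow>
      \<bar>fst q 0 powr (2 * \<alpha> / 3 - 1)\<bar> \<le> C2 * \<bar>snd (snd q) powr (3 * (2 * \<alpha> / 3 - 1))\<bar>"
    using jetset_bounds(6)[OF m s c1, where M = M and K = K and r = "2 * \<alpha> / 3 - 1"] by (rule domE) blast
  define \<beta> where "\<beta> = \<alpha> - 3 / 2"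
  define \<sigma>' where "\<sigma>' = real s + \<alpha> - 1"
  \<comment> \<open>With this exponent \<open>\<theta> r n\<close> equals dd n * ll n powr (\<alpha>
    - 1), the natural size both of the initial pairing and of the square root of the initial energy.
    Likewise \<open>\<beta>\<close> is half the order 2 \<alpha> - 3 of the energy weight.\<close>
  define r where "r = - 16 * (\<alpha> - 1)"
  \<comment> \<open>The square is that of the weighted supremum of the difference, its factor 2
    coming from the tail bound; \<open>C2\<close> belongs to the energy weight, and 3 bounds e, the
    length of the support in units of its position.\<close>
  define C' where "C' = 3 * (C2 * e ^ 2 * (2 * (B * exp \<bar>\<beta>\<bar>)) ^ 2)"
  \<comment> \<open>The first exponential is the variation of x powr (\<alpha> - 1) across the
    packet, exp (- 8) the squared lower bound of \<open>bump\<close>, and 1 / 4 the integral of the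
    squared cosine.\<close>
  define c2 where "c2 = e * exp (- \<bar>\<alpha> - 1\<bar>) * exp (- 8) / 4"
  have C': "C' \<ge> 0" using C2(1) by (simp add: C'_def)
  have c2: "c2 > 0" using e by (simp add: c2_def)
  \<comment> \<open>Four requirements on j: the travelling time fits into the interval, the
    accumulated adjoint error and the bound on arrival each stay below a quarter of the initial
    pairing, and the tail bound for \<open>\<theta>\<close> applies.\<close>
  have ev: "\<forall>\<^sub>F j in at_top. 1 / (3 * e * j ^ 14) \<le> t0 \<and>
      C * sqrt (C' + 1) * (1 / (3 * e * j ^ 6) + 1 / (e * j ^ 6) + 1 / (9 * e ^ 2 * j ^ 4)) \<le> c2 / 4 \<and>
      C * (1 / j ^ 16 * exp (- (j ^ 2))) powr \<sigma>' \<le> c2 / 4 * (exp (- j) * j powr r) \<and>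
      \<bar>- 16 * \<beta>\<bar> + 1 \<le> j"
  proof (intro eventually_conj)
    have "((\<lambda>j. 1 / (3 * e * j ^ 14)) \<longlongrightarrow> 0) at_top" using e by real_asymp
    then show "\<forall>\<^sub>F j in at_top. 1 / (3 * e * j ^ 14) \<le> t0"
      using t0(1) by (rule tendsto_zero_eventually_le)
    have "((\<lambda>j. C * sqrt (C' + 1) * (1 / (3 * e * j ^ 6) + 1 / (e * j ^ 6) + 1 / (9 * e ^ 2 * j ^ 4))) \<longlongrightarrow> C * sqrt (C' + 1) * 0) at_top"
    proof (intro tendsto_mult tendsto_const)
      show "((\<lambda>j. 1 / (3 * e * j ^ 6) + 1 / (e * j ^ 6) + 1 / (9 * e ^ 2 * j ^ 4)) \<longlongrightarrow> 0) at_top" using e by real_asymp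
    qed
    then show "\<forall>\<^sub>F j in at_top. C * sqrt (C' + 1) * (1 / (3 * e * j ^ 6) + 1 / (e * j ^ 6) + 1 / (9 * e ^ 2 * j ^ 4)) \<le> c2 / 4"
      using c2 by (intro tendsto_zero_eventually_le) auto
    have s0: "\<sigma>' > 0" using \<sigma> by (simp add: \<sigma>'_def)
    have "((\<lambda>j::real. (1 / j ^ 16 * exp (- (j ^ 2))) powr \<sigma>' / (exp (- j) * j powr r)) \<longlongrightarrow> 0) at_top"
      using s0 by real_asymp
    then have "((\<lambda>j::real. C * ((1 / j ^ 16 * exp (- (j ^ 2))) powr \<sigma>' / (exp (- j) * j powr r))) \<longlongrightarrow> C * 0) at_top"
      by (intro tendsto_mult tendsto_const)
    then have "\<forall>\<^sub>F j in at_top. C * ((1 / j ^ 16 * exp (- (j ^ 2))) powr \<sigma>' / (exp (- j) * j powr r)) < c2 / 4"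
      using c2 by (intro order_tendstoD(2)) auto
    then show "\<forall>\<^sub>F j in at_top. C * (1 / j ^ 16 * exp (- (j ^ 2))) powr \<sigma>' \<le> c2 / 4 * (exp (- j) * j powr r)"
      using eventually_gt_at_top[of 0]
    proof eventually_elim
      case (elim j)
      have "exp (- j) * j powr r > 0" using elim by simp
      then show ?case using elim(1) by (simp add: pos_divide_less_eq less_imp_le)
    qed
    show "\<forall>\<^sub>F j in at_top. \<bar>- 16 * \<beta>\<bar> + 1 \<le> j" by (rule eventually_ge_at_top)
  qed
  then obtain J where J: "\<And>j. j \<ge> J \<Longrightarrow> 1 / (3 * e * j ^ 14) \<le> t0 \<and>
      C * sqrt (C' + 1) * (1 / (3 * e * j ^ 6) + 1 / (e * j ^ 6) + 1 / (9 * e ^ 2 * j ^ 4)) \<le> c2 / 4 \<and>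
      C * (1 / j ^ 16 * exp (- (j ^ 2))) powr \<sigma>' \<le> c2 / 4 * (exp (- j) * j powr r) \<and>
      \<bar>- 16 * \<beta>\<bar> + 1 \<le> j"
    unfolding eventually_at_top_linorder by blast
  obtain n0 :: nat where n0: "J \<le> real n0" using real_arch_simple by blast
  show thesis
  proof (rule that[of n0], rule ccontr)
    fix c c' U V n
    assume cU: "classical \<alpha> \<mu> m s M \<delta> U" and cV: "classical \<alpha> \<mu> m s M \<delta> V"
      and U0: "\<And>x. U 0 0 x = Qd e c 0 x" and V0: "\<And>x. V 0 0 x = Qd e c' 0 x"
      and eq: "\<And>i. i < n \<Longrightarrow> c i = c' i" and ne: "c n \<noteq> c' n" and "\<not> n < n0"
    define j where "j = jj n"
    define l where "l = ll n"
    define N where "N = NN n"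
    \<comment> \<open>The time in which the packet moves by \<open>j ^ 2\<close> in ln x.\<close>
    define \<tau> where "\<tau> = 1 / (3 * e * j ^ 14)"
    have "J \<le> j" using n0 \<open>\<not> n < n0\<close> jj(3)[of n] by (simp add: j_def)
    note Jj = J[OF this]
    have j: "j \<ge> 2" using jj(1) by (simp add: j_def)
    have lN: "l = 1 / j ^ 16" "N = j ^ 8" by (simp_all add: l_def N_def ll_def NN_def j_def)
    have sc: "N \<ge> 1" "l > 0" "l * exp 1 \<le> 1" "3 * l \<le> 1" using scales[of n] by (simp_all add: l_def N_def)
    have N2: "N \<ge> 2" unfolding lN using j power_increasing[of 1 8 j] by simp
    define Qn where "Qn = \<theta> r n"
    have Qn: "Qn > 0" unfolding Qn_def by (rule theta_pos)
    have Qdl: "Qn = dd n * l powr (\<alpha> - 1)" unfolding l_def theta_ll Qn_def r_def by simp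
    have W0: "U 0 0 x - V 0 0 x = e * (S c 0 x - S c' 0 x)" for x
      unfolding U0 V0 Qd_0 by (simp add: algebra_simps)
    have h_pi: "1 \<le> pi / 2" "1 < pi" "pi < 2 * pi" using pi_gt3 by auto
    have s3: "3 < s" "k \<le> 2 \<Longrightarrow> k < s" for k using s by auto
    have jetU: "U k 0 x = Qd e c k x" and jetV: "V k 0 x = Qd e c' k x" if "k < s" for k x
      using classical_initial_jets[of \<alpha> \<mu> m s M \<delta> U "Qd e c", OF cU _ Qd_derivative U0 that]
        classical_initial_jets[of \<alpha> \<mu> m s M \<delta> V "Qd e c'", OF cV _ Qd_derivative V0 that] \<delta> by auto
    have gp: "good_pair s e (e / 64 / 2) K t0 U V"
    proof (rule good[OF cU cV])
      show "U k 0 z = 0 \<and> V k 0 z = 0" if "z \<in> {0, pi}" "k \<le> 2" for z k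
        using jetU[OF s3(2)[OF that(2)]] jetV[OF s3(2)[OF that(2)]] Qd_zeros[OF that] by simp
      show "U 3 0 0 = 6 * e" using jetU[OF s3(1)] Qd_third by simp
      show "e / 64 * dpi x ^ 3 \<le> U 0 0 x" if x: "x \<in> {0..pi}" for x
      proof -
        have dp: "0 \<le> dpi x" "dpi x \<le> x" using x by (auto simp: dpi_def min_def)
        have "dpi x ^ 3 / 64 \<le> sin x ^ 3 + S c 0 x"
        proof (cases "0 < x \<and> x \<le> 1")
          case True
          have "(x / 2) ^ 3 \<le> sin x ^ 3" using sin_ge_quarter(2)[of x] True h_pi by (intro power_mono) auto
          moreover have "\<bar>S c 0 x\<bar> \<le> x ^ 3 / 16" using small True by blast
          moreover have "dpi x ^ 3 \<le> x ^ 3" using dp by (intro power_mono) auto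
          moreover have "(x / 2) ^ 3 = x ^ 3 / 8" by (simp add: power_divide)
          moreover have "0 \<le> x ^ 3" using True by simp
          ultimately show ?thesis by linarith
        next
          case False
          then have "x = 0 \<or> (1 \<le> x \<and> x < 2 * pi)" using x h_pi by auto
          then have "S c 0 x = 0" by (rule S_zero)
          moreover have "(dpi x / 4) ^ 3 \<le> sin x ^ 3" using sin_ge_dpi[OF x] dp by (intro power_mono) auto
          ultimately show ?thesis by (simp add: power_divide)
        qed
        then have "e * (dpi x ^ 3 / 64) \<le> e * (sin x ^ 3 + S c 0 x)" using e by (intro mult_left_mono) auto
        then show ?thesis unfolding U0 Qd_0 by simp
      qed
      \<comment> \<open>Starting the tail at 0 sums over all packets. This constant may be large:
        \<open>K\<close> and \<open>t0\<close> were fixed independently of it.\<close>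
      define CC where "CC = B * exp \<bar>- real s\<bar> * (\<Sum>i. \<theta> (- 16 * (- real s)) (i + 0))"
      have CC: "CC \<ge> 0" unfolding CC_def
        using B0 theta_summable theta_pos by (intro mult_nonneg_nonneg suminf_nonneg) (auto simp: less_imp_le)
      show "\<bar>U 0 0 x - V 0 0 x\<bar> \<le> (e * CC) * dpi x ^ s" if x: "x \<in> {0..pi}" for x
      proof (cases "0 < x \<and> x \<le> 1")
        case True
        have dx: "dpi x = x" using True h_pi by (simp add: dpi_def min_def)
        have "\<bar>S c 0 x - S c' 0 x\<bar> * x powr (- real s) \<le> CC"
          unfolding CC_def by (rule S_diff(1)) (use True h_pi in auto)
        moreover have "x powr (- real s) = 1 / x ^ s" using True by (simp add: powr_minus_divide powr_realpow)
        ultimately have "\<bar>S c 0 x - S c' 0 x\<bar> \<le> CC * x ^ s" using True by (simp add: pos_divide_le_eq)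
        then show ?thesis unfolding W0 dx abs_mult using e by (simp add: mult_left_mono)
      next
        case False
        then have z: "x = 0 \<or> (1 \<le> x \<and> x < 2 * pi)" using x h_pi by auto
        have "0 \<le> dpi x" using x by (auto simp: dpi_def min_def)
        then show ?thesis unfolding W0 S_zero[OF z] using e CC by simp
      qed
    qed
    have cU': "classical \<alpha> \<mu> m s M t0 U" and cV': "classical \<alpha> \<mu> m s M t0 V"
      using classical_mono[OF cU order_refl t0(2)] classical_mono[OF cV order_refl t0(2)] by auto
    \<comment> \<open>Small enough to lie to the left of the packet until it arrives, and to make
      the boundary term of the energy estimate at most \<open>Qn ^ 2\<close>.\<close>
    define \<rho> where "\<rho> = min (min 1 (l * exp (- (j ^ 2)) * exp (- 1))) (Qn powr (1 / \<sigma>'))"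
    have \<sigma>'0: "\<sigma>' > 0" using \<sigma> by (simp add: \<sigma>'_def)
    have \<rho>: "0 < \<rho>" "\<rho> < pi / 2" "\<rho> \<le> l * exp (- (j ^ 2)) * exp (- 1)" "\<rho> \<le> 1" "\<rho> \<le> Qn powr (1 / \<sigma>')"
      using sc(2) Qn pi_gt3 by (auto simp: \<rho>_def)
    have \<rho>l: "\<rho> \<le> l * exp (- 1)"
    proof -
      have "l * exp (- (j ^ 2)) * exp (- 1) \<le> l * 1 * exp (- 1)" using sc(2) by (intro mult_mono) auto
      then show ?thesis using \<rho>(3) by simp
    qed
    have \<rho>Q: "\<rho> powr (2 * (real s + \<alpha> - 1)) \<le> Qn ^ 2"
    proof -
      have "\<rho> powr (2 * \<sigma>') \<le> (Qn powr (1 / \<sigma>')) powr (2 * \<sigma>')" using \<rho> \<sigma>'0 by (intro powr_mono2) auto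
      also have "\<dots> = Qn powr 2" using \<sigma>'0 by (simp add: powr_powr)
      also have "\<dots> = Qn ^ 2" using Qn powr_realpow[of Qn 2] by simp
      finally show ?thesis by (simp add: \<sigma>'_def)
    qed
    have t00: "(0::real) \<in> {0..t0}" using t0 by simp
    define I where "I = {\<rho>..pi - \<rho>}"
    have I: "0 < x" "x < pi" if "x \<in> I" for x using that \<rho> by (auto simp: I_def)
    have cu: "continuous_on I (\<lambda>x. U 0 0 x)" and cv: "continuous_on I (\<lambda>x. V 0 0 x)"
      using classicalD(4)[OF cU, of 0 0] classicalD(4)[OF cV, of 0 0] s \<delta>
      by (auto intro!: continuous_at_imp_continuous_on DERIV_isCont)
    \<comment> \<open>The difference lives in \<open>x \<le> l * exp 1\<close> and its weighted size
      is a multiple of dd n * l powr \<beta>. Squaring and multiplying by the length, of order l,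
      gives \<open>Qn ^ 2\<close> because \<beta> + 1 / 2 = \<alpha> - 1.\<close>
    have en: "energy \<alpha> U V \<rho> 0 \<le> C' * Qn ^ 2"
    proof -
      define D where "D = C2 * e ^ 2 * (2 * (B * exp \<bar>\<beta>\<bar>) * \<theta> (- 16 * \<beta>) n) ^ 2"
      have D: "D \<ge> 0" using C2(1) by (simp add: D_def)
      have "\<bar>integral I (\<lambda>x. U 0 0 x powr (2 * \<alpha> / 3 - 1) * (U 0 0 x - V 0 0 x) ^ 2)\<bar> \<le> integral I (\<lambda>x. 0) + D * (l * exp 1 - 0)"
        unfolding I_def
      proof (rule integral_abs_le_supported)
        have "U 0 0 x \<noteq> 0" if "x \<in> I" for x using good_pair_pos[OF gp c1 t00 I[OF that]] by simp
        then have "continuous_on I (\<lambda>x. U 0 0 x powr (2 * \<alpha> / 3 - 1) * (U 0 0 x - V 0 0 x) ^ 2)"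
          by (intro continuous_on_mult continuous_on_powr continuous_on_const cu cv continuous_on_power continuous_on_diff) auto
        then show "(\<lambda>x. U 0 0 x powr (2 * \<alpha> / 3 - 1) * (U 0 0 x - V 0 0 x) ^ 2) integrable_on {\<rho>..pi - \<rho>}"
          unfolding I_def by (rule integrable_continuous_interval)
        show "0 \<le> l * exp 1" using sc(2) by simp
        fix x assume "x \<in> {\<rho>..pi - \<rho>}"
        then have xI: "x \<in> I" by (simp add: I_def)
        note x = I[OF xI]
        have x2: "x < 2 * pi" using x h_pi by linarith
        show "\<bar>U 0 0 x powr (2 * \<alpha> / 3 - 1) * (U 0 0 x - V 0 0 x) ^ 2\<bar> \<le> 0 + (if x \<in> {0..l * exp 1} then D else 0)"
        proof (cases "l * exp 1 \<le> x")
          case True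
          then have "U 0 0 x - V 0 0 x = 0" unfolding W0 using S_diff(2)[OF eq x(1) x2] by (simp add: l_def)
          then show ?thesis using D by simp
        next
          case False
          have x1: "x \<le> 1" using False sc(3) by linarith
          have dx: "dpi x = x" using x1 h_pi by (simp add: dpi_def min_def)
          have p: "U 0 0 x powr (2 * \<alpha> / 3 - 1) \<le> C2 * x powr (3 * (2 * \<alpha> / 3 - 1))"
            using C2(2)[OF good_pair_jetset[OF s cU' cV' gp t00 x, unfolded dx]] by simp
          have pb: "x powr (3 * (2 * \<alpha> / 3 - 1)) = (x powr \<beta>) ^ 2"
          proof -
            have "3 * (2 * \<alpha> / 3 - 1) = \<beta> + \<beta>" by (simp add: \<beta>_def algebra_simps)
            then show ?thesis by (simp only: powr_add power2_eq_square)
          qed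
          have "\<bar>S c 0 x - S c' 0 x\<bar> * x powr \<beta> \<le> B * exp \<bar>\<beta>\<bar> * (\<Sum>i. \<theta> (- 16 * \<beta>) (i + n))"
            by (rule S_diff(1)[OF eq x(1) x2])
          also have "\<dots> \<le> B * exp \<bar>\<beta>\<bar> * (2 * \<theta> (- 16 * \<beta>) n)"
            using Jj B0 unfolding j_def by (intro mult_left_mono theta_tail(2)) auto
          finally have sb: "\<bar>S c 0 x - S c' 0 x\<bar> * x powr \<beta> \<le> 2 * (B * exp \<bar>\<beta>\<bar>) * \<theta> (- 16 * \<beta>) n" by (simp add: mult_ac)
          have "\<bar>U 0 0 x powr (2 * \<alpha> / 3 - 1) * (U 0 0 x - V 0 0 x) ^ 2\<bar> \<le> (C2 * (x powr \<beta>) ^ 2) * (e ^ 2 * \<bar>S c 0 x - S c' 0 x\<bar> ^ 2)"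
            unfolding W0 abs_mult using p C2(1) unfolding pb by (intro mult_mono) (auto simp: power_mult_distrib)
          also have "\<dots> = C2 * e ^ 2 * (\<bar>S c 0 x - S c' 0 x\<bar> * x powr \<beta>) ^ 2" by (simp add: power_mult_distrib mult_ac)
          also have "\<dots> \<le> D" unfolding D_def using sb C2(1) by (intro mult_left_mono power_mono) auto
          finally show ?thesis using False x by auto
        qed
      qed (use D in auto)
      then have "energy \<alpha> U V \<rho> 0 \<le> D * (l * exp 1)" by (simp add: energy_def I_def)
      also have "\<dots> \<le> D * (l * 3)" using D sc(2) exp_le by (intro mult_left_mono) auto
      also have "\<dots> = C' * (\<theta> (- 16 * \<beta>) n ^ 2 * l)" by (simp add: D_def C'_def power_mult_distrib mult_ac)
      also have "\<theta> (- 16 * \<beta>) n ^ 2 * l = Qn ^ 2"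
      proof -
        have "\<theta> (- 16 * \<beta>) n = dd n * l powr \<beta>" unfolding l_def theta_ll ..
        moreover have "l = (l powr (1 / 2)) ^ 2" using sc(2) by (simp add: powr_half_sqrt)
        ultimately have "\<theta> (- 16 * \<beta>) n ^ 2 * l = (dd n * l powr \<beta> * l powr (1 / 2)) ^ 2" by (metis power_mult_distrib)
        also have "dd n * l powr \<beta> * l powr (1 / 2) = dd n * l powr (\<beta> + 1 / 2)" by (simp add: powr_add)
        also have "\<beta> + 1 / 2 = \<alpha> - 1" by (simp add: \<beta>_def)
        finally show ?thesis by (simp add: Qdl)
      qed
      finally show ?thesis .
    qed
    \<comment> \<open>At time 0 the test packet has the profile and frequency of packet
      \<open>n\<close> in the data, so up to the sign \<open>sg\<close> the integrand is a
      nonnegative weight times a square. The inner half of the packet already gives the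
      bound.\<close>
    have pairlow: "c2 * Qn \<le> \<bar>pairing (\<alpha> - 2) l G e N U V \<rho> 0\<bar>"
    proof -
      define sg :: real where "sg = of_bool (c n) - of_bool (c' n)"
      have sg: "\<bar>sg\<bar> = 1" using ne by (auto simp: sg_def)
      define q where "q x = e * dd n * (x powr (\<alpha> - 2) * (bump (ln x - ln l) * cos (N * (ln x - ln l))) ^ 2)" for x
      have q0: "0 \<le> q x" for x using e by (auto simp: q_def dd_def intro!: mult_nonneg_nonneg)
      have pk: "packet (\<alpha> - 2) l G e N 0 0 x = x powr (\<alpha> - 2) * (bump (ln x - ln l) * cos (N * (ln x - ln l)))" for x
        by (simp add: packet_def wq_def wpk_def G_def Let_def)
      have prod: "packet (\<alpha> - 2) l G e N 0 0 x * (U 0 0 x - V 0 0 x) = sg * q x" if xI: "x \<in> I" for x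
      proof (cases "l * exp (- 1) \<le> x")
        case True
        note x = I[OF xI]
        have x2: "x < 2 * pi" using x h_pi by linarith
        have "U 0 0 x - V 0 0 x = e * (sg * (dd n * (bump (ln x - ln l) * cos (N * (ln x - ln l)))))"
          unfolding W0 using S_diff(3)[OF eq x(1) x2] True T_eq[OF x(1) x2, of n] by (simp add: l_def N_def sg_def)
        then show ?thesis unfolding pk q_def by (simp add: power2_eq_square mult_ac)
      next
        case False
        note x = I[OF xI]
        have "\<bar>ln x - ln l\<bar> \<ge> 1"
        proof -
          have "l * exp (- 1) = exp (ln l - 1)" using sc(2) by (simp add: exp_diff exp_minus divide_inverse)
          then have "ln x \<le> ln l - 1" using False x by (metis exp_le_cancel_iff exp_ln linear)
          then show ?thesis by linarith
        qed
        moreover have "bumpf bump" using bumpf_deriv_bump[of 0] by simp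
        ultimately have "bump (ln x - ln l) = 0" using bumpf_support by blast
        then show ?thesis unfolding pk q_def by simp
      qed
      have pair: "pairing (\<alpha> - 2) l G e N U V \<rho> 0 = sg * integral I q"
      proof -
        have "pairing (\<alpha> - 2) l G e N U V \<rho> 0 = integral I (\<lambda>x. sg * q x)"
          unfolding pairing_def I_def[symmetric] by (rule integral_cong) (rule prod)
        then show ?thesis by simp
      qed
      have cq: "continuous_on I q"
      proof -
        have "continuous_on UNIV bump"
          using BG(2) unfolding bump_jet_def by (metis DERIV_isCont continuous_at_imp_continuous_on funpow_0 le0)
        then have cb: "continuous_on I (\<lambda>x. bump (ln x - ln l))"
          by (rule continuous_on_compose2) (use I in \<open>force intro!: continuous_intros\<close>, simp)
        show ?thesis unfolding q_def
          by (intro continuous_on_mult continuous_on_const continuous_on_power cb continuous_on_cos continuous_on_diff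
              continuous_on_ln continuous_on_id continuous_on_powr) (use I in force)+
      qed
      define a b where "a = l * exp (- (1 / 2))" and "b = l * exp (1 / 2)"
      have ab: "l * exp (- 1) \<le> a" "b \<le> l * exp 1" "0 < a" "a \<le> b" using sc(2) by (auto simp: a_def b_def)
      have sub: "{a..b} \<subseteq> I" using ab \<rho>l \<rho>(4) sc(3) pi_gt3 unfolding I_def by auto
      obtain i0 where i0: "((\<lambda>x. cos (N * (ln x - ln l)) ^ 2 / x) has_integral i0) {a..b}" "i0 \<ge> 1 / 4"
        using integral_cos_sq[OF sc(2) N2] unfolding a_def b_def by blast
      define k where "k = e * dd n * (exp (- \<bar>\<alpha> - 1\<bar>) * l powr (\<alpha> - 1) * exp (- 4) ^ 2)"
      have k0: "k \<ge> 0" using e by (simp add: k_def dd_def)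
      have "k * i0 \<le> integral {a..b} q"
      proof (rule has_integral_le[OF has_integral_mult_right[OF i0(1)]])
        show "(q has_integral integral {a..b} q) {a..b}"
          using continuous_on_subset[OF cq sub] by (intro integrable_integral integrable_continuous_interval)
        fix x assume x: "x \<in> {a..b}"
        have x0: "0 < x" using x ab by auto
        have z: "\<bar>ln x - ln l\<bar> \<le> 1 / 2"
        proof -
          have "ln a = ln l - 1 / 2" "ln b = ln l + 1 / 2"
            using sc(2) by (simp_all add: a_def b_def ln_mult)
          moreover have "ln a \<le> ln x" "ln x \<le> ln b" using x x0 ab by auto
          ultimately show ?thesis by linarith
        qed
        have "x powr (- (\<alpha> - 1)) \<le> exp \<bar>- (\<alpha> - 1)\<bar> * l powr (- (\<alpha> - 1))"
          by (rule powr_le_near) (use sc(2) x ab in auto)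
        then have "1 / x powr (\<alpha> - 1) \<le> exp \<bar>\<alpha> - 1\<bar> / l powr (\<alpha> - 1)"
          by (simp only: abs_minus_cancel powr_minus_divide times_divide_eq_right mult_1_right)
        then have pw: "exp (- \<bar>\<alpha> - 1\<bar>) * l powr (\<alpha> - 1) \<le> x powr (\<alpha> - 1)"
          using x0 sc(2) by (simp add: exp_minus field_simps)
        have bb: "exp (- 4) ^ 2 \<le> bump (ln x - ln l) ^ 2" using bump_lower[OF z] by (intro power_mono) auto
        have "k * (cos (N * (ln x - ln l)) ^ 2 / x) = e * dd n * ((exp (- \<bar>\<alpha> - 1\<bar>) * l powr (\<alpha> - 1)) * exp (- 4) ^ 2 * (cos (N * (ln x - ln l)) ^ 2 / x))"
          by (simp add: k_def)
        also have "\<dots> \<le> e * dd n * (x powr (\<alpha> - 1) * bump (ln x - ln l) ^ 2 * (cos (N * (ln x - ln l)) ^ 2 / x))"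
          using e x0 pw bb by (intro mult_left_mono mult_right_mono mult_mono) (auto simp: dd_def)
        also have "\<dots> = q x"
        proof -
          have "x powr (\<alpha> - 1) = x powr (\<alpha> - 2) * x"
            using x0 powr_add[of x "\<alpha> - 2" 1] by simp
          then show ?thesis using x0 by (simp add: q_def power_mult_distrib)
        qed
        finally show "k * (cos (N * (ln x - ln l)) ^ 2 / x) \<le> q x" .
      qed
      also have "\<dots> \<le> integral I q"
      proof (rule integral_subset_le[OF sub])
        show "q integrable_on {a..b}" using continuous_on_subset[OF cq sub] by (rule integrable_continuous_interval)
        show "q integrable_on I" using cq unfolding I_def by (rule integrable_continuous_interval)
      qed (use q0 in auto)
      finally have 1: "k * i0 \<le> integral I q" .
      have "k * (1 / 4) \<le> k * i0" using k0 i0(2) by (intro mult_left_mono) auto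
      also have "k * (1 / 4) = c2 * Qn"
        unfolding k_def c2_def Qdl by (simp add: power2_eq_square flip: exp_add)
      finally have 2: "c2 * Qn \<le> integral I q" using 1 by linarith
      have "\<bar>pairing (\<alpha> - 2) l G e N U V \<rho> 0\<bar> = \<bar>integral I q\<bar>" unfolding pair abs_mult sg by simp
      then show ?thesis using 2 by linarith
    qed
    have \<tau>: "0 \<le> \<tau>" "\<tau> \<le> t0" using e j Jj by (auto simp: \<tau>_def)
    have ph: "3 * e * N ^ 2 * \<tau> = j ^ 2"
      unfolding \<tau>_def lN using e j by (simp add: field_simps flip: power_mult power_add)
    have Y0: "0 < (C' + 1) * Qn ^ 2" using C' Qn by (simp add: add_nonneg_pos)
    have EY: "energy \<alpha> U V \<rho> 0 + \<rho> powr (2 * (real s + \<alpha> - 1)) \<le> (C' + 1) * Qn ^ 2"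
      using en \<rho>Q by (simp add: algebra_simps)
    have "\<bar>pairing (\<alpha> - 2) l G e N U V \<rho> 0\<bar> \<le> C * (l * exp (- (3 * e * N ^ 2 * \<tau>))) powr (real s + \<alpha> - 1)
        + C * \<tau> * (N + (3 * l + \<tau>) * N ^ 3) * sqrt ((C' + 1) * Qn ^ 2)"
      by (rule test[OF cU' cV' gp \<rho>(1,2) sc(1,2,4) \<tau> _ Y0 EY]) (use \<rho>(3) ph in simp)
    also have "C * (l * exp (- (3 * e * N ^ 2 * \<tau>))) powr (real s + \<alpha> - 1) \<le> c2 / 4 * Qn"
      using Jj unfolding ph lN(1) \<sigma>'_def[symmetric] Qn_def \<theta>_def j_def by simp
    also have "C * \<tau> * (N + (3 * l + \<tau>) * N ^ 3) * sqrt ((C' + 1) * Qn ^ 2) \<le> c2 / 4 * Qn"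
    proof -
      have "\<tau> * (N + (3 * l + \<tau>) * N ^ 3) = 1 / (3 * e * j ^ 6) + 1 / (e * j ^ 6) + 1 / (9 * e ^ 2 * j ^ 4)"
      proof -
        have jn: "j \<noteq> 0" "e \<noteq> 0" using j e by auto
        have "\<tau> * N = 1 / (3 * e * j ^ 6)"
          unfolding \<tau>_def lN using jn by (simp add: field_simps flip: power_add)
        moreover have "\<tau> * (3 * l * N ^ 3) = 1 / (e * j ^ 6)"
          unfolding \<tau>_def lN using jn by (simp add: field_simps flip: power_add power_mult)
        moreover have "\<tau> * (\<tau> * N ^ 3) = 1 / (9 * e ^ 2 * j ^ 4)"
          unfolding \<tau>_def lN using jn by (simp add: field_simps power2_eq_square flip: power_add power_mult)
        ultimately show ?thesis by (simp add: distrib_left distrib_right)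
      qed
      then have "C * \<tau> * (N + (3 * l + \<tau>) * N ^ 3) * sqrt ((C' + 1) * Qn ^ 2)
          = (C * sqrt (C' + 1) * (1 / (3 * e * j ^ 6) + 1 / (e * j ^ 6) + 1 / (9 * e ^ 2 * j ^ 4))) * Qn"
        using Qn by (simp add: real_sqrt_mult mult_ac)
      also have "\<dots> \<le> c2 / 4 * Qn" using Jj Qn by (intro mult_right_mono) auto
      finally show ?thesis .
    qed
    finally have "\<bar>pairing (\<alpha> - 2) l G e N U V \<rho> 0\<bar> \<le> c2 / 4 * Qn + c2 / 4 * Qn" by simp
    moreover have "c2 / 4 * Qn = (c2 * Qn) / 4" "0 < c2 * Qn" using c2 Qn by simp_all
    ultimately show False using pairlow by linarith
  qed
qed

end

section \<open>Counting the sequences that admit a solution\<close>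

lemma finite_agreement_classes:
  assumes "\<And>c c' n. c \<in> A \<Longrightarrow> c' \<in> A \<Longrightarrow> (\<And>i. i < n \<Longrightarrow> c i = c' i) \<Longrightarrow> c n \<noteq> c' n \<Longrightarrow> n < (n0 :: nat)"
  shows "finite (A :: (nat \<Rightarrow> bool) set)"
proof -
  have "inj_on (\<lambda>c. {i. i < n0 \<and> c i}) A"
  proof (rule inj_onI, rule ccontr)
    fix c c' assume c: "c \<in> A" "c' \<in> A" "{i. i < n0 \<and> c i} = {i. i < n0 \<and> c' i}" "c \<noteq> c'"
    then obtain k where "c k \<noteq> c' k" by auto
    define n where "n = (LEAST k. c k \<noteq> c' k)"
    have "c n \<noteq> c' n" unfolding n_def by (rule LeastI) (rule \<open>c k \<noteq> c' k\<close>)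
    moreover have "c i = c' i" if "i < n" for i using not_less_Least[of i "\<lambda>k. c k \<noteq> c' k"] that by (auto simp: n_def)
    ultimately have "n < n0" using assms[OF c(1,2)] by blast
    then show False using c(3) \<open>c n \<noteq> c' n\<close> by (auto simp: set_eq_iff)
  qed
  moreover have "(\<lambda>c. {i. i < n0 \<and> c i}) ` A \<subseteq> Pow {..<n0}" by auto
  ultimately show ?thesis using finite_imageD finite_subset finite_Pow_iff finite_lessThan by metis
qed

lemma uncountable_nat_bool: "\<not> countable (UNIV :: (nat \<Rightarrow> bool) set)"
proof
  assume "countable (UNIV :: (nat \<Rightarrow> bool) set)"
  then obtain f :: "nat \<Rightarrow> nat \<Rightarrow> bool" where "range f = UNIV" using uncountable_def by (metis UNIV_not_empty)
  then obtain n where "f n = (\<lambda>k. \<not> f k k)" by (metis rangeE UNIV_I)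
  then show False by (metis)
qed

theorem theorem1p5:
  fixes \<alpha>1 \<mu>1 \<epsilon> :: real and m s s0 :: nat
  assumes "m \<ge> 2" and "\<epsilon> > 0"
    and "s_c \<alpha>1 \<le> int s" and "s \<le> s0" and "even s"
  shows "\<exists>u0. torus_fun u0 \<and> smooth_fun u0 \<and> Cnorm s0 u0 < \<epsilon> \<and>
           (\<forall>\<delta>>0. \<not> (\<exists>u. is_Linf_Cs_solution \<alpha>1 \<mu>1 m u0 \<delta> s u))"
proof -
  have "5 \<le> s" "\<lfloor>sigma_c \<alpha>1 - 1 / 2\<rfloor> + 1 \<le> int s" using assms(3) by (auto simp: s_c_def)
  \<comment> \<open>Parity excludes 5. Order 5 is thereby available as a continuous function, as the
    twice differentiated equation requires.\<close>
  then have s: "6 \<le> s" using assms(5) by (cases "s = 5") auto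
  \<comment> \<open>\<open>sigma_c \<alpha>1 - 1 / 2\<close> is \<open>1 - \<alpha>1\<close>, so the
    floor in \<open>s_c\<close> yields exactly the strict inequality that makes the flux and the
    arrival bound small.\<close>
  have \<sigma>: "real s + \<alpha>1 - 1 > 0"
  proof -
    have "sigma_c \<alpha>1 - 1 / 2 < of_int \<lfloor>sigma_c \<alpha>1 - 1 / 2\<rfloor> + 1" by linarith
    also have "\<dots> \<le> real s" using \<open>\<lfloor>sigma_c \<alpha>1 - 1 / 2\<rfloor> + 1 \<le> int s\<close> by linarith
    finally show ?thesis by (simp add: sigma_c_def)
  qed
  obtain FF where FF: "FF 0 = (\<lambda>N z. bump z * cos (N * z))" "\<And>k. fam k (FF k)"
    "\<And>k N l x. l > 0 \<Longrightarrow> (logscale (FF k) k N l has_real_derivative logscale (FF (Suc k)) (Suc k) N l x) (at x)"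
    by (rule fam_sequence) blast
  have "bumpf bump" using bumpf_deriv_bump[of 0] by simp
  then obtain B where B_bound: "B > 0" "\<And>z. \<bar>bump z\<bar> \<le> B" by (rule bumpf_bounded) blast
  \<comment> \<open>Anticipates the bound of \<open>S_diff\<close> with weight exponent - 3 against
    the empty sequence: \<open>exp 3\<close> and 48 = 16 * 3 come from the weight, the factor 2 from
    the tail. The further demand \<open>6 \<le> n\<close> makes \<open>jj 0\<close> at least 64,
    above the 49 that the tail bound asks for.\<close>
  have "((\<lambda>n. B * exp 3 * (2 * (exp (- (2 ^ n)) * (2 ^ n) powr 48))) \<longlongrightarrow> B * exp 3 * (2 * 0)) at_top"
  proof (intro tendsto_mult tendsto_const)
    have "((\<lambda>j::real. exp (- j) * j powr 48) \<longlongrightarrow> 0) at_top" by real_asymp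
    moreover have "filterlim (\<lambda>n::nat. (2::real) ^ n) at_top at_top" by real_asymp
    ultimately show "((\<lambda>n::nat. exp (- (2 ^ n)) * (2 ^ n :: real) powr 48) \<longlongrightarrow> 0) at_top" by (rule filterlim_compose)
  qed
  then have "\<forall>\<^sub>F n::nat in at_top. B * exp 3 * (2 * (exp (- (2 ^ n)) * (2 ^ n) powr 48)) \<le> 1 / 16"
    by (intro tendsto_zero_eventually_le) auto
  then have "\<forall>\<^sub>F n::nat in at_top. B * exp 3 * (2 * (exp (- (2 ^ n)) * (2 ^ n) powr 48)) \<le> 1 / 16 \<and> 6 \<le> n"
    by (intro eventually_conj eventually_ge_at_top)
  from eventually_happens'[OF sequentially_bot this]
  obtain n1 :: nat where n1_large: "B * exp 3 * (2 * (exp (- (2 ^ n1)) * (2 ^ n1) powr 48)) \<le> 1 / 16" "6 \<le> n1"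
    by blast
  interpret packet_data FF n1 B
    by unfold_locales (use FF B_bound n1_large in auto)
  have small: "\<bar>S c 0 x\<bar> \<le> x ^ 3 / 16" if x: "0 < x" "x \<le> 1" for c x
  proof -
    have F: "S (\<lambda>_. False) 0 x = 0" by (simp add: S_def)
    have "(2::real) ^ 6 \<le> 2 ^ n1" using n1_large(2) by (intro power_increasing) auto
    then have j0: "jj 0 \<ge> \<bar>- 16 * (- 3 :: real)\<bar> + 1" by (simp add: jj_def)
    have "\<bar>S c 0 x - S (\<lambda>_. False) 0 x\<bar> * x powr (- 3) \<le> B * exp \<bar>- 3\<bar> * (\<Sum>i. \<theta> (- 16 * - 3) (i + 0))"
      by (rule S_diff(1)) (use x pi_gt3 in auto)
    also have "\<dots> \<le> B * exp \<bar>- 3\<bar> * (2 * \<theta> (- 16 * - 3) 0)"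
      using B_bound(1) by (intro mult_left_mono theta_tail(2)[OF j0]) auto
    also have "\<dots> \<le> 1 / 16" using n1_large(1) by (simp add: \<theta>_def jj_def)
    finally have "\<bar>S c 0 x\<bar> * x powr (- 3) \<le> 1 / 16" by (simp add: F)
    moreover have "x powr (- 3) = 1 / x ^ 3" using x powr_realpow[of x 3] by (simp add: powr_minus_divide)
    ultimately show ?thesis using x by (simp add: pos_divide_le_eq)
  qed
  obtain D where D: "D \<ge> 0" "\<And>e c. e > 0 \<Longrightarrow> Cnorm s0 (Qd e c 0) \<le> e * D" using Qd_Cnorm by blast
  \<comment> \<open>The norm of the data is at most a multiple of \<open>e\<close>, uniformly in the
    sequence, so one \<open>e\<close> serves all of them. The factor 2 gives strictness and the
    summand 1 protects against \<open>D = 0\<close>.\<close>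
  define e where "e = \<epsilon> / (2 * (D + 1))"
  have e: "e > 0" using assms(2) D(1) by (simp add: e_def)
  have "e * D < \<epsilon>"
  proof -
    have "e * D \<le> e * (D + 1)" using e by (intro mult_left_mono) auto
    also have "\<dots> = \<epsilon> / 2" using D(1) by (simp add: e_def field_simps)
    finally show ?thesis using assms(2) by linarith
  qed
  then have norm: "Cnorm s0 (Qd e c 0) < \<epsilon>" for c using D(2)[OF e, of c] by linarith
  have "\<exists>c. \<forall>\<delta>>0. \<not> (\<exists>u. is_Linf_Cs_solution \<alpha>1 \<mu>1 m (Qd e c 0) \<delta> s u)"
  proof (rule ccontr)
    assume "\<not> ?thesis"
    then have all: "\<exists>\<delta>>0. \<exists>u. is_Linf_Cs_solution \<alpha>1 \<mu>1 m (Qd e c 0) \<delta> s u" for c by blast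
    \<comment> \<open>One index serves for both the bound and the lifespan. By
      \<open>classical_mono\<close> a solution with any bound and lifespan puts its sequence into
      some \<open>A i\<close>, while two members of the same \<open>A i\<close> can be compared on
      equal terms.\<close>
    define A where "A i = {c. \<exists>U. classical \<alpha>1 \<mu>1 m s (real i) (1 / real (Suc i)) U \<and> (\<forall>x. U 0 0 x = Qd e c 0 x)}" for i
    have "finite (A i)" for i
    proof -
      have i0: "0 \<le> real i" "0 < 1 / real (Suc i)" by auto
      obtain n0 where n0: "\<And>c c' U V n. classical \<alpha>1 \<mu>1 m s (real i) (1 / real (Suc i)) U \<Longrightarrow>
          classical \<alpha>1 \<mu>1 m s (real i) (1 / real (Suc i)) V \<Longrightarrow>
          (\<And>x. U 0 0 x = Qd e c 0 x) \<Longrightarrow> (\<And>x. V 0 0 x = Qd e c' 0 x) \<Longrightarrow>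
          (\<And>i. i < n \<Longrightarrow> c i = c' i) \<Longrightarrow> c n \<noteq> c' n \<Longrightarrow> n < n0"
        by (rule first_difference_bound[OF assms(1) s \<sigma> e small i0, of \<mu>1]) (assumption+, erule that)
      show ?thesis
      proof (rule finite_agreement_classes[of _ n0])
        fix c c' n assume "c \<in> A i" "c' \<in> A i" and d: "\<And>i. i < n \<Longrightarrow> c i = c' i" "c n \<noteq> c' n"
        then obtain U V where UV: "classical \<alpha>1 \<mu>1 m s (real i) (1 / real (Suc i)) U" "\<And>x. U 0 0 x = Qd e c 0 x"
          "classical \<alpha>1 \<mu>1 m s (real i) (1 / real (Suc i)) V" "\<And>x. V 0 0 x = Qd e c' 0 x"
          unfolding A_def by blast
        show "n < n0" by (rule n0[OF UV(1,3,2,4) d])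
      qed
    qed
    then have "countable (A i)" for i by (rule countable_finite)
    then have "countable (\<Union>i. A i)" by (rule countable_UN[OF countableI_type])
    moreover have "c \<in> (\<Union>i. A i)" for c
    proof -
      obtain \<delta> u where \<delta>: "\<delta> > 0" "is_Linf_Cs_solution \<alpha>1 \<mu>1 m (Qd e c 0) \<delta> s u" using all by blast
      obtain M U where U: "classical \<alpha>1 \<mu>1 m s M (\<delta> / 2) U" "\<And>x. U 0 0 x = Qd e c 0 x"
        by (rule classical_of_solution[OF \<delta>(2,1)]) (use s assms(1) in auto)
      obtain i1 :: nat where i1: "M \<le> real i1" using real_arch_simple by blast
      obtain i2 :: nat where i2: "1 / (\<delta> / 2) \<le> real i2" using real_arch_simple by blast
      define i where "i = max i1 i2"
      have "1 / (\<delta> / 2) \<le> real (Suc i)" using i2 by (simp add: i_def)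
      then have "1 / real (Suc i) \<le> \<delta> / 2" using \<delta>(1) by (simp add: field_simps)
      moreover have "M \<le> real i" using i1 by (simp add: i_def)
      ultimately have "classical \<alpha>1 \<mu>1 m s (real i) (1 / real (Suc i)) U" using classical_mono[OF U(1)] by blast
      then have "c \<in> A i" using U(2) unfolding A_def by blast
      then show ?thesis by blast
    qed
    ultimately have "countable (UNIV :: (nat \<Rightarrow> bool) set)" by (metis UNIV_eq_I)
    then show False using uncountable_nat_bool by blast
  qed
  then obtain c where "\<forall>\<delta>>0. \<not> (\<exists>u. is_Linf_Cs_solution \<alpha>1 \<mu>1 m (Qd e c 0) \<delta> s u)" by blast
  then show ?thesis using Qd_torus Qd_smooth norm by blast
qed

end
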